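(* Let $\mathbb{T}^d$ be the torus, $T>0$, $\nu>0$. Let $g\in\mathcal{D}_\nu$ (an incompressible $\nu$-Brownian diffusion) be the solution of the following stochastic differential equation on $\mathbb{T}^d$: $$dg_t=\sqrt{2\nu}\,dw_t-u(T-t,g_t)\,dt,\qquad g_0\in\mathbb{T}^d,$$ where $g_0$ is a random variable having $dx$ as law, $w_t$ is the standard Brownian motion on $\mathbb{R}^d$, and $\{u(t,x);\,t\in[0,T]\}$ is a family of $C^2$ vector fields on $\mathbb{T}^d$ which is a strong solution of the Navier-Stokes equation $$\frac{\partial}{\partial t}u(t,x)+\nabla u(t,x)\cdot u(t,x)-\nu\,\Delta u(t,x)=-\nabla p(T-t,x).$$ Assume that the process $g$ is associated with the Navier-Stokes equation in the sense that $$D_tD_tg=-\nabla p(t,g_t)\quad\text{a.s.}$$ for a regular pressure $p$ such that $\nabla^2p(t,x)\le R\,\mathrm{Id}$, with $RT^2\le\pi^2$. Then $g$ minimizes the energy $S$ in the class $$\mathcal{G}=\bigl\{g^*\in\mathcal{S}_\nu:\ dg^*_t=\sqrt{2\nu}\,dw_t+D_tg^*\,dt,\ g^*(0)=g(0),\ g^*(T)=g(T)\bigr\}.$$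
   Context: $dx$ is the normalized Lebesgue measure on $\mathbb{T}^d$; vector fields on $\mathbb{T}^d$ are identified with vector fields on $\mathbb{R}^d$ which are $2\pi$-periodic with respect to each space component. The semimartingales in $\mathcal{G}$ are all defined on the same probability space, with the same Brownian motion $w$ as for $g$. $\nabla^2p$ is the Hessian of $p$ in $x$, and $R$ is a real constant. For a semimartingale $\xi$ on the flat torus (tangent spaces being identified with $\mathbb{R}^d$), or an $\mathbb{R}^d$-valued semimartingale such as $D_tg$, $D_t\xi=\lim_{\varepsilon\to0}\mathbb{E}\bigl(\frac{\zeta_{t+\varepsilon}-\zeta_t}{\varepsilon}\big|\mathcal{F}_t\bigr)$ with $\zeta_t=\int_0^t\circ\,d\xi_s$ (an $\mathbb{R}^d$-valued semimartingale), i.e. $D_t\xi$ is the drift of $\xi$; here $D_tg=-u(T-t,g_t)$. The energy is $S(g)=\frac12\mathbb{E}\bigl(\int_0^T|D_tg|^2\,dt\bigr)$. A semimartingale $g$ on $\mathbb{T}^d$ with $g_0$ of law $dx$ is incompressible if $\mathbb{E}[f(g_t)]=\int_{\mathbb{T}^d}f(x)\,dx$ for all $t>0$ and $f\in C(\mathbb{T}^d)$. It is $\nu$-Brownian if there is a time-dependent adapted random vector field $u_t$ over $g_t$ such that for $f\in C^2(\mathbb{T}^d)$, $M^f_t=f(g_t)-f(g_0)-\int_0^t(\nu\Delta f(g_s)+\langle u_s,\nabla f(g_s)\rangle)\,ds$ is a continuous local martingale, with $\langle M^{f_1},M^{f_2}\rangle_t=2\nu\int_0^t\langle\nabla f_1,\nabla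 f_2\rangle(g_s)\,ds$. $\mathcal{S}_\nu$ is the set of incompressible $\nu$-Brownian semimartingales, and $\mathcal{D}_\nu\subset\mathcal{S}_\nu$ the set of incompressible $\nu$-Brownian diffusions.
   Formalization: The condition g*(T)=g(T) (with g*(0)=g(0)) is taken for continuous lifts to R^d, not on the torus: on the torus the claim fails, e.g. p=0, R=0, u=(2π/T)e_1, where the zero-drift process has the same endpoints on the torus but zero energy. *)

theory Defs
  imports "HOL-Probability.Probability" "HOL-Library.Real_Mod"
begin

section \<open>The flat torus\<close>

text \<open>
  The torus is \<open>\<real>\<^sup>d / (2 \<pi> \<int>)\<^sup>d\<close> with \<open>d = CARD('n)\<close>. Functions and vector fields on it are
  the \<open>2 \<pi>\<close>-periodic functions and vector fields on \<open>\<real>\<^sup>d\<close>. A continuous torus-valued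
  process \<open>g\<close> is represented by a continuous lift to \<open>\<real>\<^sup>d\<close>, so that \<open>g t - g 0\<close> is the
  \<open>\<real>\<^sup>d\<close>-valued process \<open>\<zeta>\<^sub>t = \<integral>\<^sub>0\<^sup>t \<circ> dg\<close>, and a function \<open>f\<close> on the torus is evaluated
  along \<open>g\<close> as \<open>f (g t \<omega>)\<close> with \<open>f\<close> periodic.
\<close>

definition periodic :: "(real ^ 'n \<Rightarrow> 'b) \<Rightarrow> bool" where
  "periodic f \<longleftrightarrow> (\<forall>x i. f (x + (2 * pi) *\<^sub>R axis i 1) = f x)"

definition torus_rep :: "real ^ 'n \<Rightarrow> real ^ 'n" where
  "torus_rep x = (\<chi> i. x $ i rmod (2 * pi))"

definition torus_measure :: "(real ^ 'n) measure" where
  "torus_measure = uniform_measure lborel (cbox 0 (\<chi> i. 2 * pi))"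

definition partial :: "'n \<Rightarrow> (real ^ 'n \<Rightarrow> 'b::real_normed_vector) \<Rightarrow> real ^ 'n \<Rightarrow> 'b" where
  "partial i f x = frechet_derivative f (at x) (axis i 1)"

definition C1 :: "(real ^ 'n \<Rightarrow> 'b::real_normed_vector) \<Rightarrow> bool" where
  "C1 f \<longleftrightarrow> (\<forall>x. f differentiable (at x)) \<and> (\<forall>i. continuous_on UNIV (partial i f))"

definition C2 :: "(real ^ 'n \<Rightarrow> 'b::real_normed_vector) \<Rightarrow> bool" where
  "C2 f \<longleftrightarrow> C1 f \<and> (\<forall>i. C1 (partial i f))"

definition grad :: "(real ^ 'n \<Rightarrow> real) \<Rightarrow> real ^ 'n \<Rightarrow> real ^ 'n" where
  "grad f x = (\<chi> i. partial i f x)"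

definition hessian :: "(real ^ 'n \<Rightarrow> real) \<Rightarrow> real ^ 'n \<Rightarrow> real ^ 'n ^ 'n" where
  "hessian f x = (\<chi> i j. partial i (partial j f) x)"

definition laplacian :: "(real ^ 'n \<Rightarrow> 'b::real_normed_vector) \<Rightarrow> real ^ 'n \<Rightarrow> 'b" where
  "laplacian f x = (\<Sum>i\<in>UNIV. partial i (partial i f) x)"


section \<open>Martingales and Brownian motion on \<open>[0, T]\<close>\<close>

text \<open>
  All processes live on the time interval \<open>[0, T]\<close>; their values, and the filtration, outside
  of it are irrelevant. The usual conditions are not imposed on the filtration.
\<close>

definition filtered_prob_space :: "'a measure \<Rightarrow> (real \<Rightarrow> 'a measure) \<Rightarrow> bool" where
  "filtered_prob_space M F \<longleftrightarrow>
     prob_space M \<and> filtration (space M) F \<and> (\<forall>t. subalgebra M (F t))"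

definition adapted ::
  "(real \<Rightarrow> 'a measure) \<Rightarrow> real \<Rightarrow> (real \<Rightarrow> 'a \<Rightarrow> 'b::topological_space) \<Rightarrow> bool" where
  "adapted F T X \<longleftrightarrow> (\<forall>t\<in>{0..T}. X t \<in> borel_measurable (F t))"

definition jointly_measurable ::
  "'a measure \<Rightarrow> real \<Rightarrow> (real \<Rightarrow> 'a \<Rightarrow> 'b::topological_space) \<Rightarrow> bool" where
  "jointly_measurable M T X \<longleftrightarrow>
     (\<lambda>(t, \<omega>). X t \<omega>) \<in> borel_measurable (restrict_space borel {0..T} \<Otimes>\<^sub>M M)"

definition martingale ::
  "'a measure \<Rightarrow> (real \<Rightarrow> 'a measure) \<Rightarrow> real \<Rightarrow> (real \<Rightarrow> 'a \<Rightarrow> real) \<Rightarrow> bool" where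
  "martingale M F T X \<longleftrightarrow>
     adapted F T X \<and> (\<forall>t\<in>{0..T}. integrable M (X t)) \<and>
     (\<forall>s t. 0 \<le> s \<longrightarrow> s \<le> t \<longrightarrow> t \<le> T \<longrightarrow>
        (AE \<omega> in M. real_cond_exp M (F s) (X t) \<omega> = X s \<omega>))"

text \<open>On the closed interval \<open>[0, T]\<close> a localizing sequence has to reach \<open>T\<close> after finitely
  many steps, almost surely.\<close>

definition continuous_local_martingale ::
  "'a measure \<Rightarrow> (real \<Rightarrow> 'a measure) \<Rightarrow> real \<Rightarrow> (real \<Rightarrow> 'a \<Rightarrow> real) \<Rightarrow> bool" where
  "continuous_local_martingale M F T X \<longleftrightarrow>
     adapted F T X \<and> (AE \<omega> in M. continuous_on {0..T} (\<lambda>t. X t \<omega>)) \<and>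
     (\<exists>\<tau> :: nat \<Rightarrow> 'a \<Rightarrow> real.
        (\<forall>n. stopping_time F (\<tau> n)) \<and>
        (\<forall>n. \<forall>\<omega>\<in>space M. 0 \<le> \<tau> n \<omega>) \<and>
        (AE \<omega> in M. \<forall>n. \<tau> n \<omega> \<le> \<tau> (Suc n) \<omega>) \<and>
        (AE \<omega> in M. \<exists>n. T \<le> \<tau> n \<omega>) \<and>
        (\<forall>n. martingale M F T (\<lambda>t \<omega>. X (min t (\<tau> n \<omega>)) \<omega> - X 0 \<omega>)))"

definition bounded_variation_on :: "real \<Rightarrow> real \<Rightarrow> (real \<Rightarrow> real) \<Rightarrow> bool" where
  "bounded_variation_on a b f \<longleftrightarrow>
     (\<exists>B. \<forall>d. d division_of {a..b} \<longrightarrow> (\<Sum>k\<in>d. \<bar>f (Sup k) - f (Inf k)\<bar>) \<le> B)"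

definition is_bracket ::
  "'a measure \<Rightarrow> (real \<Rightarrow> 'a measure) \<Rightarrow> real \<Rightarrow> (real \<Rightarrow> 'a \<Rightarrow> real) \<Rightarrow> (real \<Rightarrow> 'a \<Rightarrow> real)
    \<Rightarrow> (real \<Rightarrow> 'a \<Rightarrow> real) \<Rightarrow> bool" where
  "is_bracket M F T X Y A \<longleftrightarrow>
     adapted F T A \<and>
     (AE \<omega> in M. A 0 \<omega> = 0 \<and> continuous_on {0..T} (\<lambda>t. A t \<omega>) \<and>
        bounded_variation_on 0 T (\<lambda>t. A t \<omega>)) \<and>
     continuous_local_martingale M F T (\<lambda>t \<omega>. X t \<omega> * Y t \<omega> - A t \<omega>)"

definition brownian_motion ::
  "'a measure \<Rightarrow> (real \<Rightarrow> 'a measure) \<Rightarrow> real \<Rightarrow> (real \<Rightarrow> 'a \<Rightarrow> real ^ 'n) \<Rightarrow> bool" where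
  "brownian_motion M F T w \<longleftrightarrow>
     adapted F T w \<and>
     (AE \<omega> in M. w 0 \<omega> = 0) \<and>
     (\<forall>\<omega>\<in>space M. continuous_on {0..T} (\<lambda>t. w t \<omega>)) \<and>
     (\<forall>s t. 0 \<le> s \<longrightarrow> s < t \<longrightarrow> t \<le> T \<longrightarrow>
        prob_space.indep_set M (sets (F s))
          (sets (vimage_algebra (space M) (\<lambda>\<omega>. w t \<omega> - w s \<omega>) borel)) \<and>
        distributed M lborel (\<lambda>\<omega>. w t \<omega> - w s \<omega>)
          (\<lambda>x. ennreal (\<Prod>i\<in>UNIV. normal_density 0 (sqrt (t - s)) (x $ i))))"


section \<open>Incompressible \<open>\<nu>\<close>-Brownian semimartingales and diffusions\<close>

definition incompressible ::
  "'a measure \<Rightarrow> real \<Rightarrow> (real \<Rightarrow> 'a \<Rightarrow> real ^ 'n) \<Rightarrow> bool" where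
  "incompressible M T g \<longleftrightarrow>
     distr M borel (\<lambda>\<omega>. torus_rep (g 0 \<omega>)) = torus_measure \<and>
     (\<forall>t f. 0 < t \<longrightarrow> t \<le> T \<longrightarrow> periodic f \<longrightarrow> continuous_on UNIV f \<longrightarrow>
        (\<integral>\<omega>. f (g t \<omega>) \<partial>M) = (\<integral>x. (f x :: real) \<partial>torus_measure))"

definition mart_part ::
  "real \<Rightarrow> (real \<Rightarrow> 'a \<Rightarrow> real ^ 'n) \<Rightarrow> (real \<Rightarrow> 'a \<Rightarrow> real ^ 'n) \<Rightarrow> (real ^ 'n \<Rightarrow> real)
    \<Rightarrow> real \<Rightarrow> 'a \<Rightarrow> real" where
  "mart_part \<nu> g b f t \<omega> =
     f (g t \<omega>) - f (g 0 \<omega>)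
       - (LBINT s:{0..t}. \<nu> * laplacian f (g s \<omega>) + b s \<omega> \<bullet> grad f (g s \<omega>))"

definition brownian_with_drift ::
  "'a measure \<Rightarrow> (real \<Rightarrow> 'a measure) \<Rightarrow> real \<Rightarrow> real \<Rightarrow> (real \<Rightarrow> 'a \<Rightarrow> real ^ 'n)
    \<Rightarrow> (real \<Rightarrow> 'a \<Rightarrow> real ^ 'n) \<Rightarrow> bool" where
  "brownian_with_drift M F T \<nu> g b \<longleftrightarrow>
     adapted F T g \<and> (\<forall>\<omega>\<in>space M. continuous_on {0..T} (\<lambda>t. g t \<omega>)) \<and>
     adapted F T b \<and> jointly_measurable M T b \<and>
     (AE \<omega> in M. set_integrable lborel {0..T} (\<lambda>s. b s \<omega>)) \<and>
     (\<forall>f. periodic f \<longrightarrow> C2 f \<longrightarrow> continuous_local_martingale M F T (mart_part \<nu> g b f)) \<and>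
     (\<forall>f1 f2. periodic f1 \<longrightarrow> C2 f1 \<longrightarrow> periodic f2 \<longrightarrow> C2 f2 \<longrightarrow>
        is_bracket M F T (mart_part \<nu> g b f1) (mart_part \<nu> g b f2)
          (\<lambda>t \<omega>. 2 * \<nu> * (LBINT s:{0..t}. grad f1 (g s \<omega>) \<bullet> grad f2 (g s \<omega>))))"

definition incompressible_semimartingales ::
  "'a measure \<Rightarrow> (real \<Rightarrow> 'a measure) \<Rightarrow> real \<Rightarrow> real \<Rightarrow> (real \<Rightarrow> 'a \<Rightarrow> real ^ 'n) set"
  (\<open>\<S>\<close>) where
  "\<S> M F T \<nu> = {g. incompressible M T g \<and> (\<exists>b. brownian_with_drift M F T \<nu> g b)}"

text \<open>A diffusion is a semimartingale whose drift is a (deterministic, time-dependent) vector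
  field on the torus, evaluated along the process.\<close>

definition incompressible_diffusions ::
  "'a measure \<Rightarrow> (real \<Rightarrow> 'a measure) \<Rightarrow> real \<Rightarrow> real \<Rightarrow> (real \<Rightarrow> 'a \<Rightarrow> real ^ 'n) set"
  (\<open>\<D>\<close>) where
  "\<D> M F T \<nu> = {g. incompressible M T g \<and>
     (\<exists>v :: real \<Rightarrow> real ^ 'n \<Rightarrow> real ^ 'n.
        (\<lambda>(t, x). v t x) \<in> borel_measurable (restrict_space borel {0..T} \<Otimes>\<^sub>M borel) \<and>
        (\<forall>t\<in>{0..T}. periodic (v t)) \<and>
        brownian_with_drift M F T \<nu> g (\<lambda>t \<omega>. v t (g t \<omega>)))}"


section \<open>Mean forward derivative, energy and the class of competitors\<close>

definition vec_cond_exp ::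
  "'a measure \<Rightarrow> 'a measure \<Rightarrow> ('a \<Rightarrow> real ^ 'n) \<Rightarrow> 'a \<Rightarrow> real ^ 'n" where
  "vec_cond_exp M G X \<omega> = (\<chi> i. real_cond_exp M G (\<lambda>\<omega>. X \<omega> $ i) \<omega>)"

text \<open>\<open>X = D\<^sub>t \<xi>\<close>, the limit of conditional expectations being taken in \<open>L\<^sup>1\<close>. For a lifted
  torus-valued process the increments of \<open>\<xi>\<close> are those of \<open>\<zeta>\<close>.\<close>

definition mean_derivative_at ::
  "'a measure \<Rightarrow> (real \<Rightarrow> 'a measure) \<Rightarrow> (real \<Rightarrow> 'a \<Rightarrow> real ^ 'n) \<Rightarrow> real
    \<Rightarrow> ('a \<Rightarrow> real ^ 'n) \<Rightarrow> bool" where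
  "mean_derivative_at M F \<xi> t X \<longleftrightarrow>
     X \<in> borel_measurable (F t) \<and> integrable M X \<and>
     (\<forall>\<^sub>F \<epsilon> in at_right 0. integrable M (\<lambda>\<omega>. \<xi> (t + \<epsilon>) \<omega> - \<xi> t \<omega>)) \<and>
     ((\<lambda>\<epsilon>. \<integral>\<omega>. norm (vec_cond_exp M (F t) (\<lambda>\<omega>. (\<xi> (t + \<epsilon>) \<omega> - \<xi> t \<omega>) /\<^sub>R \<epsilon>) \<omega> - X \<omega>) \<partial>M)
        \<longlongrightarrow> 0) (at_right 0)"

text \<open>As a process, \<open>D \<xi>\<close> is determined, and in general exists, only for almost every \<open>t\<close>.
  (A drift that is integrable over \<open>[0, T] \<times> \<Omega>\<close>, in particular one of finite energy, always is
  the mean derivative in this sense.)\<close>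

definition is_mean_derivative ::
  "'a measure \<Rightarrow> (real \<Rightarrow> 'a measure) \<Rightarrow> real \<Rightarrow> (real \<Rightarrow> 'a \<Rightarrow> real ^ 'n)
    \<Rightarrow> (real \<Rightarrow> 'a \<Rightarrow> real ^ 'n) \<Rightarrow> bool" where
  "is_mean_derivative M F T \<xi> b \<longleftrightarrow>
     adapted F T b \<and> jointly_measurable M T b \<and>
     (AE t in lborel. 0 \<le> t \<and> t < T \<longrightarrow> mean_derivative_at M F \<xi> t (b t))"

text \<open>Some version of \<open>D \<xi>\<close>; two versions agree almost everywhere on \<open>[0, T] \<times> \<Omega>\<close>.\<close>

definition mean_derivative ::
  "'a measure \<Rightarrow> (real \<Rightarrow> 'a measure) \<Rightarrow> real \<Rightarrow> (real \<Rightarrow> 'a \<Rightarrow> real ^ 'n)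
    \<Rightarrow> (real \<Rightarrow> 'a \<Rightarrow> real ^ 'n)" where
  "mean_derivative M F T \<xi> = (SOME b. is_mean_derivative M F T \<xi> b)"

definition energy ::
  "'a measure \<Rightarrow> (real \<Rightarrow> 'a measure) \<Rightarrow> real \<Rightarrow> (real \<Rightarrow> 'a \<Rightarrow> real ^ 'n) \<Rightarrow> ennreal" where
  "energy M F T g =
     (\<integral>\<^sup>+\<omega>. (\<integral>\<^sup>+t\<in>{0..T}. ennreal ((norm (mean_derivative M F T g t \<omega>))\<^sup>2) \<partial>lborel) \<partial>M) / 2"

text \<open>\<open>dg\<^sub>t = \<surd>(2 \<nu>) dw\<^sub>t + b\<^sub>t dt\<close>; the noise is additive, so the integrated equation involves no
  stochastic integral.\<close>

definition solves_sde ::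
  "'a measure \<Rightarrow> real \<Rightarrow> real \<Rightarrow> (real \<Rightarrow> 'a \<Rightarrow> real ^ 'n) \<Rightarrow> (real \<Rightarrow> 'a \<Rightarrow> real ^ 'n)
    \<Rightarrow> (real \<Rightarrow> 'a \<Rightarrow> real ^ 'n) \<Rightarrow> bool" where
  "solves_sde M T \<nu> w g b \<longleftrightarrow>
     (AE \<omega> in M. set_integrable lborel {0..T} (\<lambda>s. b s \<omega>) \<and>
        (\<forall>t\<in>{0..T}. g t \<omega> =
           g 0 \<omega> + sqrt (2 * \<nu>) *\<^sub>R (w t \<omega> - w 0 \<omega>) + (LBINT s:{0..t}. b s \<omega>)))"

text \<open>
  The end point conditions are equalities of lifts. Given equality at time \<open>0\<close>, equality at
  time \<open>T\<close> says that the drifts have the same integral over \<open>[0, T]\<close>. Equality modulo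
  \<open>2 \<pi> \<int>\<^sup>d\<close> at time \<open>T\<close> would not do: for a constant velocity \<open>u = (2 \<pi> / T) e\<close> with \<open>e\<close> a unit
  coordinate vector and \<open>p = 0\<close>, \<open>R = 0\<close>, the process with zero drift would have smaller energy
  than \<open>g\<close>.
\<close>

definition competitors ::
  "'a measure \<Rightarrow> (real \<Rightarrow> 'a measure) \<Rightarrow> real \<Rightarrow> real \<Rightarrow> (real \<Rightarrow> 'a \<Rightarrow> real ^ 'n)
    \<Rightarrow> (real \<Rightarrow> 'a \<Rightarrow> real ^ 'n) \<Rightarrow> (real \<Rightarrow> 'a \<Rightarrow> real ^ 'n) set" where
  "competitors M F T \<nu> w g = {g'.
     g' \<in> \<S> M F T \<nu> \<and>
     (\<exists>b. is_mean_derivative M F T g' b) \<and>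
     solves_sde M T \<nu> w g' (mean_derivative M F T g') \<and>
     (AE \<omega> in M. g' 0 \<omega> = g 0 \<omega>) \<and> (AE \<omega> in M. g' T \<omega> = g T \<omega>)}"


section \<open>Navier-Stokes equation and pressure\<close>

definition regular_pressure :: "real \<Rightarrow> (real \<Rightarrow> real ^ 'n \<Rightarrow> real) \<Rightarrow> bool" where
  "regular_pressure T p \<longleftrightarrow>
     (\<forall>t\<in>{0..T}. periodic (p t) \<and> C2 (p t)) \<and>
     continuous_on ({0..T} \<times> UNIV) (\<lambda>(t, x). p t x) \<and>
     continuous_on ({0..T} \<times> UNIV) (\<lambda>(t, x). grad (p t) x)"

text \<open>The equation holds pointwise, the time derivative being one-sided at the end points of
  \<open>[0, T]\<close>; \<open>\<nabla>u \<cdot> u\<close> is the derivative of \<open>u\<close> in direction \<open>u\<close>. Note that the pressure term runs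
  backwards in time.\<close>

definition navier_stokes_solution ::
  "real \<Rightarrow> real \<Rightarrow> (real \<Rightarrow> real ^ 'n \<Rightarrow> real ^ 'n) \<Rightarrow> (real \<Rightarrow> real ^ 'n \<Rightarrow> real) \<Rightarrow> bool" where
  "navier_stokes_solution T \<nu> u p \<longleftrightarrow>
     (\<forall>t\<in>{0..T}. periodic (u t) \<and> C2 (u t)) \<and>
     continuous_on ({0..T} \<times> UNIV) (\<lambda>(t, x). u t x) \<and>
     (\<forall>t\<in>{0..T}. \<forall>x. \<exists>u'. ((\<lambda>s. u s x) has_vector_derivative u') (at t within {0..T}) \<and>
        u' + frechet_derivative (u t) (at x) (u t x) - \<nu> *\<^sub>R laplacian (u t) x
          = - grad (p (T - t)) x)"

end

theory Submission
  imports Defs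
begin

text \<open>
  Write \<open>b\<^sub>t = - u (T - t, g\<^sub>t)\<close> for the drift of \<open>g\<close> and \<open>a\<^sub>t = - \<nabla>p (t, g\<^sub>t)\<close>. Both are bounded with
  continuous paths, because \<open>u\<close> and \<open>\<nabla>p\<close> are continuous and periodic. Let \<open>b'\<close> be the drift of a
  competitor \<open>g'\<close> of finite energy, \<open>c = b' - b\<close> and \<open>h = g' - g\<close>. Both processes are driven by the
  same noise, so \<open>h\<^sub>t = \<integral>\<^sub>0\<^sup>t c ds\<close> pathwise, and \<open>h\<^sub>0 = h\<^sub>T = 0\<close>. Hence
  \<open>E \<integral> |b'|\<^sup>2 = E \<integral> |b|\<^sup>2 + 2 E \<integral> b \<bullet> c + E \<integral> |c|\<^sup>2\<close>, and the sum of the last two terms has to be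
  nonnegative. Three facts give this.

  First variation (\<open>component_variation\<close>): \<open>E \<integral> b \<bullet> c = - E \<integral> a \<bullet> h\<close>. The hypothesis \<open>D b = a\<close> makes
  \<open>b\<^sub>t - \<integral>\<^sub>0\<^sup>t a dr\<close> a martingale. The vector \<open>c\<^sub>s\<close> is \<open>F\<^sub>s\<close>-measurable, hence orthogonal to the
  increment of this martingale over \<open>[s, T]\<close> (\<open>compensated_orthogonal\<close>). Integrating over \<open>s\<close>, the terminal value is paired with
  \<open>\<integral> c ds = h\<^sub>T = 0\<close> and drops out, and a pathwise integration by parts moves the derivative from \<open>h\<close>
  to \<open>\<integral> a dr\<close>. No stochastic integral is involved.

  Pressure (\<open>C2_taylor_upper\<close>): Taylor's formula along the segment from \<open>g\<^sub>t\<close> to \<open>g'\<^sub>t\<close> and \<open>\<nabla>\<^sup>2p \<le> R Id\<close> give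
  \<open>p (t, g'\<^sub>t) \<le> p (t, g\<^sub>t) - a\<^sub>t \<bullet> h\<^sub>t + R / 2 |h\<^sub>t|\<^sup>2\<close>. By incompressibility the expectations of
  \<open>p (t, g'\<^sub>t)\<close> and \<open>p (t, g\<^sub>t)\<close> agree, so \<open>E (a\<^sub>t \<bullet> h\<^sub>t) \<le> R / 2 E |h\<^sub>t|\<^sup>2\<close>.

  Wirtinger's inequality (\<open>wirtinger_inequality\<close>): \<open>\<pi>\<^sup>2 \<integral> |h|\<^sup>2 \<le> T\<^sup>2 \<integral> |c|\<^sup>2\<close> on each path, as \<open>h\<close> vanishes at both ends.

  Together, \<open>2 E \<integral> b \<bullet> c + E \<integral> |c|\<^sup>2 \<ge> E \<integral> |c|\<^sup>2 - R E \<integral> |h|\<^sup>2 \<ge> 0\<close> since \<open>R T\<^sup>2 \<le> \<pi>\<^sup>2\<close>;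
  this is \<open>energy_minimal_of_potential_bound\<close>.

  It also has to be shown that \<open>g\<close> itself is a competitor and that its energy is that of \<open>b\<close>, the
  mean derivative being an arbitrary version: Brownian increments have conditional mean zero, so \<open>b\<close> is
  a mean derivative of \<open>g\<close> (\<open>mean_derivative_at_of_drift\<close>), and any two versions agree almost
  everywhere (\<open>mean_derivative_version\<close>).
\<close>

section \<open>Periodic functions\<close>

lemma periodic_add_int_multiple:
  assumes "periodic f"
  shows "f (x + (2 * pi * of_int k) *\<^sub>R axis i 1) = f x"
proof -
  have nat: "f (x + (2 * pi * real n) *\<^sub>R axis i 1) = f x" for n x
  proof (induction n)
    case (Suc n)
    have "x + (2 * pi * real (Suc n)) *\<^sub>R axis i 1
        = (x + (2 * pi * real n) *\<^sub>R axis i 1) + (2 * pi) *\<^sub>R axis i 1"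
      by (simp add: algebra_simps)
    then show ?case using Suc assms unfolding periodic_def by metis
  qed simp
  show ?thesis
  proof (cases "k \<ge> 0")
    case True
    then show ?thesis using nat[of x "nat k"] by simp
  next
    case False
    then show ?thesis
      using nat[of "x + (2 * pi * of_int k) *\<^sub>R axis i 1" "nat (- k)"] by simp
  qed
qed

text \<open>
  Reduction modulo \<open>2 \<pi>\<close> is a finite sequence of shifts, one coordinate at a time.
\<close>

lemma periodic_torus_rep:
  assumes "periodic f"
  shows "f (torus_rep x) = f x"
proof -
  define k where "k i = - \<lfloor>x $ i / (2 * pi)\<rfloor>" for i
  have *: "f (x + (\<Sum>i\<in>I. (2 * pi * of_int (k i)) *\<^sub>R axis i 1)) = f x" if "finite I" for I
    using that
  proof induction
    case (insert i I)
    then show ?case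
      using periodic_add_int_multiple[OF assms, of "x + (\<Sum>i\<in>I. (2 * pi * of_int (k i)) *\<^sub>R axis i 1)" "k i" i]
      by (simp add: algebra_simps)
  qed simp
  have "torus_rep x = x + (\<Sum>i\<in>UNIV. (2 * pi * of_int (k i)) *\<^sub>R axis i 1)"
    by (simp add: vec_eq_iff torus_rep_def rmod_def k_def axis_def sum.delta if_distrib cong: if_cong)
  then show ?thesis using *[of UNIV] by simp
qed

lemma torus_rep_in_cbox: "torus_rep x \<in> cbox 0 (\<chi> i. 2 * pi)"
  by (simp add: mem_box_cart torus_rep_def rmod_nonneg rmod_le)

text \<open>
  The supremum over \<open>\<real>\<^sup>d\<close> is already attained on the compact fundamental cell.
\<close>

lemma periodic_family_bounded:
  fixes f :: "real \<Rightarrow> real ^ 'n \<Rightarrow> 'b::real_normed_vector"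
  assumes "continuous_on ({0..T} \<times> UNIV) (\<lambda>(t, x). f t x)"
    and "\<And>t. t \<in> {0..T} \<Longrightarrow> periodic (f t)"
  shows "\<exists>B. \<forall>t\<in>{0..T}. \<forall>x. norm (f t x) \<le> B"
proof -
  have "compact ((\<lambda>(t, x). f t x) ` ({0..T} \<times> cbox 0 (\<chi> i. 2 * pi)))"
    by (intro compact_continuous_image continuous_on_subset[OF assms(1)] compact_Times) auto
  then obtain B where B: "\<forall>y\<in>(\<lambda>(t, x). f t x) ` ({0..T} \<times> cbox 0 (\<chi> i. 2 * pi)). norm y \<le> B"
    using compact_imp_bounded bounded_iff by metis
  have "norm (f t x) \<le> B" if "t \<in> {0..T}" for t x
    using B that torus_rep_in_cbox[of x] periodic_torus_rep[OF assms(2)[OF that], of x]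
    by (metis (mono_tags, lifting) SigmaI image_eqI split_conv)
  then show ?thesis by blast
qed

lemma continuous_on_slice:
  assumes "continuous_on (S \<times> UNIV) (\<lambda>(t, x). f t x)" and "t \<in> S"
  shows "continuous_on UNIV (f t)"
proof -
  have "continuous_on UNIV (\<lambda>x. (t, x))" by (intro continuous_intros)
  from continuous_on_compose2[OF assms(1) this] show ?thesis using assms(2) by auto
qed

text \<open>
  Translating by a period does not change the function, so it does not change its derivative either.
\<close>

lemma periodic_grad:
  fixes f :: "real ^ 'n \<Rightarrow> real"
  assumes "periodic f" "C1 f"
  shows "periodic (grad f)"
  unfolding periodic_def
proof (intro allI)
  fix x :: "real ^ 'n" and i :: 'n
  let ?v = "(2 * pi) *\<^sub>R axis i (1::real)"
  have shift: "(\<lambda>y. f (y + ?v)) = f" using assms(1) by (auto simp: periodic_def)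
  have "(f has_derivative frechet_derivative f (at (x + ?v))) (at (x + ?v))"
    using assms(2) by (auto simp: C1_def frechet_derivative_works[symmetric])
  then have "((\<lambda>y. f (y + ?v)) has_derivative (\<lambda>z. frechet_derivative f (at (x + ?v)) z)) (at x)"
    by (rule has_derivative_compose[rotated]) (auto intro!: derivative_eq_intros)
  then have "frechet_derivative f (at x) = frechet_derivative f (at (x + ?v))"
    unfolding shift by (metis frechet_derivative_at)
  then show "grad f (x + ?v) = grad f x" by (simp add: grad_def partial_def)
qed

section \<open>Taylor expansion along a segment\<close>

lemma C1_frechet_derivative:
  fixes f :: "real ^ 'n \<Rightarrow> real"
  assumes "C1 f"
  shows "frechet_derivative f (at x) \<xi> = grad f x \<bullet> \<xi>"
proof -
  have "(f has_derivative frechet_derivative f (at x)) (at x)"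
    using assms by (auto simp: C1_def frechet_derivative_works[symmetric])
  then interpret bounded_linear "frechet_derivative f (at x)" by (rule has_derivative_bounded_linear)
  have "\<xi> = (\<Sum>i\<in>UNIV. (\<xi> $ i) *\<^sub>R axis i 1)"
    by (simp add: basis_expansion scalar_mult_eq_scaleR[symmetric])
  then have "frechet_derivative f (at x) \<xi> = (\<Sum>i\<in>UNIV. (\<xi> $ i) * partial i f x)"
    by (metis (mono_tags, lifting) partial_def scaleR real_scaleR_def sum sum.cong)
  then show ?thesis by (simp add: grad_def inner_vec_def mult.commute)
qed

text \<open>
  The second derivative of \<open>s \<mapsto> f (x + s \<xi>)\<close> is \<open>\<xi> \<bullet> (\<nabla>\<^sup>2f \<xi>)\<close>, and the Lagrange remainder needs
  it at a single intermediate point only.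
\<close>

lemma C2_taylor_upper:
  fixes f :: "real ^ 'n \<Rightarrow> real"
  assumes "C2 f" and hess: "\<And>x \<xi>. \<xi> \<bullet> (hessian f x *v \<xi>) \<le> R * (\<xi> \<bullet> \<xi>)"
  shows "f y \<le> f x + grad f x \<bullet> (y - x) + R / 2 * ((y - x) \<bullet> (y - x))"
proof -
  define \<xi> where "\<xi> = y - x"
  have C1: "C1 f" "\<And>i. C1 (partial i f)" using assms(1) by (auto simp: C2_def)
  have line: "((\<lambda>s. k (x + s *\<^sub>R \<xi>)) has_real_derivative grad k (x + s *\<^sub>R \<xi>) \<bullet> \<xi>) (at s)"
    if "C1 k" for k :: "real ^ 'n \<Rightarrow> real" and s
  proof -
    have "(k has_derivative frechet_derivative k (at (x + s *\<^sub>R \<xi>))) (at (x + s *\<^sub>R \<xi>))"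
      using that by (auto simp: C1_def frechet_derivative_works[symmetric])
    then have "((\<lambda>s. k (x + s *\<^sub>R \<xi>)) has_derivative
        (\<lambda>z. frechet_derivative k (at (x + s *\<^sub>R \<xi>)) (z *\<^sub>R \<xi>))) (at s)"
      by (rule has_derivative_compose[rotated]) (auto intro!: derivative_eq_intros)
    then show ?thesis
      by (simp add: C1_frechet_derivative[OF that] has_field_derivative_def mult.commute[of "_ \<bullet> _"]
          cong: if_cong) (simp add: mult_commute_abs)
  qed
  define \<phi>1 where "\<phi>1 s = grad f (x + s *\<^sub>R \<xi>) \<bullet> \<xi>" for s
  define \<phi>2 where "\<phi>2 s = \<xi> \<bullet> (hessian f (x + s *\<^sub>R \<xi>) *v \<xi>)" for s
  have d2: "(\<phi>1 has_real_derivative \<phi>2 s) (at s)" for s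
  proof -
    have "((\<lambda>s. \<Sum>j\<in>UNIV. partial j f (x + s *\<^sub>R \<xi>) * \<xi> $ j) has_real_derivative
        (\<Sum>j\<in>UNIV. (grad (partial j f) (x + s *\<^sub>R \<xi>) \<bullet> \<xi>) * \<xi> $ j)) (at s)"
      by (intro DERIV_sum DERIV_cmult_right line C1)
    moreover have "(\<lambda>s. \<Sum>j\<in>UNIV. partial j f (x + s *\<^sub>R \<xi>) * \<xi> $ j) = \<phi>1"
      by (auto simp: \<phi>1_def inner_vec_def grad_def)
    moreover have "(\<Sum>j\<in>UNIV. (grad (partial j f) (x + s *\<^sub>R \<xi>) \<bullet> \<xi>) * \<xi> $ j) = \<phi>2 s"
      unfolding \<phi>2_def hessian_def grad_def inner_vec_def matrix_vector_mult_def
      by (simp add: sum_distrib_left sum_distrib_right mult_ac) (subst sum.swap, simp add: mult.left_commute)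
    ultimately show ?thesis by simp
  qed
  define \<phi> where "\<phi> s = f (x + s *\<^sub>R \<xi>)" for s
  define diff where "diff m = (if m = (0::nat) then \<phi> else if m = 1 then \<phi>1 else \<phi>2)" for m
  have "\<exists>t>0. t < 1 \<and> \<phi> 1 = (\<Sum>m<2. diff m 0 / fact m * 1 ^ m) + diff 2 t / fact 2 * 1 ^ 2"
    by (rule Maclaurin)
      (auto simp: diff_def d2 less_2_cases_iff \<phi>1_def[symmetric] \<phi>_def[abs_def] intro: line[OF C1(1), folded \<phi>1_def])
  then obtain t where "\<phi> 1 = \<phi> 0 + \<phi>1 0 + \<phi>2 t / 2"
    by (auto simp: diff_def numeral_2_eq_2)
  moreover have "\<phi>2 t \<le> R * (\<xi> \<bullet> \<xi>)" unfolding \<phi>2_def by (rule hess)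
  ultimately show ?thesis by (simp add: \<phi>_def \<phi>1_def \<xi>_def)
qed

section \<open>Integration by parts and Wirtinger's inequality\<close>

text \<open>
  The product of the two integrals is the integral of \<open>f x * k y\<close> over the plane; cut along the
  diagonal, the plane gives one term for each half. In this form no differentiation of indefinite
  integrals of merely integrable functions is needed.
\<close>

lemma integration_by_parts_lborel:
  fixes f k :: "real \<Rightarrow> real"
  assumes f: "integrable lborel f" and k: "integrable lborel k"
  shows "integrable lborel (\<lambda>s. f s * (LBINT r:{..s}. k r))"
    and "integrable lborel (\<lambda>s. k s * (LBINT r:{..s}. f r))"
    and "(LBINT s. f s * (LBINT r:{..s}. k r)) + (LBINT s. k s * (LBINT r:{..s}. f r))
      = integral\<^sup>L lborel f * integral\<^sup>L lborel k"
proof -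
  note [measurable] = borel_measurable_integrable[OF f] borel_measurable_integrable[OF k]
  let ?P = "\<lambda>(x, y). f x * k y"
  let ?A = "\<lambda>(x, y). indicator {y. y \<le> x} y * (f x * k y)"
  let ?B = "\<lambda>(x, y). indicator {x. x < y} x * (f x * k y)"
  have P: "integrable (lborel \<Otimes>\<^sub>M lborel) ?P"
    by (intro lborel_pair.Fubini_integrable) (auto simp: abs_mult f k)
  have [measurable]: "?A \<in> borel_measurable (lborel \<Otimes>\<^sub>M lborel)"
      "?B \<in> borel_measurable (lborel \<Otimes>\<^sub>M lborel)"
    by (simp_all add: indicator_def case_prod_beta')
  have A: "integrable (lborel \<Otimes>\<^sub>M lborel) ?A"
    by (rule Bochner_Integration.integrable_bound[OF P]) (auto simp: indicator_def)
  have B: "integrable (lborel \<Otimes>\<^sub>M lborel) ?B"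
    by (rule Bochner_Integration.integrable_bound[OF P]) (auto simp: indicator_def)
  have A1: "(LBINT y. ?A (x, y)) = f x * (LBINT r:{..x}. k r)" for x
    unfolding set_lebesgue_integral_def
    by (subst integral_mult_right_zero[symmetric], rule Bochner_Integration.integral_cong)
      (auto simp: indicator_def)
  \<comment> \<open>The half plane \<open>x < y\<close> is open while \<open>{..y}\<close> contains its right end point;
    this changes the integral by a null set only.\<close>
  have B1: "(LBINT x. ?B (x, y)) = k y * (LBINT r:{..y}. f r)" for y
    unfolding set_lebesgue_integral_def
  proof (subst integral_mult_right_zero[symmetric], rule integral_cong_AE)
    show "AE x in lborel. ?B (x, y) = k y * (indicator {..y} x *\<^sub>R f x)"
      using AE_lborel_singleton[of y] by eventually_elim (auto simp: indicator_def)
  qed (simp_all add: indicator_def)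
  show "integrable lborel (\<lambda>s. f s * (LBINT r:{..s}. k r))"
    using lborel_pair.integrable_fst'[OF A] unfolding A1 .
  show "integrable lborel (\<lambda>s. k s * (LBINT r:{..s}. f r))"
    using lborel_pair.integrable_snd[of "\<lambda>x y. ?B (x, y)"] B unfolding B1 by simp
  have "integral\<^sup>L lborel f * integral\<^sup>L lborel k = (LBINT x. LBINT y. ?P (x, y))"
    by simp
  also have "\<dots> = integral\<^sup>L (lborel \<Otimes>\<^sub>M lborel) ?P"
    by (rule lborel_pair.integral_fst'[OF P])
  also have "\<dots> = integral\<^sup>L (lborel \<Otimes>\<^sub>M lborel) (\<lambda>z. ?A z + ?B z)"
    by (rule Bochner_Integration.integral_cong) (auto simp: indicator_def)
  also have "\<dots> = integral\<^sup>L (lborel \<Otimes>\<^sub>M lborel) ?A + integral\<^sup>L (lborel \<Otimes>\<^sub>M lborel) ?B"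
    by (rule Bochner_Integration.integral_add[OF A B])
  also have "integral\<^sup>L (lborel \<Otimes>\<^sub>M lborel) ?A = (LBINT s. f s * (LBINT r:{..s}. k r))"
    unfolding A1[symmetric] by (rule lborel_pair.integral_fst'[OF A, symmetric])
  also have "integral\<^sup>L (lborel \<Otimes>\<^sub>M lborel) ?B = (LBINT s. k s * (LBINT r:{..s}. f r))"
    unfolding B1[symmetric] using lborel_pair.integral_snd[of "\<lambda>x y. ?B (x, y)"] B by simp
  finally show "(LBINT s. f s * (LBINT r:{..s}. k r)) + (LBINT s. k s * (LBINT r:{..s}. f r))
      = integral\<^sup>L lborel f * integral\<^sup>L lborel k" by simp
qed

lemma integration_by_parts_interval:
  fixes f k :: "real \<Rightarrow> real"
  assumes f: "set_integrable lborel {0..T} f" and k: "set_integrable lborel {0..T} k"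
  shows "set_integrable lborel {0..T} (\<lambda>s. f s * (LBINT r:{0..s}. k r))"
    and "set_integrable lborel {0..T} (\<lambda>s. k s * (LBINT r:{0..s}. f r))"
    and "(LBINT s:{0..T}. f s * (LBINT r:{0..s}. k r)) + (LBINT s:{0..T}. k s * (LBINT r:{0..s}. f r))
      = (LBINT s:{0..T}. f s) * (LBINT s:{0..T}. k s)"
proof -
  have *: "(LBINT r:{..s}. indicator {0..T} r *\<^sub>R q r) = (LBINT r:{0..s}. q r)"
    if "s \<le> T" for s and q :: "real \<Rightarrow> real"
    unfolding set_lebesgue_integral_def
    by (rule Bochner_Integration.integral_cong) (use that in \<open>auto simp: indicator_def\<close>)
  have **: "(\<lambda>s. (indicator {0..T} s *\<^sub>R q s) * (LBINT r:{..s}. indicator {0..T} r *\<^sub>R q' r))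
     = (\<lambda>s. indicator {0..T} s *\<^sub>R (q s * (LBINT r:{0..s}. q' r)))" for q q' :: "real \<Rightarrow> real"
  proof
    fix s
    show "(indicator {0..T} s *\<^sub>R q s) * (LBINT r:{..s}. indicator {0..T} r *\<^sub>R q' r)
      = indicator {0..T} s *\<^sub>R (q s * (LBINT r:{0..s}. q' r))"
      by (cases "s \<in> {0..T}") (use *[of s q'] in auto)
  qed
  note parts = integration_by_parts_lborel[OF f[unfolded set_integrable_def] k[unfolded set_integrable_def],
      unfolded **]
  from parts show "set_integrable lborel {0..T} (\<lambda>s. f s * (LBINT r:{0..s}. k r))"
    and "set_integrable lborel {0..T} (\<lambda>s. k s * (LBINT r:{0..s}. f r))"
    and "(LBINT s:{0..T}. f s * (LBINT r:{0..s}. k r)) + (LBINT s:{0..T}. k s * (LBINT r:{0..s}. f r))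
      = (LBINT s:{0..T}. f s) * (LBINT s:{0..T}. k s)"
    by (simp_all add: set_integrable_def set_lebesgue_integral_def)
qed

lemma continuous_on_indefinite_LBINT:
  fixes f :: "real \<Rightarrow> real"
  assumes "set_integrable lborel {0..T} f"
  shows "continuous_on {0..T} (\<lambda>t. LBINT s:{0..t}. f s)"
proof -
  have "(LBINT s:{0..t}. f s) = integral {0..t} f" if "t \<in> {0..T}" for t
    using that by (intro set_borel_integral_eq_integral set_integrable_subset[OF assms]) auto
  moreover have "continuous_on {0..T} (\<lambda>t. integral {0..t} f)"
    by (intro indefinite_integral_continuous_1 set_borel_integral_eq_integral assms)
  ultimately show ?thesis using continuous_on_cong[OF refl] by (metis (no_types, lifting))
qed

lemma set_integrable_continuous_mult:
  fixes c q :: "real \<Rightarrow> real"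
  assumes c: "set_integrable lborel {a..b} c" and q: "continuous_on {a..b} q"
  shows "set_integrable lborel {a..b} (\<lambda>s. c s * q s)"
proof -
  have "compact (q ` {a..b})" by (intro compact_continuous_image q) auto
  then obtain B where B: "B > 0" "\<And>s. s \<in> {a..b} \<Longrightarrow> \<bar>q s\<bar> \<le> B"
    using compact_imp_bounded bounded_pos by (metis imageI real_norm_def)
  have [measurable]: "(\<lambda>s. indicator {a..b} s *\<^sub>R q s) \<in> borel_measurable lborel"
    "(\<lambda>s. indicator {a..b} s *\<^sub>R c s) \<in> borel_measurable lborel"
    using borel_measurable_continuous_on_indicator[OF _ q] c
    by (auto simp: set_integrable_def borel_measurable_integrable)
  have eq: "(\<lambda>s. indicator {a..b} s *\<^sub>R (c s * q s)) =
      (\<lambda>s. (indicator {a..b} s *\<^sub>R c s) * (indicator {a..b} s *\<^sub>R q s))"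
    by (auto simp: indicator_def fun_eq_iff)
  have "integrable lborel (\<lambda>s. B * (indicator {a..b} s *\<^sub>R c s))"
    using c by (simp add: set_integrable_def)
  then show ?thesis unfolding set_integrable_def eq
  proof (rule Bochner_Integration.integrable_bound)
    have "\<bar>c s\<bar> * \<bar>q s\<bar> \<le> B * \<bar>c s\<bar>" if "s \<in> {a..b}" for s
      using B(2)[OF that] by (subst mult.commute) (rule mult_right_mono, auto)
    then show "AE s in lborel. norm (indicator {a..b} s *\<^sub>R c s * (indicator {a..b} s *\<^sub>R q s))
        \<le> norm (B * (indicator {a..b} s *\<^sub>R c s))"
      using B(1) by (auto simp: indicator_def abs_mult)
  qed measurable
qed

text \<open>
  Take \<open>\<omega> < \<pi> / T\<close>, so that \<open>\<theta> t = tan (\<omega> (t - T / 2))\<close> is smooth on all of \<open>[0, T]\<close> and solves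
  \<open>\<theta>' = \<omega> (1 + \<theta>\<^sup>2)\<close>. Expanding \<open>\<integral> (h' + \<omega> h \<theta>)\<^sup>2 \<ge> 0\<close> and integrating \<open>2 h h' \<theta>\<close> by parts,
  which produces no boundary terms as \<open>h\<close> vanishes at both ends, leaves \<open>\<omega>\<^sup>2 \<integral> h\<^sup>2 \<le> \<integral> h'\<^sup>2\<close>.
  Then \<open>\<omega>\<close> tends to \<open>\<pi> / T\<close>; working with \<open>\<omega> = \<pi> / T\<close> directly would make \<open>\<theta>\<close> singular at the
  end points.
\<close>

lemma wirtinger_inequality:
  fixes c :: "real \<Rightarrow> real"
  assumes T: "T > 0" and c: "set_integrable lborel {0..T} c"
    and c2: "set_integrable lborel {0..T} (\<lambda>t. (c t)\<^sup>2)"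
    and "(LBINT s:{0..T}. c s) = 0"
  shows "pi\<^sup>2 * (LBINT t:{0..T}. (LBINT s:{0..t}. c s)\<^sup>2) \<le> T\<^sup>2 * (LBINT t:{0..T}. (c t)\<^sup>2)"
proof -
  define h where "h t = (LBINT s:{0..t}. c s)" for t
  have hT: "h T = 0" using assms by (simp add: h_def)
  have hc: "continuous_on {0..T} h" unfolding h_def by (rule continuous_on_indefinite_LBINT[OF c])
  have h2: "set_integrable lborel {0..T} (\<lambda>t. (h t)\<^sup>2)"
    by (intro borel_integrable_atLeastAtMost' continuous_intros hc)
  have ch: "set_integrable lborel {0..T} (\<lambda>s. 2 * (c s * h s))"
    using set_integrable_continuous_mult[OF c hc] by (rule set_integrable_mult_right)
  have sq: "(LBINT s:{0..t}. 2 * (c s * h s)) = (h t)\<^sup>2" if "t \<in> {0..T}" for t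
  proof -
    have "set_integrable lborel {0..t} c" by (rule set_integrable_subset[OF c]) (use that in auto)
    from integration_by_parts_interval(3)[OF this this] show ?thesis
      by (simp add: h_def[symmetric] power2_eq_square)
  qed
  have main: "\<omega>\<^sup>2 * (LBINT t:{0..T}. (h t)\<^sup>2) \<le> (LBINT t:{0..T}. (c t)\<^sup>2)"
    if \<omega>: "0 < \<omega>" "\<omega> < pi / T" for \<omega>
  proof -
    define \<theta> where "\<theta> t = tan (\<omega> * (t - T / 2))" for t
    define \<theta>' where "\<theta>' t = \<omega> * (1 + (\<theta> t)\<^sup>2)" for t
    have cos: "cos (\<omega> * (t - T / 2)) \<noteq> 0" if "t \<in> {0..T}" for t
    proof -
      have "\<bar>\<omega> * (t - T / 2)\<bar> = \<omega> * \<bar>t - T / 2\<bar>" using \<omega> by (simp add: abs_mult)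
      also have "\<dots> \<le> \<omega> * (T / 2)" using \<omega> that by (intro mult_left_mono) (auto simp: abs_if)
      also have "\<dots> < pi / 2" using \<omega>(2) T by (simp add: field_simps)
      finally have "\<omega> * (t - T / 2) < pi / 2" "- (pi / 2) < \<omega> * (t - T / 2)" by linarith+
      then have "cos (\<omega> * (t - T / 2)) > 0" by (intro cos_gt_zero_pi) auto
      then show ?thesis by simp
    qed
    have d: "(\<theta> has_real_derivative \<theta>' t) (at t)" if "t \<in> {0..T}" for t
    proof -
      have "((\<lambda>t. \<omega> * (t - T / 2)) has_real_derivative \<omega>) (at t)"
        by (auto intro!: derivative_eq_intros)
      from DERIV_chain2[OF DERIV_tan[OF cos[OF that]] this]
      have "(\<theta> has_real_derivative inverse ((cos (\<omega> * (t - T / 2)))\<^sup>2) * \<omega>) (at t)"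
        unfolding \<theta>_def[abs_def] .
      moreover have "inverse ((cos (\<omega> * (t - T / 2)))\<^sup>2) * \<omega> = \<theta>' t"
        unfolding \<theta>'_def \<theta>_def tan_sec[OF cos[OF that]] power_inverse by (rule mult.commute)
      ultimately show ?thesis by simp
    qed
    then have \<theta>c: "continuous_on {0..T} \<theta>"
      by (intro continuous_at_imp_continuous_on ballI DERIV_isCont)
    then have \<theta>'c: "continuous_on {0..T} \<theta>'" unfolding \<theta>'_def by (intro continuous_intros)
    then have k: "set_integrable lborel {0..T} \<theta>'" by (rule borel_integrable_atLeastAtMost')
    have K: "(LBINT s:{0..t}. \<theta>' s) = \<theta> t - \<theta> 0" if "t \<in> {0..T}" for t
      unfolding set_lebesgue_integral_def
      by (rule integral_FTC_atLeastAtMost)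
        (use that in \<open>auto intro!: continuous_on_subset[OF \<theta>'c] has_field_derivative_at_within d
           simp: has_real_derivative_iff_has_vector_derivative[symmetric]\<close>)
    \<comment> \<open>By \<open>sq\<close> the indefinite integral of \<open>2 c h\<close> is \<open>h\<^sup>2\<close>; its partner is \<open>\<theta> - \<theta> 0\<close>, and the
      constant \<open>\<theta> 0\<close> contributes a multiple of \<open>(h T)\<^sup>2 = 0\<close>.\<close>
    note parts = integration_by_parts_interval[OF ch k]
    have ch\<theta>: "set_integrable lborel {0..T} (\<lambda>s. 2 * (c s * h s) * \<theta> s)"
      by (rule set_integrable_continuous_mult[OF ch \<theta>c])
    have h\<theta>: "set_integrable lborel {0..T} (\<lambda>s. (h s)\<^sup>2 * (\<theta> s)\<^sup>2)"
      by (intro borel_integrable_atLeastAtMost' continuous_intros hc \<theta>c)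
    have "0 = (LBINT s:{0..T}. 2 * (c s * h s) * (\<theta> s - \<theta> 0)) + (LBINT s:{0..T}. \<theta>' s * (h s)\<^sup>2)"
    proof -
      have "(LBINT s:{0..T}. 2 * (c s * h s) * (LBINT r:{0..s}. \<theta>' r)) =
          (LBINT s:{0..T}. 2 * (c s * h s) * (\<theta> s - \<theta> 0))"
        by (rule set_lebesgue_integral_cong) (auto simp: K)
      moreover have "(LBINT s:{0..T}. \<theta>' s * (LBINT r:{0..s}. 2 * (c r * h r))) =
          (LBINT s:{0..T}. \<theta>' s * (h s)\<^sup>2)"
        by (intro set_lebesgue_integral_cong) (simp, intro allI impI, simp only: sq)
      moreover have "(LBINT s:{0..T}. 2 * (c s * h s)) = 0" using sq[of T] T hT by simp
      ultimately show ?thesis using parts(3) by (simp only: mult_zero_left)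
    qed
    also have "(LBINT s:{0..T}. 2 * (c s * h s) * (\<theta> s - \<theta> 0)) =
        (LBINT s:{0..T}. 2 * (c s * h s) * \<theta> s) - (LBINT s:{0..T}. 2 * (c s * h s) * \<theta> 0)"
      by (subst set_integral_diff(2)[symmetric])
        (auto intro!: ch\<theta> ch set_integrable_mult_left simp: right_diff_distrib)
    also have "(LBINT s:{0..T}. 2 * (c s * h s) * \<theta> 0) = 0"
      using sq[of T] T hT by (simp add: mult.assoc[symmetric])
    also have "(LBINT s:{0..T}. \<theta>' s * (h s)\<^sup>2) =
       \<omega> * ((LBINT s:{0..T}. (h s)\<^sup>2) + (LBINT s:{0..T}. (h s)\<^sup>2 * (\<theta> s)\<^sup>2))"
      unfolding \<theta>'_def
      by (subst set_integral_add(2)[OF h2 h\<theta>, symmetric], subst set_integral_mult_right[symmetric])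
        (simp add: algebra_simps)
    finally have 1: "(LBINT s:{0..T}. 2 * (c s * h s) * \<theta> s) =
       - \<omega> * ((LBINT s:{0..T}. (h s)\<^sup>2) + (LBINT s:{0..T}. (h s)\<^sup>2 * (\<theta> s)\<^sup>2))" by simp
    have "0 \<le> (LBINT s:{0..T}. (c s + \<omega> * h s * \<theta> s)\<^sup>2)"
      by (auto intro!: Bochner_Integration.integral_nonneg simp: set_lebesgue_integral_def)
    also have "\<dots> = (LBINT s:{0..T}. (c s)\<^sup>2 + \<omega> * (2 * (c s * h s) * \<theta> s) + \<omega>\<^sup>2 * ((h s)\<^sup>2 * (\<theta> s)\<^sup>2))"
      by (simp add: power2_eq_square algebra_simps)
    also have "\<dots> = (LBINT t:{0..T}. (c t)\<^sup>2) + \<omega> * (LBINT s:{0..T}. 2 * (c s * h s) * \<theta> s)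
        + \<omega>\<^sup>2 * (LBINT s:{0..T}. (h s)\<^sup>2 * (\<theta> s)\<^sup>2)"
      by (simp add: set_integral_add c2 ch\<theta> h\<theta>)
    also have "\<dots> = (LBINT t:{0..T}. (c t)\<^sup>2) - \<omega>\<^sup>2 * (LBINT t:{0..T}. (h t)\<^sup>2)"
      unfolding 1 by (simp add: power2_eq_square algebra_simps)
    finally show ?thesis by simp
  qed
  have "(pi / T)\<^sup>2 * (LBINT t:{0..T}. (h t)\<^sup>2) \<le> (LBINT t:{0..T}. (c t)\<^sup>2)"
  proof (rule field_le_mult_one_interval)
    fix z :: real assume z: "0 < z" "z < 1"
    have "sqrt z * (pi / T) < 1 * (pi / T)"
      by (intro mult_strict_right_mono) (use z T in auto)
    then have "(sqrt z * (pi / T))\<^sup>2 * (LBINT t:{0..T}. (h t)\<^sup>2) \<le> (LBINT t:{0..T}. (c t)\<^sup>2)"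
      using z T by (intro main) auto
    then show "z * ((pi / T)\<^sup>2 * (LBINT t:{0..T}. (h t)\<^sup>2)) \<le> (LBINT t:{0..T}. (c t)\<^sup>2)"
      using z by (simp only: power_mult_distrib real_sqrt_pow2 less_imp_le mult.assoc)
  qed
  then show ?thesis using T by (simp add: h_def power_divide field_simps)
qed

section \<open>Right derivatives and limits from the right\<close>

lemma LBINT_eq_integral:
  fixes f :: "real \<Rightarrow> real"
  assumes "continuous_on {0..T} f" and "t \<le> T"
  shows "(LBINT s:{0..t}. f s) = integral {0..t} f"
  by (intro set_borel_integral_eq_integral borel_integrable_atLeastAtMost'
      continuous_on_subset[OF assms(1)]) (use assms(2) in auto)

lemma LBINT_increment_bound:
  fixes f :: "real \<Rightarrow> real"
  assumes f: "continuous_on {0..T} f" and B: "\<And>s. s \<in> {0..T} \<Longrightarrow> \<bar>f s\<bar> \<le> B"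
    and st: "0 \<le> s" "s \<le> t" "t \<le> T"
  shows "\<bar>(LBINT r:{0..t}. f r) - (LBINT r:{0..s}. f r)\<bar> \<le> B * (t - s)"
proof -
  have "f integrable_on {0..t}"
    by (intro integrable_continuous_real continuous_on_subset[OF f]) (use st in auto)
  then have "integral {0..s} f + integral {s..t} f = integral {0..t} f"
    by (intro Henstock_Kurzweil_Integration.integral_combine) (use st in auto)
  moreover have "norm (integral {s..t} f) \<le> B * (t - s)"
    by (intro integral_bound continuous_on_subset[OF f]) (use st B in auto)
  ultimately show ?thesis using st by (simp add: LBINT_eq_integral[OF f] abs_le_iff)
qed

lemma right_average_tendsto:
  fixes f :: "real \<Rightarrow> real"
  assumes f: "continuous_on {0..T} f" and t: "0 \<le> t" "t < T"
  shows "((\<lambda>\<epsilon>. ((LBINT s:{0..t + \<epsilon>}. f s) - (LBINT s:{0..t}. f s)) / \<epsilon>) \<longlongrightarrow> f t) (at_right 0)"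
proof -
  have small: "\<forall>\<^sub>F \<epsilon> in at_right 0. 0 < \<epsilon> \<and> \<epsilon> < T - t"
    unfolding eventually_at_right_field using t by (intro exI[of _ "T - t"]) auto
  have "((\<lambda>u. integral {0..u} f) has_real_derivative f t) (at t within {0..T})"
    unfolding has_real_derivative_iff_has_vector_derivative
    by (rule integral_has_vector_derivative[OF f]) (use t in auto)
  then have lim: "((\<lambda>y. (integral {0..y} f - integral {0..t} f) / (y - t)) \<longlongrightarrow> f t) (at t within {0..T})"
    by (simp add: has_field_derivative_iff)
  have "filterlim (\<lambda>\<epsilon>. t + \<epsilon>) (at t within {0..T}) (at_right 0)"
    unfolding filterlim_at
  proof
    show "\<forall>\<^sub>F \<epsilon> in at_right 0. t + \<epsilon> \<in> {0..T} \<and> t + \<epsilon> \<noteq> t"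
      using small by eventually_elim (use t in auto)
    have "((\<lambda>\<epsilon>. t + \<epsilon>) \<longlongrightarrow> t + 0) (at_right 0)" by (intro tendsto_intros)
    then show "((\<lambda>\<epsilon>. t + \<epsilon>) \<longlongrightarrow> t) (at_right 0)" by simp
  qed
  from filterlim_compose[OF lim this]
  show ?thesis
  proof (rule Lim_transform_eventually)
    show "\<forall>\<^sub>F \<epsilon> in at_right 0. (integral {0..t + \<epsilon>} f - integral {0..t} f) / (t + \<epsilon> - t)
      = ((LBINT s:{0..t + \<epsilon>}. f s) - (LBINT s:{0..t}. f s)) / \<epsilon>"
      using small by eventually_elim (use t in \<open>auto simp: LBINT_eq_integral[OF f]\<close>)
  qed
qed

text \<open>
  Were \<open>|f - f a|\<close> to exceed the line of slope \<open>e\<close> at \<open>b\<close>, consider the last point \<open>t\<close> where it does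
  not. Since the right derivative at \<open>t\<close> is \<open>0\<close>, the bound persists to the right of \<open>t\<close>, a contradiction.
\<close>

lemma zero_right_derivative_imp_constant:
  fixes f :: "real \<Rightarrow> real"
  assumes f: "continuous_on {a..b} f" and ab: "a \<le> b"
    and d: "\<And>t. a \<le> t \<Longrightarrow> t < b \<Longrightarrow> ((\<lambda>\<epsilon>. (f (t + \<epsilon>) - f t) / \<epsilon>) \<longlongrightarrow> 0) (at_right 0)"
  shows "f b = f a"
proof -
  have "\<bar>f b - f a\<bar> \<le> e * (b - a)" if "e > 0" for e
  proof (rule ccontr)
    assume neg: "\<not> \<bar>f b - f a\<bar> \<le> e * (b - a)"
    define \<psi> where "\<psi> t = \<bar>f t - f a\<bar> - e * (t - a)" for t
    have \<psi>c: "continuous_on {a..b} \<psi>" unfolding \<psi>_def by (intro continuous_intros f)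
    define S where "S = {t \<in> {a..b}. \<psi> t \<le> 0}"
    have "closed S" unfolding S_def
      by (rule continuous_closed_preimage[of _ _ "{..0}", simplified vimage_def Collect_conj_eq[symmetric] Int_def, simplified])
        (use \<psi>c in auto)
    moreover have "bounded S" by (rule bounded_subset[of "{a..b}"]) (auto simp: S_def)
    ultimately have "compact S" by (simp add: compact_eq_bounded_closed)
    moreover have "a \<in> S" using ab by (auto simp: S_def \<psi>_def)
    ultimately obtain t where t: "t \<in> S" "\<And>s. s \<in> S \<Longrightarrow> s \<le> t"
      using compact_attains_sup[of S] by blast
    have "t < b" using t(1) neg by (auto simp: S_def \<psi>_def less_le)
    have "a \<le> t" using t(1) by (auto simp: S_def)
    have "\<forall>\<^sub>F \<epsilon> in at_right 0. \<bar>(f (t + \<epsilon>) - f t) / \<epsilon>\<bar> < e"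
      using tendstoD[OF d[OF \<open>a \<le> t\<close> \<open>t < b\<close>] that] by (simp add: dist_real_def)
    moreover have "\<forall>\<^sub>F \<epsilon> in at_right 0. 0 < \<epsilon> \<and> \<epsilon> < b - t"
      unfolding eventually_at_right_field using \<open>t < b\<close> by (intro exI[of _ "b - t"]) auto
    ultimately have "\<forall>\<^sub>F \<epsilon> in at_right 0. \<bar>(f (t + \<epsilon>) - f t) / \<epsilon>\<bar> < e \<and> 0 < \<epsilon> \<and> \<epsilon> < b - t"
      by eventually_elim auto
    then obtain \<epsilon> where \<epsilon>: "\<bar>(f (t + \<epsilon>) - f t) / \<epsilon>\<bar> < e" "0 < \<epsilon>" "\<epsilon> < b - t"
      using eventually_happens by fastforce
    then have "\<bar>f (t + \<epsilon>) - f t\<bar> \<le> e * \<epsilon>" by (simp add: abs_divide field_simps)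
    then have "\<psi> (t + \<epsilon>) \<le> \<psi> t" unfolding \<psi>_def by (simp add: algebra_simps abs_le_iff abs_if split: if_splits)
    also have "\<psi> t \<le> 0" using t(1) by (simp add: S_def)
    finally have "t + \<epsilon> \<in> S" using \<epsilon> \<open>a \<le> t\<close> by (auto simp: S_def)
    with t(2)[OF this] \<epsilon> show False by simp
  qed
  note * = this
  have "\<bar>f b - f a\<bar> \<le> 0 + e" if "e > 0" for e
  proof (cases "a = b")
    case False
    then show ?thesis using *[of "e / (b - a)"] that ab by simp
  qed (use that in auto)
  then have "\<bar>f b - f a\<bar> \<le> 0" by (rule field_le_epsilon)
  then show ?thesis by simp
qed

text \<open>
  Dominated convergence for a limit along \<open>at_right 0\<close>, by restriction to sequences.
\<close>

lemma bounded_convergence_at_right: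
  fixes f :: "real \<Rightarrow> 'a \<Rightarrow> real"
  assumes M: "finite_measure M" and e: "e > 0"
    and f: "\<And>\<epsilon>. 0 < \<epsilon> \<Longrightarrow> \<epsilon> < e \<Longrightarrow> f \<epsilon> \<in> borel_measurable M"
    and l: "l \<in> borel_measurable M"
    and bd: "\<And>\<epsilon>. 0 < \<epsilon> \<Longrightarrow> \<epsilon> < e \<Longrightarrow> AE \<omega> in M. \<bar>f \<epsilon> \<omega>\<bar> \<le> K"
    and lim: "AE \<omega> in M. ((\<lambda>\<epsilon>. f \<epsilon> \<omega>) \<longlongrightarrow> l \<omega>) (at_right 0)"
  shows "((\<lambda>\<epsilon>. \<integral>\<omega>. f \<epsilon> \<omega> \<partial>M) \<longlongrightarrow> (\<integral>\<omega>. l \<omega> \<partial>M)) (at_right 0)"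
proof (rule tendsto_at_right_sequentially[OF e])
  interpret finite_measure M by (rule M)
  fix S :: "nat \<Rightarrow> real"
  assume S: "\<And>n. 0 < S n" "\<And>n. S n < e" "S \<longlonglongrightarrow> 0"
  then have S0: "filterlim S (at_right 0) sequentially"
    by (simp add: filterlim_at less_imp_neq[symmetric])
  have "AE \<omega> in M. (\<lambda>n. f (S n) \<omega>) \<longlonglongrightarrow> l \<omega>"
    using lim by eventually_elim (rule filterlim_compose[OF _ S0])
  then show "(\<lambda>n. \<integral>\<omega>. f (S n) \<omega> \<partial>M) \<longlonglongrightarrow> (\<integral>\<omega>. l \<omega> \<partial>M)"
    by (rule integral_dominated_convergence[where w = "\<lambda>_. K", rotated 3])
      (auto intro!: l f S bd simp del: real_norm_def simp: real_norm_def[abs_def])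
qed

section \<open>Vector-valued integrals and measurable processes\<close>

lemma vec_nth_measurable [measurable (raw)]:
  fixes X :: "'a \<Rightarrow> real ^ 'n"
  assumes "X \<in> borel_measurable M"
  shows "(\<lambda>\<omega>. X \<omega> $ i) \<in> borel_measurable M"
  using measurable_compose[OF assms, of "\<lambda>x. x $ i" borel]
  by (simp add: borel_measurable_continuous_onI continuous_on_component)

lemma vec_eq_sum_axis: "(x :: real ^ 'n) = (\<Sum>i\<in>UNIV. (x $ i) *\<^sub>R axis i 1)"
  by (simp add: basis_expansion scalar_mult_eq_scaleR[symmetric])

lemma integrable_vecI:
  fixes X :: "'a \<Rightarrow> real ^ 'n"
  assumes "\<And>i. integrable M (\<lambda>\<omega>. X \<omega> $ i)"
  shows "integrable M X"
proof -
  have "integrable M (\<lambda>\<omega>. \<Sum>i\<in>UNIV. (X \<omega> $ i) *\<^sub>R axis i (1::real))"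
    using assms by (intro Bochner_Integration.integrable_sum integrable_scaleR_left) auto
  then show ?thesis by (simp flip: vec_eq_sum_axis)
qed

lemma integrable_vec_nth:
  fixes X :: "'a \<Rightarrow> real ^ 'n"
  assumes "integrable M X"
  shows "integrable M (\<lambda>\<omega>. X \<omega> $ i)"
  by (rule integrable_bounded_linear[OF bounded_linear_vec_nth assms])

lemma set_integral_vec_nth:
  fixes f :: "'a \<Rightarrow> real ^ 'n"
  assumes "set_integrable M A f"
  shows "(LINT s:A|M. f s) $ i = (LINT s:A|M. f s $ i)"
  using integral_bounded_linear[OF bounded_linear_vec_nth assms[unfolded set_integrable_def], of i]
  by (simp add: set_lebesgue_integral_def)

text \<open>
  The process is the pointwise limit of its discretisations at the grid points
  \<open>\<lfloor>t n\<rfloor> / n\<close>, each of which involves only countably many times.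
\<close>

lemma jointly_measurable_continuous_process:
  fixes X :: "real \<Rightarrow> 'a \<Rightarrow> 'b::metric_space"
  assumes T: "0 \<le> T" and X: "\<And>t. t \<in> {0..T} \<Longrightarrow> X t \<in> borel_measurable M"
    and cont: "\<And>\<omega>. \<omega> \<in> space M \<Longrightarrow> continuous_on {0..T} (\<lambda>t. X t \<omega>)"
  shows "jointly_measurable M T X"
  unfolding jointly_measurable_def
proof (rule borel_measurable_LIMSEQ_metric)
  define r where "r n i = max 0 (min T (real_of_int i / real (Suc n)))" for n i
  have r: "r n i \<in> {0..T}" for n i using T by (auto simp: r_def)
  have rlim: "(\<lambda>n. r n \<lfloor>t * real (Suc n)\<rfloor>) \<longlonglongrightarrow> t" if "t \<in> {0..T}" for t
  proof (rule LIM_zero_cancel, rule Lim_null_comparison)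
    show "\<forall>\<^sub>F n in sequentially. norm (r n \<lfloor>t * real (Suc n)\<rfloor> - t) \<le> 1 / real (Suc n)"
    proof (rule always_eventually, rule allI)
      fix n
      have "real_of_int \<lfloor>t * real (Suc n)\<rfloor> \<le> t * real (Suc n)"
        "t * real (Suc n) - 1 \<le> real_of_int \<lfloor>t * real (Suc n)\<rfloor>"
        by linarith+
      moreover have "real_of_int \<lfloor>t * real (Suc n)\<rfloor> \<ge> 0" using that by simp
      ultimately have "real_of_int \<lfloor>t * real (Suc n)\<rfloor> / real (Suc n) \<le> (t * real (Suc n)) / real (Suc n)"
        "(t * real (Suc n) - 1) / real (Suc n) \<le> real_of_int \<lfloor>t * real (Suc n)\<rfloor> / real (Suc n)"
        "0 \<le> real_of_int \<lfloor>t * real (Suc n)\<rfloor> / real (Suc n)"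
        by (intro divide_right_mono divide_nonneg_nonneg; simp)+
      then have "real_of_int \<lfloor>t * real (Suc n)\<rfloor> / real (Suc n) \<le> t"
        "t - 1 / real (Suc n) \<le> real_of_int \<lfloor>t * real (Suc n)\<rfloor> / real (Suc n)"
        "0 \<le> real_of_int \<lfloor>t * real (Suc n)\<rfloor> / real (Suc n)"
        by (simp_all add: diff_divide_distrib del: of_nat_Suc)
      then show "norm (r n \<lfloor>t * real (Suc n)\<rfloor> - t) \<le> 1 / real (Suc n)"
        using that unfolding r_def real_norm_def by (simp add: min_def max_def del: of_nat_Suc)
    qed
    show "(\<lambda>n. 1 / real (Suc n)) \<longlonglongrightarrow> 0" by (rule LIMSEQ_Suc[OF lim_1_over_n])
  qed
  show "(\<lambda>(t, \<omega>). X (r n \<lfloor>t * real (Suc n)\<rfloor>) \<omega>) \<in> borel_measurable (restrict_space borel {0..T} \<Otimes>\<^sub>M M)" for n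
  proof -
    have 1: "(\<lambda>z. X (r n i) (snd z)) \<in> borel_measurable (restrict_space borel {0..T} \<Otimes>\<^sub>M M)" for i
      using X[OF r[of n i]] by measurable
    have 2: "(\<lambda>z. \<lfloor>fst z * real (Suc n)\<rfloor>) \<in> measurable (restrict_space borel {0..T} \<Otimes>\<^sub>M M) (count_space UNIV)"
    proof -
      have [measurable]: "(\<lambda>z. fst z) \<in> borel_measurable (restrict_space borel {0..T} \<Otimes>\<^sub>M M)"
        by (rule measurable_compose[OF measurable_fst]) (simp add: measurable_restrict_space1)
      show ?thesis by measurable
    qed
    from measurable_compose_countable[OF 1 2] show ?thesis by (simp add: case_prod_beta')
  qed
  fix z assume "z \<in> space (restrict_space borel {0..T} \<Otimes>\<^sub>M M)"
  then have z: "fst z \<in> {0..T}" "snd z \<in> space M"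
    by (auto simp: space_pair_measure space_restrict_space)
  have "(\<lambda>n. X (r n \<lfloor>fst z * real (Suc n)\<rfloor>) (snd z)) \<longlonglongrightarrow> X (fst z) (snd z)"
    using r rlim[OF z(1)] z(1)
    by (intro continuous_on_tendsto_compose[OF cont[OF z(2)]]) auto
  then show "(\<lambda>n. case z of (t, \<omega>) \<Rightarrow> X (r n \<lfloor>t * real (Suc n)\<rfloor>) \<omega>) \<longlonglongrightarrow> (case z of (t, \<omega>) \<Rightarrow> X t \<omega>)"
    by (simp add: case_prod_beta')
qed

text \<open>
  Lebesgue measure as a measure on the space \<open>[0, T]\<close>, so that the product with \<open>M\<close> is a finite
  measure and Fubini's theorem applies to processes that are defined on \<open>[0, T]\<close> only.
\<close>

abbreviation time_measure :: "real \<Rightarrow> real measure" where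
  "time_measure T \<equiv> restrict_space lborel {0..T}"

lemma LBINT_eq_restrict_space:
  fixes f :: "real \<Rightarrow> real"
  assumes "t \<le> T"
  shows "(LBINT r:{0..t}. f r) = (\<integral>r. indicator {0..t} r * f r \<partial>time_measure T)"
  unfolding set_lebesgue_integral_def
  by (subst integral_restrict_space) (use assms in \<open>auto intro!: Bochner_Integration.integral_cong simp: indicator_def\<close>)

lemma finite_measure_restrict_lborel: "finite_measure (time_measure T)"
  by (rule finite_measureI) (simp add: space_restrict_space emeasure_restrict_space emeasure_lborel_Icc_eq)

lemma jointly_measurable_lborel:
  fixes X :: "real \<Rightarrow> 'a \<Rightarrow> 'b::topological_space"
  shows "jointly_measurable M T X \<longleftrightarrow>
     (\<lambda>(t, \<omega>). X t \<omega>) \<in> borel_measurable (time_measure T \<Otimes>\<^sub>M M)"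
proof -
  have "sets (restrict_space borel {0..T} \<Otimes>\<^sub>M M) = sets (time_measure T \<Otimes>\<^sub>M M)"
    by (intro sets_pair_measure_cong sets_restrict_space_cong) auto
  from measurable_cong_sets[OF this refl, of "borel :: 'b measure"] show ?thesis by (simp only: jointly_measurable_def)
qed

lemma jointly_measurable_swap:
  assumes "jointly_measurable M T X"
  shows "(\<lambda>(\<omega>, t). X t \<omega>) \<in> borel_measurable (M \<Otimes>\<^sub>M time_measure T)"
  using measurable_compose[OF measurable_pair_swap' assms[unfolded jointly_measurable_lborel]]
  by (simp add: case_prod_beta')

lemma jointly_measurable_vec_nth:
  fixes X :: "real \<Rightarrow> 'a \<Rightarrow> real ^ 'n"
  assumes "jointly_measurable M T X"
  shows "jointly_measurable M T (\<lambda>t \<omega>. X t \<omega> $ i)"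
  using vec_nth_measurable[OF assms[unfolded jointly_measurable_def], of i]
  by (simp add: jointly_measurable_def case_prod_beta')

lemma measurable_LBINT_process:
  fixes X :: "real \<Rightarrow> 'a \<Rightarrow> real"
  assumes X: "jointly_measurable M T X" and "t \<le> T"
  shows "(\<lambda>\<omega>. LBINT r:{0..t}. X r \<omega>) \<in> borel_measurable M"
proof -
  interpret finite_measure "time_measure T" by (rule finite_measure_restrict_lborel)
  note jointly_measurable_swap[OF X, measurable]
  have [measurable]: "{0..t} \<inter> {0..T} \<in> sets (time_measure T)"
    by (simp add: sets_restrict_space_iff)
  have "(indicator {0..t} :: real \<Rightarrow> real) \<in> borel_measurable (time_measure T)"
    by (intro measurable_restrict_space1) simp
  then have [measurable]: "(\<lambda>z :: 'a \<times> real. indicator {0..t} (snd z) :: real) \<in> borel_measurable (M \<Otimes>\<^sub>M time_measure T)"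
    by (rule measurable_compose[OF measurable_snd])
  have "(\<lambda>(\<omega>, r). indicator {0..t} r * X r \<omega>) \<in> borel_measurable (M \<Otimes>\<^sub>M time_measure T)"
    by (simp add: case_prod_beta')
  from borel_measurable_lebesgue_integral[OF this] show ?thesis
    by (simp add: LBINT_eq_restrict_space[OF assms(2)])
qed

lemma integral_restrict_lborel:
  fixes f :: "real \<Rightarrow> real"
  shows "(\<integral>t. f t \<partial>time_measure T) = (LBINT t:{0..T}. f t)"
    and "integrable (time_measure T) f \<longleftrightarrow> set_integrable lborel {0..T} f"
  by (simp_all add: integral_restrict_space integrable_restrict_space set_lebesgue_integral_def set_integrable_def)

lemma integrable_mult_bounded:
  fixes c f :: "'a \<Rightarrow> real"
  assumes "integrable M c" "f \<in> borel_measurable M" "\<And>x. x \<in> space M \<Longrightarrow> \<bar>f x\<bar> \<le> K"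
  shows "integrable M (\<lambda>x. c x * f x)"
proof (rule Bochner_Integration.integrable_bound)
  show "integrable M (\<lambda>x. K * c x)" using assms(1) by simp
  show "AE x in M. norm (c x * f x) \<le> norm (K * c x)"
  proof (rule AE_I2)
    fix x assume "x \<in> space M"
    from assms(3)[OF this] have "\<bar>f x\<bar> \<le> \<bar>K\<bar>" by simp
    then have "\<bar>f x\<bar> * \<bar>c x\<bar> \<le> \<bar>K\<bar> * \<bar>c x\<bar>" by (rule mult_right_mono) simp
    then show "norm (c x * f x) \<le> norm (K * c x)" by (simp add: abs_mult mult.commute)
  qed
qed (use assms in auto)

lemma (in finite_measure) integrable_of_square_integrable:
  fixes f :: "'a \<Rightarrow> real"
  assumes "f \<in> borel_measurable M" "integrable M (\<lambda>x. (f x)\<^sup>2)"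
  shows "integrable M f"
proof (rule Bochner_Integration.integrable_bound)
  show "integrable M (\<lambda>x. 1 + (f x)\<^sup>2)" using assms(2) by simp
  have "\<bar>y\<bar> \<le> 1 + y\<^sup>2" for y :: real
    using zero_le_power2[of "\<bar>y\<bar> - 1"] by (simp add: power2_diff)  
  then show "AE x in M. norm (f x) \<le> norm (1 + (f x)\<^sup>2)" by auto
qed (use assms in auto)

section \<open>Conditional expectations and mean derivatives\<close>

context
  fixes M :: "'a measure" and F :: "real \<Rightarrow> 'a measure"
  assumes filt: "filtered_prob_space M F"
begin

lemma prob_space_M: "prob_space M" using filt by (simp add: filtered_prob_space_def)

lemma subalgebra_F: "subalgebra M (F t)" using filt by (simp add: filtered_prob_space_def)

lemma measurable_F_M: "X \<in> measurable (F t) N \<Longrightarrow> X \<in> measurable M N"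
  by (rule measurable_from_subalg[OF subalgebra_F])

lemma measurable_F_mono:
  assumes "s \<le> t" "X \<in> measurable (F s) N"
  shows "X \<in> measurable (F t) N"
proof (rule measurable_from_subalg[OF _ assms(2)])
  have "filtration (space M) F" using filt by (simp add: filtered_prob_space_def)
  then show "subalgebra (F t) (F s)"
    using assms(1) by (auto simp: subalgebra_def filtration_def)
qed

lemma sigma_finite_subalgebra_F: "sigma_finite_subalgebra M (F t)"
proof -
  interpret prob_space M by (rule prob_space_M)
  show ?thesis
    by (intro finite_measure_subalgebra_is_sigma_finite finite_measure_subalgebra.intro
        finite_measure_subalgebra_axioms.intro subalgebra_F finite_measure_axioms)
qed

text \<open>
  Test the conditional expectation against its own sign, which is measurable for the smaller
  \<open>\<sigma>\<close>-algebra.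
\<close>

lemma real_cond_exp_contraction:
  assumes "integrable M X"
  shows "(\<integral>\<omega>. \<bar>real_cond_exp M (F t) X \<omega>\<bar> \<partial>M) \<le> (\<integral>\<omega>. \<bar>X \<omega>\<bar> \<partial>M)"
proof -
  interpret sigma_finite_subalgebra M "F t" by (rule sigma_finite_subalgebra_F)
  let ?E = "real_cond_exp M (F t) X"
  have [measurable]: "X \<in> borel_measurable M" using assms by auto
  have int: "integrable M (\<lambda>\<omega>. sgn (?E \<omega>) * X \<omega>)"
    by (rule Bochner_Integration.integrable_bound[OF assms])
      (auto simp: abs_mult sgn_if measurable_F_M)
  have "(\<integral>\<omega>. \<bar>?E \<omega>\<bar> \<partial>M) = (\<integral>\<omega>. sgn (?E \<omega>) * ?E \<omega> \<partial>M)"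
    by (simp add: abs_sgn mult.commute)
  also have "\<dots> = (\<integral>\<omega>. sgn (?E \<omega>) * X \<omega> \<partial>M)"
    by (rule real_cond_exp_intg(2)[OF int]) auto
  also have "\<dots> \<le> (\<integral>\<omega>. \<bar>X \<omega>\<bar> \<partial>M)"
    by (rule integral_mono[OF int]) (auto simp: assms sgn_if)
  finally show ?thesis .
qed

lemma integrable_vec_cond_exp:
  assumes "integrable M X"
  shows "integrable M (vec_cond_exp M (F t) X)"
proof -
  interpret sigma_finite_subalgebra M "F t" by (rule sigma_finite_subalgebra_F)
  show ?thesis
    by (rule integrable_vecI) (simp add: vec_cond_exp_def real_cond_exp_int(1) integrable_vec_nth assms)
qed

lemma mean_derivative_at_unique:
  assumes X: "mean_derivative_at M F \<xi> t X" and Y: "mean_derivative_at M F \<xi> t Y"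
  shows "AE \<omega> in M. X \<omega> = Y \<omega>"
proof -
  define V where "V \<epsilon> = vec_cond_exp M (F t) (\<lambda>\<omega>. (\<xi> (t + \<epsilon>) \<omega> - \<xi> t \<omega>) /\<^sub>R \<epsilon>)" for \<epsilon>
  have int: "integrable M X" "integrable M Y" using X Y by (auto simp: mean_derivative_at_def)
  have "\<forall>\<^sub>F \<epsilon> in at_right 0. integrable M (\<lambda>\<omega>. \<xi> (t + \<epsilon>) \<omega> - \<xi> t \<omega>)"
    using X by (auto simp: mean_derivative_at_def)
  then have le: "\<forall>\<^sub>F \<epsilon> in at_right 0. (\<integral>\<omega>. norm (X \<omega> - Y \<omega>) \<partial>M)
      \<le> (\<integral>\<omega>. norm (V \<epsilon> \<omega> - X \<omega>) \<partial>M) + (\<integral>\<omega>. norm (V \<epsilon> \<omega> - Y \<omega>) \<partial>M)"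
  proof eventually_elim
    case (elim \<epsilon>)
    then have "integrable M (V \<epsilon>)" unfolding V_def
      by (intro integrable_vec_cond_exp integrable_scaleR_right)
    have "(\<integral>\<omega>. norm (X \<omega> - Y \<omega>) \<partial>M) \<le> (\<integral>\<omega>. norm (V \<epsilon> \<omega> - X \<omega>) + norm (V \<epsilon> \<omega> - Y \<omega>) \<partial>M)"
    proof (rule integral_mono)
      fix \<omega> show "norm (X \<omega> - Y \<omega>) \<le> norm (V \<epsilon> \<omega> - X \<omega>) + norm (V \<epsilon> \<omega> - Y \<omega>)"
        by (metis dist_norm dist_triangle3)
    qed (use int \<open>integrable M (V \<epsilon>)\<close> in auto)
    also have "\<dots> = (\<integral>\<omega>. norm (V \<epsilon> \<omega> - X \<omega>) \<partial>M) + (\<integral>\<omega>. norm (V \<epsilon> \<omega> - Y \<omega>) \<partial>M)"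
      by (rule Bochner_Integration.integral_add) (use int \<open>integrable M (V \<epsilon>)\<close> in auto)
    finally show ?case .
  qed
  have "((\<lambda>\<epsilon>. (\<integral>\<omega>. norm (V \<epsilon> \<omega> - X \<omega>) \<partial>M) + (\<integral>\<omega>. norm (V \<epsilon> \<omega> - Y \<omega>) \<partial>M)) \<longlongrightarrow> 0 + 0) (at_right 0)"
    using X Y unfolding mean_derivative_at_def V_def by (intro tendsto_add) auto
  then have "(\<integral>\<omega>. norm (X \<omega> - Y \<omega>) \<partial>M) \<le> 0"
    using tendsto_lowerbound[OF _ le] by simp
  then have "(\<integral>\<omega>. norm (X \<omega> - Y \<omega>) \<partial>M) = 0"
    by (simp add: order_antisym)
  then have "AE \<omega> in M. norm (X \<omega> - Y \<omega>) = 0"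
    by (subst (asm) integral_nonneg_eq_0_iff_AE) (use int in auto)
  then show ?thesis by simp
qed

text \<open>
  The first absolute moment of one coordinate of a product of Gaussian densities factorises over the
  coordinates. The mean vanishes since the density is even, and independence turns this into a
  vanishing conditional mean.
\<close>

lemma brownian_increment:
  fixes w :: "real \<Rightarrow> 'a \<Rightarrow> real ^ 'n"
  assumes w: "brownian_motion M F T w" and st: "0 \<le> s" "s < t" "t \<le> T"
  shows "integrable M (\<lambda>\<omega>. (w t \<omega> - w s \<omega>) $ i)"
    and "AE \<omega> in M. real_cond_exp M (F s) (\<lambda>\<omega>. (w t \<omega> - w s \<omega>) $ i) \<omega> = 0"
proof -
  interpret prob_space M by (rule prob_space_M)
  interpret sigma_finite_subalgebra M "F s" by (rule sigma_finite_subalgebra_F)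
  define W where "W \<omega> = w t \<omega> - w s \<omega>" for \<omega>
  define \<sigma> where "\<sigma> = sqrt (t - s)"
  have \<sigma>: "\<sigma> > 0" using st by (simp add: \<sigma>_def)
  let ?\<rho> = "\<lambda>x :: real ^ 'n. \<Prod>i\<in>UNIV. normal_density 0 \<sigma> (x $ i)"
  have indep: "indep_set (sets (F s)) (sets (vimage_algebra (space M) W borel))"
    and D: "distributed M lborel W (\<lambda>x. ennreal (?\<rho> x))"
    using w st unfolding brownian_motion_def W_def[abs_def] \<sigma>_def by auto
  have [measurable]: "W \<in> borel_measurable M" using distributed_measurable[OF D] by simp
  have \<rho>0: "?\<rho> x \<ge> 0" for x by (intro prod_nonneg) auto
  have \<rho>m: "?\<rho> \<in> borel_measurable lborel" by measurable
  have "(\<integral>\<^sup>+x. ennreal (?\<rho> x * \<bar>x $ i\<bar>) \<partial>lborel) < \<infinity>"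
  proof -
    define q where "q b y = normal_density 0 \<sigma> y * (if b = axis i 1 then \<bar>y\<bar> else 1)"
      for b :: "real ^ 'n" and y
    have [measurable]: "q b \<in> borel_measurable borel" for b unfolding q_def by measurable
    have q0: "q b y \<ge> 0" for b y by (simp add: q_def)
    have B: "(Basis :: (real ^ 'n) set) = (\<lambda>j. axis j 1) ` UNIV" by (auto simp: Basis_vec_def)
    have inj: "inj (\<lambda>j :: 'n. axis j (1 :: real))" by (simp add: inj_on_def axis_eq_axis)
    have eq: "?\<rho> x * \<bar>x $ i\<bar> = (\<Prod>b\<in>Basis. q b (x \<bullet> b))" for x :: "real ^ 'n"
    proof -
      have "(\<Prod>b\<in>Basis. q b (x \<bullet> b)) = (\<Prod>j\<in>UNIV. q (axis j 1) (x $ j))"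
        unfolding B prod.reindex[OF inj] by (simp add: cart_eq_inner_axis)
      also have "\<dots> = (\<Prod>j\<in>UNIV. normal_density 0 \<sigma> (x $ j) * (if j = i then \<bar>x $ j\<bar> else 1))"
        by (intro prod.cong refl) (simp add: q_def axis_eq_axis)
      also have "\<dots> = ?\<rho> x * (\<Prod>j\<in>UNIV. if j = i then \<bar>x $ j\<bar> else 1)"
        by (rule prod.distrib)
      also have "(\<Prod>j\<in>UNIV. if j = i then \<bar>x $ j\<bar> else 1) = \<bar>x $ i\<bar>"
        by (simp add: prod.delta)
      finally show ?thesis by simp
    qed
    have "(\<integral>\<^sup>+x. ennreal (?\<rho> x * \<bar>x $ i\<bar>) \<partial>lborel) = (\<integral>\<^sup>+x. (\<Prod>b\<in>Basis. ennreal (q b (x \<bullet> b))) \<partial>(lborel :: (real ^ 'n) measure))"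
      by (simp add: eq prod_ennreal q0)
    also have "\<dots> = (\<Prod>b\<in>(Basis :: (real ^ 'n) set). \<integral>\<^sup>+y. ennreal (q b y) \<partial>lborel)"
      by (rule nn_integral_lborel_prod) auto
    also have "\<dots> < \<infinity>"
    proof -
      have "integrable lborel (q b)" for b
      proof (cases "b = axis i 1")
        case True
        have "integrable lborel (\<lambda>y. normal_density 0 \<sigma> y * (y - 0) ^ 1)"
          by (rule integrable_normal_moment[OF \<sigma>])
        from integrable_abs[OF this] show ?thesis
          by (simp add: q_def[abs_def] True abs_mult)
      next
        case False
        then show ?thesis using integrable_normal_density[OF \<sigma>, of 0] by (simp add: q_def[abs_def])
      qed
      then have "(\<integral>\<^sup>+y. ennreal (q b y) \<partial>lborel) < \<infinity>" for b
        by (subst nn_integral_eq_integral) (auto simp: q0)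
      then show ?thesis by (simp add: less_top[symmetric] ennreal_prod_eq_top)
    qed
    finally show ?thesis .
  qed
  then have int\<rho>: "integrable lborel (\<lambda>x. ?\<rho> x * x $ i)"
    by (intro integrableI_bounded) (auto simp: abs_mult \<rho>0)
  have "integrable M (\<lambda>\<omega>. W \<omega> $ i) \<longleftrightarrow> integrable lborel (\<lambda>x. ?\<rho> x * x $ i)"
    using distributed_integrable[OF D _ \<rho>0, of "\<lambda>x. x $ i"] by simp
  with int\<rho> have int: "integrable M (\<lambda>\<omega>. W \<omega> $ i)" by simp
  have uminus: "distr lborel borel uminus = (lborel :: (real ^ 'n) measure)"
    using lborel_affine[of "-1" "0 :: real ^ 'n", symmetric] by (simp add: density_1)
  have "expectation (\<lambda>\<omega>. W \<omega> $ i) = (\<integral>x. ?\<rho> x * x $ i \<partial>lborel)"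
    using distributed_integral[OF D _ \<rho>0, of "\<lambda>x. x $ i"] by simp
  also have "\<dots> = (\<integral>x. ?\<rho> (- x) * (- x) $ i \<partial>lborel)"
    using integral_distr[of uminus lborel borel "\<lambda>x. ?\<rho> x * x $ i"] unfolding uminus by simp
  also have "\<dots> = - (\<integral>x. ?\<rho> x * x $ i \<partial>lborel)"
    by (simp add: normal_density_def)
  finally have mean: "expectation (\<lambda>\<omega>. W \<omega> $ i) = 0"
    using distributed_integral[OF D _ \<rho>0, of "\<lambda>x. x $ i"] by simp
  show "integrable M (\<lambda>\<omega>. (w t \<omega> - w s \<omega>) $ i)" using int by (simp add: W_def)
  have "AE \<omega> in M. real_cond_exp M (F s) (\<lambda>\<omega>. W \<omega> $ i) \<omega> = 0"
  proof (rule real_cond_exp_charact)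
    fix A assume A: "A \<in> sets (F s)"
    then have AM: "A \<in> sets M" using subalgebra_F[of s] by (auto simp: subalgebra_def)
    have "indep_var borel (indicator A :: 'a \<Rightarrow> real) borel (\<lambda>\<omega>. W \<omega> $ i)"
      unfolding indep_var_eq
    proof (intro conjI)
      have 1: "(indicator A :: 'a \<Rightarrow> real) \<in> borel_measurable (F s)" using A by simp
      have 2: "(\<lambda>\<omega>. W \<omega> $ i) \<in> borel_measurable (vimage_algebra (space M) W borel)"
        by (rule measurable_compose[OF measurable_vimage_algebra1]) auto
      have sp: "space (F s) = space M" using subalgebra_F[of s] by (auto simp: subalgebra_def)
      show "indep_set
         (sigma_sets (space M) {(indicator A :: 'a \<Rightarrow> real) -` B \<inter> space M |B. B \<in> sets borel})
         (sigma_sets (space M) {(\<lambda>\<omega>. W \<omega> $ i) -` B \<inter> space M |B. B \<in> sets borel})"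
        unfolding indep_set_def
      proof (rule indep_sets_mono_sets[OF indep[unfolded indep_set_def]])
        fix j :: bool
        have "{(indicator A :: 'a \<Rightarrow> real) -` B \<inter> space M |B. B \<in> sets borel} \<subseteq> sets (F s)"
          using measurable_sets[OF 1] unfolding sp by auto
        from sets.sigma_sets_subset[OF this]
        have a: "sigma_sets (space M) {(indicator A :: 'a \<Rightarrow> real) -` B \<inter> space M |B. B \<in> sets borel} \<subseteq> sets (F s)"
          unfolding sp .
        have "{(\<lambda>\<omega>. W \<omega> $ i) -` B \<inter> space M |B. B \<in> sets borel}
            \<subseteq> sets (vimage_algebra (space M) W borel)"
          using measurable_sets[OF 2] unfolding space_vimage_algebra by auto
        from sets.sigma_sets_subset[OF this]
        have b: "sigma_sets (space M) {(\<lambda>\<omega>. W \<omega> $ i) -` B \<inter> space M |B. B \<in> sets borel}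
            \<subseteq> sets (vimage_algebra (space M) W borel)"
          unfolding space_vimage_algebra .
        show "(case j of True \<Rightarrow> sigma_sets (space M) {(indicator A :: 'a \<Rightarrow> real) -` B \<inter> space M |B. B \<in> sets borel}
            | False \<Rightarrow> sigma_sets (space M) {(\<lambda>\<omega>. W \<omega> $ i) -` B \<inter> space M |B. B \<in> sets borel})
          \<subseteq> (case j of True \<Rightarrow> sets (F s) | False \<Rightarrow> sets (vimage_algebra (space M) W borel))"
          using a b by (cases j) auto
      qed
    qed (use AM in auto)
    from indep_var_lebesgue_integral[OF this _ int] AM
    have "expectation (\<lambda>\<omega>. indicat_real A \<omega> * W \<omega> $ i) = 0"
      by (simp add: mean integrable_real_indicator emeasure_finite less_top[symmetric])
    then show "(\<integral>\<omega>\<in>A. W \<omega> $ i \<partial>M) = (\<integral>\<omega>\<in>A. 0 \<partial>M)"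
      by (simp add: set_lebesgue_integral_def)
  qed (use int in auto)
  then show "AE \<omega> in M. real_cond_exp M (F s) (\<lambda>\<omega>. (w t \<omega> - w s \<omega>) $ i) \<omega> = 0"
    by (simp add: W_def)
qed

lemma adapted_measurable:
  fixes X :: "real \<Rightarrow> 'a \<Rightarrow> real ^ 'n"
  assumes "adapted F T X" "s \<in> {0..T}"
  shows "X s \<in> borel_measurable M"
  using assms by (auto simp: adapted_def intro!: measurable_F_M[of _ s])

text \<open>
  The Brownian part of the increment of \<open>g\<close> has conditional mean zero. What remains is the time average
  of \<open>b\<close> over \<open>[t, t + \<epsilon>]\<close>, which converges to \<open>b\<^sub>t\<close> pathwise and boundedly; conditioning does not
  increase the \<open>L\<^sup>1\<close> distance.
\<close>

lemma mean_derivative_at_of_drift: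
  fixes w g b :: "real \<Rightarrow> 'a \<Rightarrow> real ^ 'n"
  assumes w: "brownian_motion M F T w" and t: "0 \<le> t" "t < T"
    and g: "adapted F T g" and b: "adapted F T b"
    and bc: "\<And>\<omega>. \<omega> \<in> space M \<Longrightarrow> continuous_on {0..T} (\<lambda>s. b s \<omega>)"
    and bB: "\<And>s \<omega>. s \<in> {0..T} \<Longrightarrow> norm (b s \<omega>) \<le> B"
    and sde: "solves_sde M T \<nu> w g b"
  shows "mean_derivative_at M F g t (b t)"
proof -
  interpret prob_space M by (rule prob_space_M)
  interpret sigma_finite_subalgebra M "F t" by (rule sigma_finite_subalgebra_F)
  define \<sigma> where "\<sigma> = sqrt (2 * \<nu>)"
  define D where "D \<epsilon> i \<omega> = (g (t + \<epsilon>) \<omega> - g t \<omega>) $ i - \<sigma> * (w (t + \<epsilon>) \<omega> - w t \<omega>) $ i" for \<epsilon> i \<omega>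
  have wa: "adapted F T w" using w by (simp add: brownian_motion_def)
  have meas: "X s \<in> borel_measurable M" if "adapted F T X" "s \<in> {0..T}" for s and X :: "real \<Rightarrow> 'a \<Rightarrow> real ^ 'n"
    using that by (auto simp: adapted_def intro!: measurable_F_M[of _ s])
  have btF: "b t \<in> borel_measurable (F t)" using b t by (auto simp: adapted_def)
  have bci: "continuous_on {0..T} (\<lambda>s. b s \<omega> $ i)" if "\<omega> \<in> space M" for \<omega> i
    by (intro continuous_on_component bc that)
  have bBi: "\<bar>b s \<omega> $ i\<bar> \<le> B" if "s \<in> {0..T}" for s \<omega> i
    using bB[OF that] component_le_norm_cart order_trans by blast
  have sol: "AE \<omega> in M. \<forall>\<epsilon>. 0 < \<epsilon> \<longrightarrow> \<epsilon> < T - t \<longrightarrow>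
      D \<epsilon> i \<omega> = (LBINT s:{0..t + \<epsilon>}. b s \<omega> $ i) - (LBINT s:{0..t}. b s \<omega> $ i)" for i
    using sde unfolding solves_sde_def
  proof (rule AE_mp, intro AE_I2 impI allI)
    fix \<omega> \<epsilon> assume "\<omega> \<in> space M" and \<epsilon>: "0 < \<epsilon>" "\<epsilon> < T - t"
      and *: "set_integrable lborel {0..T} (\<lambda>s. b s \<omega>) \<and>
        (\<forall>t\<in>{0..T}. g t \<omega> = g 0 \<omega> + sqrt (2 * \<nu>) *\<^sub>R (w t \<omega> - w 0 \<omega>) + (LBINT s:{0..t}. b s \<omega>))"
    have si: "set_integrable lborel {0..s} (\<lambda>s. b s \<omega>)" if "s \<in> {0..T}" for s
      by (rule set_integrable_subset[OF conjunct1[OF *]]) (use that in auto)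
    have eq: "g s \<omega> $ i = g 0 \<omega> $ i + \<sigma> * (w s \<omega> $ i - w 0 \<omega> $ i) + (LBINT s:{0..s}. b s \<omega> $ i)"
      if "s \<in> {0..T}" for s
      using conjunct2[OF *, rule_format, OF that]
      by (simp add: \<sigma>_def set_integral_vec_nth[OF si[OF that]])
    show "D \<epsilon> i \<omega> = (LBINT s:{0..t + \<epsilon>}. b s \<omega> $ i) - (LBINT s:{0..t}. b s \<omega> $ i)"
      using eq[of t] eq[of "t + \<epsilon>"] t \<epsilon> by (simp add: D_def algebra_simps)
  qed
  have DB: "AE \<omega> in M. \<forall>\<epsilon>. 0 < \<epsilon> \<longrightarrow> \<epsilon> < T - t \<longrightarrow> \<bar>D \<epsilon> i \<omega>\<bar> \<le> B * \<epsilon>" for i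
    using sol[of i] AE_space
  proof eventually_elim
    case (elim \<omega>)
    show ?case
    proof (intro allI impI)
      fix \<epsilon> assume "0 < \<epsilon>" "\<epsilon> < T - t"
      then show "\<bar>D \<epsilon> i \<omega>\<bar> \<le> B * \<epsilon>"
        using LBINT_increment_bound[OF bci[OF elim(2), of i] bBi, of t "t + \<epsilon>"] elim(1) t by simp
    qed
  qed
  have Dm: "D \<epsilon> i \<in> borel_measurable M" if "0 < \<epsilon>" "\<epsilon> < T - t" for \<epsilon> i
    unfolding D_def[abs_def]
    by (intro borel_measurable_diff borel_measurable_times borel_measurable_const vec_nth_measurable meas[OF g] meas[OF wa])
      (use that t in auto)
  have Di: "integrable M (D \<epsilon> i)" if "0 < \<epsilon>" "\<epsilon> < T - t" for \<epsilon> i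
    by (rule integrable_const_bound[where B = "B * \<epsilon>"]) (use DB[of i] Dm[OF that] that in auto)
  have Wi: "integrable M (\<lambda>\<omega>. (w (t + \<epsilon>) \<omega> - w t \<omega>) $ i)" 
    and W0: "AE \<omega> in M. real_cond_exp M (F t) (\<lambda>\<omega>. (w (t + \<epsilon>) \<omega> - w t \<omega>) $ i) \<omega> = 0"
    if "0 < \<epsilon>" "\<epsilon> < T - t" for \<epsilon> i
    using brownian_increment[OF w, of t "t + \<epsilon>"] that t by auto
  have bi: "integrable M (\<lambda>\<omega>. b t \<omega> $ i)" for i
    by (rule integrable_const_bound[where B = B]) (use bBi[of t] t vec_nth_measurable[OF meas[OF b]] in auto)
  have gi: "integrable M (\<lambda>\<omega>. g (t + \<epsilon>) \<omega> - g t \<omega>)" if "0 < \<epsilon>" "\<epsilon> < T - t" for \<epsilon>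
  proof (rule integrable_vecI)
    fix i
    have "integrable M (\<lambda>\<omega>. D \<epsilon> i \<omega> + \<sigma> * (w (t + \<epsilon>) \<omega> - w t \<omega>) $ i)"
      by (intro Bochner_Integration.integrable_add integrable_mult_right Di Wi that)
    then show "integrable M (\<lambda>\<omega>. (g (t + \<epsilon>) \<omega> - g t \<omega>) $ i)" by (simp add: D_def)
  qed
  have small: "\<forall>\<^sub>F \<epsilon> in at_right 0. 0 < \<epsilon> \<and> \<epsilon> < T - t"
    unfolding eventually_at_right_field using t by (intro exI[of _ "T - t"]) auto
  define V where "V \<epsilon> = vec_cond_exp M (F t) (\<lambda>\<omega>. (g (t + \<epsilon>) \<omega> - g t \<omega>) /\<^sub>R \<epsilon>)" for \<epsilon>
  have le: "(\<integral>\<omega>. norm (V \<epsilon> \<omega> - b t \<omega>) \<partial>M) \<le> (\<Sum>i\<in>UNIV. \<integral>\<omega>. \<bar>D \<epsilon> i \<omega> / \<epsilon> - b t \<omega> $ i\<bar> \<partial>M)"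
    if \<epsilon>: "0 < \<epsilon>" "\<epsilon> < T - t" for \<epsilon>
  proof -
    have int: "integrable M (\<lambda>\<omega>. D \<epsilon> i \<omega> / \<epsilon> - b t \<omega> $ i)" for i
      by (intro Bochner_Integration.integrable_diff integrable_divide Di bi \<epsilon>)
    have V: "AE \<omega> in M. V \<epsilon> \<omega> $ i - b t \<omega> $ i = real_cond_exp M (F t) (\<lambda>\<omega>. D \<epsilon> i \<omega> / \<epsilon> - b t \<omega> $ i) \<omega>" for i
    proof -
      have eq: "(\<lambda>\<omega>. ((g (t + \<epsilon>) \<omega> - g t \<omega>) /\<^sub>R \<epsilon>) $ i) =
          (\<lambda>\<omega>. ((D \<epsilon> i \<omega> / \<epsilon> - b t \<omega> $ i) + b t \<omega> $ i) + \<sigma> / \<epsilon> * (w (t + \<epsilon>) \<omega> - w t \<omega>) $ i)"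
        using \<epsilon> by (auto simp: D_def fun_eq_iff divide_simps)
      have "AE \<omega> in M. real_cond_exp M (F t) (\<lambda>\<omega>. ((g (t + \<epsilon>) \<omega> - g t \<omega>) /\<^sub>R \<epsilon>) $ i) \<omega> =
          real_cond_exp M (F t) (\<lambda>\<omega>. (D \<epsilon> i \<omega> / \<epsilon> - b t \<omega> $ i) + b t \<omega> $ i) \<omega> +
          real_cond_exp M (F t) (\<lambda>\<omega>. \<sigma> / \<epsilon> * (w (t + \<epsilon>) \<omega> - w t \<omega>) $ i) \<omega>"
        unfolding eq
        by (rule real_cond_exp_add) (intro Bochner_Integration.integrable_add integrable_mult_right int bi Wi \<epsilon>)+
      moreover have "AE \<omega> in M. real_cond_exp M (F t) (\<lambda>\<omega>. (D \<epsilon> i \<omega> / \<epsilon> - b t \<omega> $ i) + b t \<omega> $ i) \<omega> =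
          real_cond_exp M (F t) (\<lambda>\<omega>. D \<epsilon> i \<omega> / \<epsilon> - b t \<omega> $ i) \<omega> + real_cond_exp M (F t) (\<lambda>\<omega>. b t \<omega> $ i) \<omega>"
        by (rule real_cond_exp_add[OF int bi])
      moreover have "AE \<omega> in M. real_cond_exp M (F t) (\<lambda>\<omega>. \<sigma> / \<epsilon> * (w (t + \<epsilon>) \<omega> - w t \<omega>) $ i) \<omega> =
          \<sigma> / \<epsilon> * real_cond_exp M (F t) (\<lambda>\<omega>. (w (t + \<epsilon>) \<omega> - w t \<omega>) $ i) \<omega>"
        by (rule real_cond_exp_cmult[OF Wi[OF \<epsilon>]])
      moreover have "AE \<omega> in M. real_cond_exp M (F t) (\<lambda>\<omega>. b t \<omega> $ i) \<omega> = b t \<omega> $ i"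
        by (rule real_cond_exp_F_meas[OF bi vec_nth_measurable[OF btF]])
      ultimately show ?thesis using W0[OF \<epsilon>, of i]
        by eventually_elim (simp add: V_def vec_cond_exp_def)
    qed
    have iV: "integrable M (V \<epsilon>)" unfolding V_def
      by (intro integrable_vec_cond_exp integrable_scaleR_right gi \<epsilon>)
    have ib: "integrable M (b t)" by (rule integrable_vecI[OF bi])
    have "(\<integral>\<omega>. norm (V \<epsilon> \<omega> - b t \<omega>) \<partial>M) \<le> (\<integral>\<omega>. (\<Sum>i\<in>UNIV. \<bar>V \<epsilon> \<omega> $ i - b t \<omega> $ i\<bar>) \<partial>M)"
    proof (rule integral_mono)
      show "integrable M (\<lambda>\<omega>. \<Sum>i\<in>UNIV. \<bar>V \<epsilon> \<omega> $ i - b t \<omega> $ i\<bar>)"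
        by (intro Bochner_Integration.integrable_sum integrable_abs Bochner_Integration.integrable_diff
            integrable_vec_nth iV ib)
      show "norm (V \<epsilon> \<omega> - b t \<omega>) \<le> (\<Sum>i\<in>UNIV. \<bar>V \<epsilon> \<omega> $ i - b t \<omega> $ i\<bar>)" for \<omega>
        using norm_le_l1_cart[of "V \<epsilon> \<omega> - b t \<omega>"] by simp
    qed (use iV ib in auto)
    also have "\<dots> = (\<Sum>i\<in>UNIV. \<integral>\<omega>. \<bar>V \<epsilon> \<omega> $ i - b t \<omega> $ i\<bar> \<partial>M)"
      by (intro Bochner_Integration.integral_sum integrable_abs Bochner_Integration.integrable_diff
          integrable_vec_nth iV ib)
    also have "\<dots> = (\<Sum>i\<in>UNIV. \<integral>\<omega>. \<bar>real_cond_exp M (F t) (\<lambda>\<omega>. D \<epsilon> i \<omega> / \<epsilon> - b t \<omega> $ i) \<omega>\<bar> \<partial>M)"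
    proof (intro sum.cong refl integral_cong_AE)
      fix i
      show "AE \<omega> in M. \<bar>V \<epsilon> \<omega> $ i - b t \<omega> $ i\<bar> = \<bar>real_cond_exp M (F t) (\<lambda>\<omega>. D \<epsilon> i \<omega> / \<epsilon> - b t \<omega> $ i) \<omega>\<bar>"
        using V[of i] by eventually_elim simp
      have "integrable M (\<lambda>\<omega>. \<bar>V \<epsilon> \<omega> $ i - b t \<omega> $ i\<bar>)" 
        by (intro integrable_abs Bochner_Integration.integrable_diff integrable_vec_nth iV ib)
      then show "(\<lambda>\<omega>. \<bar>V \<epsilon> \<omega> $ i - b t \<omega> $ i\<bar>) \<in> borel_measurable M" by auto
    qed auto
    also have "\<dots> \<le> (\<Sum>i\<in>UNIV. \<integral>\<omega>. \<bar>D \<epsilon> i \<omega> / \<epsilon> - b t \<omega> $ i\<bar> \<partial>M)"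
      by (intro sum_mono real_cond_exp_contraction int)
    finally show ?thesis .
  qed
  have lim: "((\<lambda>\<epsilon>. \<Sum>i\<in>UNIV. \<integral>\<omega>. \<bar>D \<epsilon> i \<omega> / \<epsilon> - b t \<omega> $ i\<bar> \<partial>M) \<longlongrightarrow> 0) (at_right 0)"
  proof (rule tendsto_null_sum)
    fix i
    have "((\<lambda>\<epsilon>. \<integral>\<omega>. \<bar>D \<epsilon> i \<omega> / \<epsilon> - b t \<omega> $ i\<bar> \<partial>M) \<longlongrightarrow> (\<integral>\<omega>. 0 \<partial>M)) (at_right 0)"
    proof (rule bounded_convergence_at_right[where e = "T - t" and K = "2 * B"])
      show "(\<lambda>\<omega>. \<bar>D \<epsilon> i \<omega> / \<epsilon> - b t \<omega> $ i\<bar>) \<in> borel_measurable M" if "0 < \<epsilon>" "\<epsilon> < T - t" for \<epsilon>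
        using Dm[OF that, of i] vec_nth_measurable[OF meas[OF b, of t], of i] t by auto
      show "AE \<omega> in M. \<bar>\<bar>D \<epsilon> i \<omega> / \<epsilon> - b t \<omega> $ i\<bar>\<bar> \<le> 2 * B" if "0 < \<epsilon>" "\<epsilon> < T - t" for \<epsilon>
        using DB[of i]
      proof eventually_elim
        case (elim \<omega>)
        then have "\<bar>D \<epsilon> i \<omega>\<bar> / \<epsilon> \<le> B" using that by (simp add: pos_divide_le_eq)
        then have "\<bar>D \<epsilon> i \<omega> / \<epsilon>\<bar> \<le> B" using that by (simp add: abs_divide)
        moreover have "\<bar>b t \<omega> $ i\<bar> \<le> B" using t by (intro bBi) auto
        ultimately show ?case
          using abs_triangle_ineq4[of "D \<epsilon> i \<omega> / \<epsilon>" "b t \<omega> $ i"] unfolding abs_abs by linarith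
      qed
      show "AE \<omega> in M. ((\<lambda>\<epsilon>. \<bar>D \<epsilon> i \<omega> / \<epsilon> - b t \<omega> $ i\<bar>) \<longlongrightarrow> 0) (at_right 0)"
        using sol[of i] AE_space
      proof eventually_elim
        case (elim \<omega>)
        have "((\<lambda>\<epsilon>. D \<epsilon> i \<omega> / \<epsilon>) \<longlongrightarrow> b t \<omega> $ i) (at_right 0)"
        proof (rule Lim_transform_eventually[OF right_average_tendsto[OF bci[OF elim(2), of i] t]])
          show "\<forall>\<^sub>F \<epsilon> in at_right 0. ((LBINT s:{0..t + \<epsilon>}. b s \<omega> $ i) - (LBINT s:{0..t}. b s \<omega> $ i)) / \<epsilon> = D \<epsilon> i \<omega> / \<epsilon>"
            using small by eventually_elim (use elim(1) in auto)
        qed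
        then show ?case by (intro tendsto_rabs_zero LIM_zero)
      qed
    qed (use t finite_measure_axioms in auto)
    then show "((\<lambda>\<epsilon>. \<integral>\<omega>. \<bar>D \<epsilon> i \<omega> / \<epsilon> - b t \<omega> $ i\<bar> \<partial>M) \<longlongrightarrow> 0) (at_right 0)" by simp
  qed
  have "((\<lambda>\<epsilon>. \<integral>\<omega>. norm (V \<epsilon> \<omega> - b t \<omega>) \<partial>M) \<longlongrightarrow> 0) (at_right 0)"
  proof (rule Lim_null_comparison[OF _ lim])
    show "\<forall>\<^sub>F \<epsilon> in at_right 0. norm (\<integral>\<omega>. norm (V \<epsilon> \<omega> - b t \<omega>) \<partial>M)
        \<le> (\<Sum>i\<in>UNIV. \<integral>\<omega>. \<bar>D \<epsilon> i \<omega> / \<epsilon> - b t \<omega> $ i\<bar> \<partial>M)"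
      using small by eventually_elim (use le in auto)
  qed
  moreover have "\<forall>\<^sub>F \<epsilon> in at_right 0. integrable M (\<lambda>\<omega>. g (t + \<epsilon>) \<omega> - g t \<omega>)"
    using small by eventually_elim (use gi in auto)
  ultimately show ?thesis
    unfolding mean_derivative_at_def V_def using btF integrable_vecI[OF bi] by blast
qed

end

text \<open>
  At almost every time two versions agree almost surely; Fubini's theorem exchanges the two
  quantifiers, so that almost all paths of the versions agree for almost every time.
\<close>

lemma mean_derivative_version:
  fixes b :: "real \<Rightarrow> 'a \<Rightarrow> real ^ 'n"
  assumes filt: "filtered_prob_space M F" and T: "0 < T"
    and b: "is_mean_derivative M F T \<xi> b"
  shows "is_mean_derivative M F T \<xi> (mean_derivative M F T \<xi>)"
    and "AE \<omega> in M. AE t in lborel. t \<in> {0..T} \<longrightarrow> mean_derivative M F T \<xi> t \<omega> = b t \<omega>"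
proof -
  interpret M: prob_space M by (rule prob_space_M[OF filt])
  let ?N = "time_measure T"
  interpret N: finite_measure ?N by (rule finite_measure_restrict_lborel)
  interpret pair_sigma_finite M ?N ..
  let ?v = "mean_derivative M F T \<xi>"
  show v: "is_mean_derivative M F T \<xi> ?v" unfolding mean_derivative_def
    using someI_ex[where P = "is_mean_derivative M F T \<xi>"] b by blast
  have [measurable]: "(\<lambda>(\<omega>, t). b t \<omega>) \<in> borel_measurable (M \<Otimes>\<^sub>M ?N)"
      "(\<lambda>(\<omega>, t). ?v t \<omega>) \<in> borel_measurable (M \<Otimes>\<^sub>M ?N)"
    using v b by (auto simp: is_mean_derivative_def intro!: jointly_measurable_swap)
  have *: "AE t in lborel. 0 \<le> t \<and> t < T \<longrightarrow> (AE \<omega> in M. ?v t \<omega> = b t \<omega>)"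
  proof -
    have "AE t in lborel. 0 \<le> t \<and> t < T \<longrightarrow> mean_derivative_at M F \<xi> t (?v t)"
      "AE t in lborel. 0 \<le> t \<and> t < T \<longrightarrow> mean_derivative_at M F \<xi> t (b t)"
      using v b by (simp_all add: is_mean_derivative_def)
    then show ?thesis by eventually_elim (auto intro: mean_derivative_at_unique[OF filt])
  qed
  have "AE t in ?N. AE \<omega> in M. ?v t \<omega> = b t \<omega>"
  proof (subst AE_restrict_space_iff)
    show "AE t in lborel. t \<in> {0..T} \<longrightarrow> (AE \<omega> in M. ?v t \<omega> = b t \<omega>)"
      using * AE_lborel_singleton[of T] by eventually_elim auto
  qed simp
  then have "AE \<omega> in M. AE t in ?N. ?v t \<omega> = b t \<omega>"
    by (subst AE_commute) (auto simp: case_prod_beta')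
  then show "AE \<omega> in M. AE t in lborel. t \<in> {0..T} \<longrightarrow> ?v t \<omega> = b t \<omega>"
    by (simp add: AE_restrict_space_iff)
qed

section \<open>The martingale part of a drift\<close>

text \<open>
  One component of \<open>b\<^sub>t - \<integral>\<^sub>0\<^sup>t a dr\<close>. If \<open>a\<close> is the mean derivative of \<open>b\<close>, this is a martingale;
  the martingale property is stated below as orthogonality of its increments to the past.
\<close>

definition compensated :: "(real \<Rightarrow> 'a \<Rightarrow> real ^ 'n) \<Rightarrow> (real \<Rightarrow> 'a \<Rightarrow> real ^ 'n) \<Rightarrow> 'n \<Rightarrow> real \<Rightarrow> 'a \<Rightarrow> real" where
  "compensated b a i t \<omega> = b t \<omega> $ i - (LBINT r:{0..t}. a r \<omega> $ i)"

context
  fixes M :: "'a measure" and F :: "real \<Rightarrow> 'a measure" and T :: real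
    and b a :: "real \<Rightarrow> 'a \<Rightarrow> real ^ 'n" and B :: real
  assumes filt: "filtered_prob_space M F" and T: "0 < T"
    and b: "adapted F T b" "\<And>\<omega>. \<omega> \<in> space M \<Longrightarrow> continuous_on {0..T} (\<lambda>s. b s \<omega>)"
      "\<And>s \<omega>. s \<in> {0..T} \<Longrightarrow> norm (b s \<omega>) \<le> B"
    and a: "adapted F T a" "\<And>\<omega>. \<omega> \<in> space M \<Longrightarrow> continuous_on {0..T} (\<lambda>s. a s \<omega>)"
      "\<And>s \<omega>. s \<in> {0..T} \<Longrightarrow> norm (a s \<omega>) \<le> B"
    and md: "\<And>t. 0 \<le> t \<Longrightarrow> t < T \<Longrightarrow> mean_derivative_at M F b t (a t)"
begin

lemmas drift_measurable = adapted_measurable[OF filt a(1)] adapted_measurable[OF filt b(1)]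

lemma component_continuous:
  "\<omega> \<in> space M \<Longrightarrow> continuous_on {0..T} (\<lambda>s. a s \<omega> $ i)"
  "\<omega> \<in> space M \<Longrightarrow> continuous_on {0..T} (\<lambda>s. b s \<omega> $ i)"
  by (intro continuous_on_component a b; simp)+

lemma component_bound:
  "s \<in> {0..T} \<Longrightarrow> \<bar>a s \<omega> $ i\<bar> \<le> B" "s \<in> {0..T} \<Longrightarrow> \<bar>b s \<omega> $ i\<bar> \<le> B"
  using a(3) b(3) component_le_norm_cart order_trans by blast+

lemma compensated_measurable:
  assumes "t \<in> {0..T}"
  shows "compensated b a i t \<in> borel_measurable M"
proof -
  have "jointly_measurable M T a"
    by (intro jointly_measurable_continuous_process drift_measurable a) (use T in auto)
  then have "(\<lambda>\<omega>. LBINT r:{0..t}. a r \<omega> $ i) \<in> borel_measurable M"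
    by (intro measurable_LBINT_process jointly_measurable_vec_nth) (use assms in auto)
  then show ?thesis
    unfolding compensated_def[abs_def]
    by (intro borel_measurable_diff vec_nth_measurable drift_measurable b assms)
qed

lemma compensated_continuous:
  assumes "\<omega> \<in> space M"
  shows "continuous_on {0..T} (\<lambda>t. compensated b a i t \<omega>)"
  unfolding compensated_def
  by (intro continuous_on_diff continuous_on_indefinite_LBINT borel_integrable_atLeastAtMost'
      component_continuous assms)

lemma compensated_bound:
  assumes "\<omega> \<in> space M" "t \<in> {0..T}"
  shows "\<bar>compensated b a i t \<omega>\<bar> \<le> B + B * T"
proof -
  have B: "B \<ge> 0" using component_bound(1)[of 0 \<omega>] T by force
  have "\<bar>(LBINT r:{0..t}. a r \<omega> $ i) - (LBINT r:{0..0}. a r \<omega> $ i)\<bar> \<le> B * (t - 0)"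
    by (rule LBINT_increment_bound[OF component_continuous(1)[OF assms(1)] component_bound(1)])
      (use assms in auto)
  moreover have "(LBINT r:{0..0}. a r \<omega> $ i) = 0"
    by (subst LBINT_eq_integral[OF component_continuous(1)[OF assms(1)]]) (use T in auto)
  moreover have "B * t \<le> B * T" using assms B by (intro mult_left_mono) auto
  ultimately show ?thesis
    using component_bound(2)[OF assms(2), of \<omega> i] by (simp add: compensated_def)
qed

text \<open>
  For bounded \<open>Z\<close> from the past of \<open>s\<close>, the function \<open>t \<mapsto> E (Z C\<^sub>t)\<close> on \<open>[s, T]\<close>, with \<open>C\<close> the
  compensated process, is continuous. Its right derivative is \<open>E (Z a\<^sub>t) - E (Z a\<^sub>t) = 0\<close>: the first
  term comes from the \<open>L\<^sup>1\<close> convergence in the definition of the mean derivative, which may be tested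
  against \<open>Z\<close> because \<open>Z\<close> is bounded and \<open>F\<^sub>t\<close>-measurable, the second from the averages of \<open>a\<close>.
\<close>

lemma compensated_orthogonal_bounded:
  assumes s: "s \<in> {0..T}" and Z: "Z \<in> borel_measurable (F s)" and K: "\<And>\<omega>. \<bar>Z \<omega>\<bar> \<le> K"
  shows "(\<integral>\<omega>. Z \<omega> * compensated b a i T \<omega> \<partial>M) = (\<integral>\<omega>. Z \<omega> * compensated b a i s \<omega> \<partial>M)"
proof (rule zero_right_derivative_imp_constant
    [where f = "\<lambda>t. \<integral>\<omega>. Z \<omega> * compensated b a i t \<omega> \<partial>M" and a = s and b = T])
  interpret prob_space M by (rule prob_space_M[OF filt])
  let ?C = "compensated b a i"
  have [measurable]: "Z \<in> borel_measurable M" by (rule measurable_F_M[OF filt Z])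
  have K0: "K \<ge> 0" using K[of undefined] by linarith
  have ZC: "\<bar>Z \<omega> * ?C t \<omega>\<bar> \<le> K * (B + B * T)" if "\<omega> \<in> space M" "t \<in> {0..T}" for \<omega> t
    unfolding abs_mult by (intro mult_mono K compensated_bound that K0) auto
  show "s \<le> T" using s by simp
  show "continuous_on {s..T} (\<lambda>t. \<integral>\<omega>. Z \<omega> * ?C t \<omega> \<partial>M)"
    unfolding continuous_on_sequentially comp_def
  proof (intro allI ballI impI, elim conjE)
    fix x t assume t: "t \<in> {s..T}" and x: "\<forall>n. x n \<in> {s..T}" "x \<longlonglongrightarrow> t"
    have tT: "t \<in> {0..T}" using s t by simp
    have xT: "x n \<in> {0..T}" for n using s x(1)[rule_format, of n] by simp
    show "(\<lambda>n. \<integral>\<omega>. Z \<omega> * ?C (x n) \<omega> \<partial>M) \<longlonglongrightarrow> (\<integral>\<omega>. Z \<omega> * ?C t \<omega> \<partial>M)"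
    proof (rule integral_dominated_convergence[where w = "\<lambda>_. K * (B + B * T)"])
      show "AE \<omega> in M. (\<lambda>n. Z \<omega> * ?C (x n) \<omega>) \<longlonglongrightarrow> Z \<omega> * ?C t \<omega>"
        using xT tT x(2)
        by (intro AE_I2 tendsto_mult_left continuous_on_tendsto_compose[OF compensated_continuous]) auto
    qed (use ZC xT tT compensated_measurable in auto)
  qed
  fix t assume t: "s \<le> t" "t < T"
  then have t0: "0 \<le> t" "t \<in> {0..T}" using s by auto
  interpret sigma_finite_subalgebra M "F t" by (rule sigma_finite_subalgebra_F[OF filt])
  have ZF: "Z \<in> borel_measurable (F t)" by (rule measurable_F_mono[OF filt t(1) Z])
  have small: "\<forall>\<^sub>F \<epsilon> in at_right 0. 0 < \<epsilon> \<and> \<epsilon> < T - t"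
    unfolding eventually_at_right_field using t by (intro exI[of _ "T - t"]) auto
  note MD = md[OF t0(1) t(2), unfolded mean_derivative_at_def]
  define q where "q \<epsilon> \<omega> = ((LBINT r:{0..t + \<epsilon>}. a r \<omega> $ i) - (LBINT r:{0..t}. a r \<omega> $ i)) / \<epsilon>" for \<epsilon> \<omega>
  define v where "v \<epsilon> \<omega> = ((b (t + \<epsilon>) \<omega> - b t \<omega>) /\<^sub>R \<epsilon>) $ i" for \<epsilon> \<omega>
  define V where "V \<epsilon> = vec_cond_exp M (F t) (\<lambda>\<omega>. (b (t + \<epsilon>) \<omega> - b t \<omega>) /\<^sub>R \<epsilon>)" for \<epsilon>
  have b_int: "integrable M (\<lambda>\<omega>. b r \<omega> $ i)" and a_int: "integrable M (\<lambda>\<omega>. a r \<omega> $ i)" if "r \<in> {0..T}" for r i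
    by (rule integrable_const_bound[where B = B];
        use component_bound that in \<open>auto intro!: vec_nth_measurable drift_measurable a b\<close>)+
  have Zint: "integrable M (\<lambda>\<omega>. Z \<omega> * f \<omega>)" if "integrable M f" for f :: "'a \<Rightarrow> real"
  proof (rule Bochner_Integration.integrable_bound)
    show "integrable M (\<lambda>\<omega>. K * f \<omega>)" using that by simp
    show "AE \<omega> in M. norm (Z \<omega> * f \<omega>) \<le> norm (K * f \<omega>)"
      using K K0 by (auto simp: abs_mult intro!: mult_right_mono)
  qed (use that in auto)
  have q_meas: "q \<epsilon> \<in> borel_measurable M" if "0 < \<epsilon>" "\<epsilon> < T - t" for \<epsilon>
  proof -
    have "q \<epsilon> = (\<lambda>\<omega>. ((b (t + \<epsilon>) \<omega> $ i - ?C (t + \<epsilon>) \<omega>) - (b t \<omega> $ i - ?C t \<omega>)) / \<epsilon>)"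
      by (simp add: q_def compensated_def fun_eq_iff)
    moreover have "t + \<epsilon> \<in> {0..T}" using that t0 by simp
    ultimately show ?thesis
      using compensated_measurable[of "t + \<epsilon>" i] compensated_measurable[OF t0(2), of i]
        b_int[of "t + \<epsilon>" i] b_int[OF t0(2), of i] by (auto dest!: borel_measurable_integrable)
  qed
  have q_bd: "\<bar>q \<epsilon> \<omega>\<bar> \<le> B" if "0 < \<epsilon>" "\<epsilon> < T - t" "\<omega> \<in> space M" for \<epsilon> \<omega>
  proof -
    have "\<bar>(LBINT r:{0..t + \<epsilon>}. a r \<omega> $ i) - (LBINT r:{0..t}. a r \<omega> $ i)\<bar> \<le> B * ((t + \<epsilon>) - t)"
      by (rule LBINT_increment_bound[OF component_continuous(1)[OF that(3)] component_bound(1)])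
        (use that t0 in auto)
    then show ?thesis using that by (simp add: q_def abs_divide pos_divide_le_eq)
  qed
  have q_int: "integrable M (q \<epsilon>)" if "0 < \<epsilon>" "\<epsilon> < T - t" for \<epsilon>
    by (rule integrable_const_bound[where B = B]) (use q_bd[OF that] q_meas[OF that] in auto)
  have v_int: "integrable M (v \<epsilon>)" if "0 < \<epsilon>" "\<epsilon> < T - t" for \<epsilon>
    unfolding v_def[abs_def] using b_int[of "t + \<epsilon>" i] b_int[OF t0(2), of i] that t0
    by (auto intro!: integrable_divide)
  have lim_q: "((\<lambda>\<epsilon>. \<integral>\<omega>. Z \<omega> * q \<epsilon> \<omega> \<partial>M) \<longlongrightarrow> (\<integral>\<omega>. Z \<omega> * a t \<omega> $ i \<partial>M)) (at_right 0)"
  proof (rule bounded_convergence_at_right[where e = "T - t" and K = "K * B"])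
    show "AE \<omega> in M. ((\<lambda>\<epsilon>. Z \<omega> * q \<epsilon> \<omega>) \<longlongrightarrow> Z \<omega> * a t \<omega> $ i) (at_right 0)"
      unfolding q_def
      by (intro AE_I2 tendsto_mult_left right_average_tendsto[where T = T] component_continuous t0 t)
    show "AE \<omega> in M. \<bar>Z \<omega> * q \<epsilon> \<omega>\<bar> \<le> K * B" if "0 < \<epsilon>" "\<epsilon> < T - t" for \<epsilon>
      unfolding abs_mult by (intro AE_I2 mult_mono K q_bd that K0) auto
  qed (use t q_meas a_int[OF t0(2), of i] finite_measure_axioms in auto)
  have lim_v: "((\<lambda>\<epsilon>. \<integral>\<omega>. Z \<omega> * v \<epsilon> \<omega> \<partial>M) \<longlongrightarrow> (\<integral>\<omega>. Z \<omega> * a t \<omega> $ i \<partial>M)) (at_right 0)"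
  proof (rule LIM_zero_cancel, rule Lim_null_comparison)
    show "((\<lambda>\<epsilon>. K * (\<integral>\<omega>. norm (V \<epsilon> \<omega> - a t \<omega>) \<partial>M)) \<longlongrightarrow> 0) (at_right 0)"
      using MD unfolding V_def by (intro tendsto_mult_right_zero) auto
    show "\<forall>\<^sub>F \<epsilon> in at_right 0. norm ((\<integral>\<omega>. Z \<omega> * v \<epsilon> \<omega> \<partial>M) - (\<integral>\<omega>. Z \<omega> * a t \<omega> $ i \<partial>M))
        \<le> K * (\<integral>\<omega>. norm (V \<epsilon> \<omega> - a t \<omega>) \<partial>M)"
      using small
    proof eventually_elim
      case (elim \<epsilon>)
      then have te: "t + \<epsilon> \<in> {0..T}" using t0 by auto
      have iV: "integrable M (V \<epsilon>)" unfolding V_def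
        by (intro integrable_vec_cond_exp[OF filt] integrable_scaleR_right Bochner_Integration.integrable_diff
            integrable_vecI b_int te t0)
      have ia: "integrable M (a t)" by (intro integrable_vecI a_int t0)
      have Vv: "V \<epsilon> \<omega> $ i = real_cond_exp M (F t) (v \<epsilon>) \<omega>" for \<omega>
        by (simp add: V_def vec_cond_exp_def v_def[abs_def])
      have "(\<integral>\<omega>. Z \<omega> * v \<epsilon> \<omega> \<partial>M) = (\<integral>\<omega>. Z \<omega> * V \<epsilon> \<omega> $ i \<partial>M)"
        unfolding Vv using elim
        by (intro real_cond_exp_intg(2)[symmetric] Zint v_int ZF) (auto intro: borel_measurable_integrable v_int)
      then have "(\<integral>\<omega>. Z \<omega> * v \<epsilon> \<omega> \<partial>M) - (\<integral>\<omega>. Z \<omega> * a t \<omega> $ i \<partial>M)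
          = (\<integral>\<omega>. Z \<omega> * (V \<epsilon> \<omega> - a t \<omega>) $ i \<partial>M)"
        using Zint[OF integrable_vec_nth[OF iV, of i]] Zint[OF integrable_vec_nth[OF ia, of i]]
        by (simp add: right_diff_distrib)
      moreover have "norm (\<integral>\<omega>. Z \<omega> * (V \<epsilon> \<omega> - a t \<omega>) $ i \<partial>M) \<le> (\<integral>\<omega>. K * norm (V \<epsilon> \<omega> - a t \<omega>) \<partial>M)"
      proof (rule order_trans[OF integral_norm_bound], rule integral_mono)
        show "integrable M (\<lambda>\<omega>. norm (Z \<omega> * (V \<epsilon> \<omega> - a t \<omega>) $ i))"
          by (intro integrable_norm Zint integrable_vec_nth Bochner_Integration.integrable_diff iV ia)
        show "integrable M (\<lambda>\<omega>. K * norm (V \<epsilon> \<omega> - a t \<omega>))" using iV ia by simp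
        show "norm (Z \<omega> * (V \<epsilon> \<omega> - a t \<omega>) $ i) \<le> K * norm (V \<epsilon> \<omega> - a t \<omega>)" for \<omega>
          unfolding norm_mult by (intro mult_mono) (use K K0 component_le_norm_cart in \<open>auto simp del: vector_minus_component\<close>)
      qed
      ultimately show ?case by simp
    qed
  qed
  have "((\<lambda>\<epsilon>. (\<integral>\<omega>. Z \<omega> * v \<epsilon> \<omega> \<partial>M) - (\<integral>\<omega>. Z \<omega> * q \<epsilon> \<omega> \<partial>M)) \<longlongrightarrow> 0) (at_right 0)"
    using tendsto_diff[OF lim_v lim_q] by simp
  then show "((\<lambda>\<epsilon>. ((\<integral>\<omega>. Z \<omega> * ?C (t + \<epsilon>) \<omega> \<partial>M) - (\<integral>\<omega>. Z \<omega> * ?C t \<omega> \<partial>M)) / \<epsilon>) \<longlongrightarrow> 0) (at_right 0)"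
  proof (rule Lim_transform_eventually)
    show "\<forall>\<^sub>F \<epsilon> in at_right 0. (\<integral>\<omega>. Z \<omega> * v \<epsilon> \<omega> \<partial>M) - (\<integral>\<omega>. Z \<omega> * q \<epsilon> \<omega> \<partial>M) =
        ((\<integral>\<omega>. Z \<omega> * ?C (t + \<epsilon>) \<omega> \<partial>M) - (\<integral>\<omega>. Z \<omega> * ?C t \<omega> \<partial>M)) / \<epsilon>"
      using small
    proof eventually_elim
      case (elim \<epsilon>)
      then have te: "t + \<epsilon> \<in> {0..T}" using t0 by auto
      have C: "integrable M (?C r)" if "r \<in> {0..T}" for r
        by (rule integrable_const_bound[where B = "B + B * T"])
          (use compensated_bound compensated_measurable that in auto)
      have "(\<integral>\<omega>. Z \<omega> * v \<epsilon> \<omega> \<partial>M) - (\<integral>\<omega>. Z \<omega> * q \<epsilon> \<omega> \<partial>M) = (\<integral>\<omega>. Z \<omega> * v \<epsilon> \<omega> - Z \<omega> * q \<epsilon> \<omega> \<partial>M)"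
        using elim by (intro Bochner_Integration.integral_diff[symmetric] Zint v_int q_int) auto
      also have "\<dots> = (\<integral>\<omega>. (Z \<omega> * ?C (t + \<epsilon>) \<omega> - Z \<omega> * ?C t \<omega>) / \<epsilon> \<partial>M)"
        by (rule Bochner_Integration.integral_cong)
          (use elim in \<open>auto simp: v_def q_def compensated_def field_simps\<close>)
      also have "\<dots> = ((\<integral>\<omega>. Z \<omega> * ?C (t + \<epsilon>) \<omega> \<partial>M) - (\<integral>\<omega>. Z \<omega> * ?C t \<omega> \<partial>M)) / \<epsilon>"
        using Zint[OF C[OF te]] Zint[OF C[OF t0(2)]] by simp
      finally show ?case .
    qed
  qed
qed

text \<open>
  Truncation extends the orthogonality to integrable \<open>Z\<close>, since the compensated process is bounded.
  This is the form in which it is applied, with \<open>Z\<close> a component of the difference of two drifts.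
\<close>

lemma compensated_orthogonal:
  assumes s: "s \<in> {0..T}" and Z: "Z \<in> borel_measurable (F s)" and int: "integrable M Z"
  shows "(\<integral>\<omega>. Z \<omega> * compensated b a i T \<omega> \<partial>M) = (\<integral>\<omega>. Z \<omega> * compensated b a i s \<omega> \<partial>M)"
proof -
  interpret prob_space M by (rule prob_space_M[OF filt])
  define Zn where "Zn n \<omega> = max (- real n) (min (real n) (Z \<omega>))" for n \<omega>
  have Zn_meas [measurable]: "Zn n \<in> borel_measurable (F s)" for n
    unfolding Zn_def[abs_def] using Z by measurable
  have Zn_le: "\<bar>Zn n \<omega>\<bar> \<le> \<bar>Z \<omega>\<bar>" for n \<omega> by (auto simp: Zn_def)
  have Zn_lim: "(\<lambda>n. Zn n \<omega>) \<longlonglongrightarrow> Z \<omega>" for \<omega>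
  proof (rule tendsto_eventually)
    obtain N where "\<bar>Z \<omega>\<bar> \<le> real N" using real_arch_simple by blast
    then show "\<forall>\<^sub>F n in sequentially. Zn n \<omega> = Z \<omega>"
      unfolding eventually_sequentially by (intro exI[of _ N]) (auto simp: Zn_def)
  qed
  have lim: "(\<lambda>n. \<integral>\<omega>. Zn n \<omega> * compensated b a i r \<omega> \<partial>M) \<longlonglongrightarrow> (\<integral>\<omega>. Z \<omega> * compensated b a i r \<omega> \<partial>M)"
    if r: "r \<in> {0..T}" for r
  proof (rule integral_dominated_convergence[where w = "\<lambda>\<omega>. \<bar>Z \<omega>\<bar> * (B + B * T)"])
    note compensated_measurable[OF r, measurable] measurable_F_M[OF filt Zn_meas, measurable]
      measurable_F_M[OF filt Z, measurable]
    show "(\<lambda>\<omega>. Z \<omega> * compensated b a i r \<omega>) \<in> borel_measurable M"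
      "(\<lambda>\<omega>. Zn n \<omega> * compensated b a i r \<omega>) \<in> borel_measurable M" for n by measurable
    show "integrable M (\<lambda>\<omega>. \<bar>Z \<omega>\<bar> * (B + B * T))" using int by simp
    show "AE \<omega> in M. (\<lambda>n. Zn n \<omega> * compensated b a i r \<omega>) \<longlonglongrightarrow> Z \<omega> * compensated b a i r \<omega>"
      by (intro AE_I2 tendsto_mult_right Zn_lim)
    show "AE \<omega> in M. norm (Zn n \<omega> * compensated b a i r \<omega>) \<le> \<bar>Z \<omega>\<bar> * (B + B * T)" for n
      unfolding real_norm_def abs_mult
      by (intro AE_I2 mult_mono Zn_le compensated_bound r) auto
  qed
  have eq: "(\<integral>\<omega>. Zn n \<omega> * compensated b a i T \<omega> \<partial>M) = (\<integral>\<omega>. Zn n \<omega> * compensated b a i s \<omega> \<partial>M)" for n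
    by (rule compensated_orthogonal_bounded[OF s Zn_meas, where K = "real n"]) (auto simp: Zn_def)
  have TT: "T \<in> {0..T}" using T by simp
  show ?thesis using LIMSEQ_unique[OF lim[OF TT, unfolded eq] lim[OF s]] .
qed

section \<open>Variation of the energy\<close>

lemma pair_sigma_finite_path: "pair_sigma_finite M (time_measure T)" "finite_measure (M \<Otimes>\<^sub>M time_measure T)"
proof -
  interpret M: prob_space M by (rule prob_space_M[OF filt])
  interpret N: finite_measure "time_measure T" by (rule finite_measure_restrict_lborel)
  show "pair_sigma_finite M (time_measure T)" ..
  show "finite_measure (M \<Otimes>\<^sub>M time_measure T)" by (rule finite_measure_pair_measure) unfold_locales
qed

text \<open>
  Let \<open>C\<close> be the compensated process and \<open>A\<^sub>t = \<integral>\<^sub>0\<^sup>t a dr\<close>, so that \<open>b = C + A\<close>. Orthogonality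
  replaces \<open>E \<integral> c\<^sub>s C\<^sub>s ds\<close> by \<open>E (C\<^sub>T \<integral> c\<^sub>s ds) = E (C\<^sub>T h\<^sub>T) = 0\<close>, and integration by parts
  along each path gives \<open>\<integral> c A ds = - \<integral> h a ds\<close>, again because \<open>h\<^sub>T = 0\<close>. The bound on \<open>h\<close> is
  Wirtinger's inequality, integrated over the paths.
\<close>

lemma component_variation:
  fixes c h :: "real \<Rightarrow> 'a \<Rightarrow> real"
  assumes c_ad: "\<And>s. s \<in> {0..T} \<Longrightarrow> c s \<in> borel_measurable (F s)"
    and c_jm: "jointly_measurable M T c"
    and c2: "integrable (M \<Otimes>\<^sub>M time_measure T) (\<lambda>(\<omega>, t). (c t \<omega>)\<^sup>2)"
    and h_jm: "jointly_measurable M T h"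
    and h_eq: "AE \<omega> in M. \<forall>t\<in>{0..T}. h t \<omega> = (LBINT s:{0..t}. c s \<omega>)"
    and hT: "AE \<omega> in M. h T \<omega> = 0"
  shows "integrable (M \<Otimes>\<^sub>M time_measure T) (\<lambda>(\<omega>, t). (h t \<omega>)\<^sup>2)"
    and "pi\<^sup>2 * (\<integral>(\<omega>, t). (h t \<omega>)\<^sup>2 \<partial>(M \<Otimes>\<^sub>M time_measure T)) \<le> T\<^sup>2 * (\<integral>(\<omega>, t). (c t \<omega>)\<^sup>2 \<partial>(M \<Otimes>\<^sub>M time_measure T))"
    and "(\<integral>(\<omega>, t). c t \<omega> * b t \<omega> $ i \<partial>(M \<Otimes>\<^sub>M time_measure T)) = - (\<integral>(\<omega>, t). h t \<omega> * a t \<omega> $ i \<partial>(M \<Otimes>\<^sub>M time_measure T))"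
proof -
  interpret M: prob_space M by (rule prob_space_M[OF filt])
  interpret N: finite_measure "time_measure T" by (rule finite_measure_restrict_lborel)
  interpret pair_sigma_finite M "time_measure T" by (rule pair_sigma_finite_path)
  interpret Q: finite_measure "M \<Otimes>\<^sub>M time_measure T" by (rule pair_sigma_finite_path)
  note cm = jointly_measurable_swap[OF c_jm] and hm = jointly_measurable_swap[OF h_jm]
  have h2m: "(\<lambda>(\<omega>, t). (h t \<omega>)\<^sup>2) \<in> borel_measurable (M \<Otimes>\<^sub>M time_measure T)"
    using borel_measurable_power[OF hm, of 2] by (simp add: case_prod_beta')
  have c1: "integrable (M \<Otimes>\<^sub>M time_measure T) (\<lambda>(\<omega>, t). c t \<omega>)"
    using Q.integrable_of_square_integrable[OF cm] c2 by (simp add: case_prod_beta')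
  have path: "AE \<omega> in M. set_integrable lborel {0..T} (\<lambda>t. c t \<omega>) \<and> set_integrable lborel {0..T} (\<lambda>t. (c t \<omega>)\<^sup>2)
      \<and> (\<forall>t\<in>{0..T}. h t \<omega> = (LBINT s:{0..t}. c s \<omega>)) \<and> h T \<omega> = 0"
    using AE_integrable_fst'[OF c1] AE_integrable_fst'[OF c2] h_eq hT
    by eventually_elim (simp add: integral_restrict_lborel)
  have pathh: "AE \<omega> in M. set_integrable lborel {0..T} (\<lambda>t. (h t \<omega>)\<^sup>2) \<and>
     pi\<^sup>2 * (LBINT t:{0..T}. (h t \<omega>)\<^sup>2) \<le> T\<^sup>2 * (LBINT t:{0..T}. (c t \<omega>)\<^sup>2)"
    using path
  proof eventually_elim
    case (elim \<omega>)
    have hc: "continuous_on {0..T} (\<lambda>t. h t \<omega>)"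
      using elim continuous_on_indefinite_LBINT[of T "\<lambda>t. c t \<omega>"]
      by (simp cong: continuous_on_cong_simp)
    have "(LBINT t:{0..T}. (h t \<omega>)\<^sup>2) = (LBINT t:{0..T}. (LBINT s:{0..t}. c s \<omega>)\<^sup>2)"
      using elim by (intro set_lebesgue_integral_cong) auto
    moreover have "(LBINT s:{0..T}. c s \<omega>) = 0" using elim T by force
    ultimately show ?case
      using wirtinger_inequality[OF T, of "\<lambda>t. c t \<omega>"] elim
      by (auto intro!: borel_integrable_atLeastAtMost' continuous_intros hc)
  qed
  have c2i: "integrable M (\<lambda>\<omega>. LBINT t:{0..T}. (c t \<omega>)\<^sup>2)"
    using integrable_fst'[OF c2] by (simp add: integral_restrict_lborel)
  have h2i: "integrable M (\<lambda>\<omega>. LBINT t:{0..T}. (h t \<omega>)\<^sup>2)"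
  proof (rule Bochner_Integration.integrable_bound)
    show "integrable M (\<lambda>\<omega>. T\<^sup>2 / pi\<^sup>2 * (LBINT t:{0..T}. (c t \<omega>)\<^sup>2))" using c2i by simp
    show "(\<lambda>\<omega>. LBINT t:{0..T}. (h t \<omega>)\<^sup>2) \<in> borel_measurable M"
      using N.borel_measurable_lebesgue_integral[OF h2m] by (simp add: integral_restrict_lborel)
    show "AE \<omega> in M. norm (LBINT t:{0..T}. (h t \<omega>)\<^sup>2) \<le> norm (T\<^sup>2 / pi\<^sup>2 * (LBINT t:{0..T}. (c t \<omega>)\<^sup>2))"
      using pathh
    proof eventually_elim
      case (elim \<omega>)
      then have "(LBINT t:{0..T}. (h t \<omega>)\<^sup>2) \<le> T\<^sup>2 / pi\<^sup>2 * (LBINT t:{0..T}. (c t \<omega>)\<^sup>2)"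
        by (simp add: field_simps)
      moreover have "0 \<le> (LBINT t:{0..T}. (h t \<omega>)\<^sup>2)" unfolding set_lebesgue_integral_def
        by (intro Bochner_Integration.integral_nonneg) auto
      ultimately show ?case unfolding real_norm_def by linarith
    qed
  qed
  show h2: "integrable (M \<Otimes>\<^sub>M time_measure T) (\<lambda>(\<omega>, t). (h t \<omega>)\<^sup>2)"
  proof (rule Fubini_integrable[OF h2m])
    show "integrable M (\<lambda>\<omega>. \<integral>t. norm (case (\<omega>, t) of (\<omega>, t) \<Rightarrow> (h t \<omega>)\<^sup>2) \<partial>time_measure T)"
      using h2i by (simp add: integral_restrict_lborel)
    show "AE \<omega> in M. integrable (time_measure T) (\<lambda>t. case (\<omega>, t) of (\<omega>, t) \<Rightarrow> (h t \<omega>)\<^sup>2)"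
      using pathh by (auto simp: integral_restrict_lborel)
  qed
  have "pi\<^sup>2 * (\<integral>\<omega>. (LBINT t:{0..T}. (h t \<omega>)\<^sup>2) \<partial>M) \<le> T\<^sup>2 * (\<integral>\<omega>. (LBINT t:{0..T}. (c t \<omega>)\<^sup>2) \<partial>M)"
    using pathh by (subst (1 2) integral_mult_right_zero[symmetric]) (intro integral_mono_AE, auto simp: h2i c2i)
  then show "pi\<^sup>2 * (\<integral>(\<omega>, t). (h t \<omega>)\<^sup>2 \<partial>(M \<Otimes>\<^sub>M time_measure T)) \<le> T\<^sup>2 * (\<integral>(\<omega>, t). (c t \<omega>)\<^sup>2 \<partial>(M \<Otimes>\<^sub>M time_measure T))"
    using integral_fst'[OF h2] integral_fst'[OF c2] by (simp add: integral_restrict_lborel)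

  let ?C = "compensated b a i"
  let ?A = "\<lambda>t \<omega>. b t \<omega> $ i - ?C t \<omega>"
  have A: "?A t \<omega> = (LBINT r:{0..t}. a r \<omega> $ i)" for t \<omega> by (simp add: compensated_def)
  have Cj: "jointly_measurable M T ?C"
    by (intro jointly_measurable_continuous_process compensated_measurable compensated_continuous)
      (use T in auto)
  have bj: "jointly_measurable M T (\<lambda>t \<omega>. b t \<omega> $ i)" and aj: "jointly_measurable M T (\<lambda>t \<omega>. a t \<omega> $ i)"
    by (intro jointly_measurable_vec_nth jointly_measurable_continuous_process drift_measurable a b; use T in simp)+
  note Cm = jointly_measurable_swap[OF Cj] and bm = jointly_measurable_swap[OF bj] and am = jointly_measurable_swap[OF aj]
  have sp: "space (M \<Otimes>\<^sub>M time_measure T) = space M \<times> {0..T}" by (simp add: space_pair_measure space_restrict_space)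
  have CTm: "(\<lambda>(\<omega>, t). ?C T \<omega>) \<in> borel_measurable (M \<Otimes>\<^sub>M time_measure T)"
    using measurable_compose[OF measurable_fst compensated_measurable[of T i]] T
    by (simp add: case_prod_beta')
  have cC: "integrable (M \<Otimes>\<^sub>M time_measure T) (\<lambda>(\<omega>, t). c t \<omega> * ?C t \<omega>)"
    using integrable_mult_bounded[OF c1 Cm, of "B + B * T"] compensated_bound[of _ _ i]
    by (auto simp: case_prod_beta' sp)
  have cCT: "integrable (M \<Otimes>\<^sub>M time_measure T) (\<lambda>(\<omega>, t). c t \<omega> * ?C T \<omega>)"
    using integrable_mult_bounded[OF c1 CTm, of "B + B * T"] compensated_bound[of _ T i] T
    by (auto simp: case_prod_beta' sp)
  have cb: "integrable (M \<Otimes>\<^sub>M time_measure T) (\<lambda>(\<omega>, t). c t \<omega> * b t \<omega> $ i)"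
    using integrable_mult_bounded[OF c1 bm, of B] component_bound(2)[of _ _ i]
    by (auto simp: case_prod_beta' sp)
  have h1: "integrable (M \<Otimes>\<^sub>M time_measure T) (\<lambda>(\<omega>, t). h t \<omega>)"
    using Q.integrable_of_square_integrable[OF hm] h2 by (simp add: case_prod_beta')
  have ha: "integrable (M \<Otimes>\<^sub>M time_measure T) (\<lambda>(\<omega>, t). h t \<omega> * a t \<omega> $ i)"
    using integrable_mult_bounded[OF h1 am, of B] component_bound(1)[of _ _ i]
    by (auto simp: case_prod_beta' sp)
  have cA: "integrable (M \<Otimes>\<^sub>M time_measure T) (\<lambda>(\<omega>, t). c t \<omega> * ?A t \<omega>)"
    using Bochner_Integration.integrable_diff[OF cb cC] by (simp add: case_prod_beta' right_diff_distrib)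

  have "(\<integral>(\<omega>, t). c t \<omega> * ?C T \<omega> \<partial>(M \<Otimes>\<^sub>M time_measure T)) = (\<integral>(\<omega>, t). c t \<omega> * ?C t \<omega> \<partial>(M \<Otimes>\<^sub>M time_measure T))"
  proof -
    have "(\<integral>t. (\<integral>\<omega>. c t \<omega> * ?C T \<omega> \<partial>M) \<partial>time_measure T) = (\<integral>t. (\<integral>\<omega>. c t \<omega> * ?C t \<omega> \<partial>M) \<partial>time_measure T)"
    proof (rule integral_cong_AE)
      have "AE t in time_measure T. integrable M (c t)"
        using AE_integrable_snd[of "\<lambda>\<omega> t. c t \<omega>"] c1 by simp
      with AE_space show "AE t in time_measure T. (\<integral>\<omega>. c t \<omega> * ?C T \<omega> \<partial>M) = (\<integral>\<omega>. c t \<omega> * ?C t \<omega> \<partial>M)"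
      proof eventually_elim
        case (elim t)
        then have t: "t \<in> {0..T}" by (simp add: space_restrict_space)
        show ?case by (rule compensated_orthogonal[OF t c_ad[OF t] elim(2)])
      qed
      show "(\<lambda>t. \<integral>\<omega>. c t \<omega> * ?C T \<omega> \<partial>M) \<in> borel_measurable (time_measure T)"
        "(\<lambda>t. \<integral>\<omega>. c t \<omega> * ?C t \<omega> \<partial>M) \<in> borel_measurable (time_measure T)"
        using integrable_snd[of "\<lambda>\<omega> t. c t \<omega> * ?C T \<omega>"] integrable_snd[of "\<lambda>\<omega> t. c t \<omega> * ?C t \<omega>"] cC cCT by auto
    qed
    then show ?thesis
      using integral_snd[of "\<lambda>\<omega> t. c t \<omega> * ?C T \<omega>"] integral_snd[of "\<lambda>\<omega> t. c t \<omega> * ?C t \<omega>"] cC cCT by simp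
  qed
  moreover have "(\<integral>(\<omega>, t). c t \<omega> * ?C T \<omega> \<partial>(M \<Otimes>\<^sub>M time_measure T)) = 0"
  proof -
    have "(\<integral>(\<omega>, t). c t \<omega> * ?C T \<omega> \<partial>(M \<Otimes>\<^sub>M time_measure T)) = (\<integral>\<omega>. (\<integral>t. c t \<omega> * ?C T \<omega> \<partial>time_measure T) \<partial>M)"
      using integral_fst'[OF cCT] by simp
    also have "\<dots> = (\<integral>\<omega>. 0 \<partial>M)"
    proof (rule integral_cong_AE)
      show "AE \<omega> in M. (\<integral>t. c t \<omega> * ?C T \<omega> \<partial>time_measure T) = 0"
        using path
      proof eventually_elim
        case (elim \<omega>)
        then have "(LBINT s:{0..T}. c s \<omega>) = 0" using T by force
        then show ?case by (simp add: integral_restrict_lborel)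
      qed
      show "(\<lambda>\<omega>. \<integral>t. c t \<omega> * ?C T \<omega> \<partial>time_measure T) \<in> borel_measurable M" using integrable_fst'[OF cCT] by auto
    qed simp
    finally show ?thesis by simp
  qed
  ultimately have "(\<integral>(\<omega>, t). c t \<omega> * b t \<omega> $ i \<partial>(M \<Otimes>\<^sub>M time_measure T)) = (\<integral>(\<omega>, t). c t \<omega> * ?A t \<omega> \<partial>(M \<Otimes>\<^sub>M time_measure T))"
    using Bochner_Integration.integral_diff[OF cb cC] by (simp add: case_prod_beta' right_diff_distrib)
  also have "\<dots> = (\<integral>\<omega>. (\<integral>t. c t \<omega> * ?A t \<omega> \<partial>time_measure T) \<partial>M)" using integral_fst'[OF cA] by simp
  also have "\<dots> = (\<integral>\<omega>. - (\<integral>t. h t \<omega> * a t \<omega> $ i \<partial>time_measure T) \<partial>M)"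
  proof (rule integral_cong_AE)
    show "AE \<omega> in M. (\<integral>t. c t \<omega> * ?A t \<omega> \<partial>time_measure T) = - (\<integral>t. h t \<omega> * a t \<omega> $ i \<partial>time_measure T)"
      using path AE_space
    proof eventually_elim
      case (elim \<omega>)
      have ai: "set_integrable lborel {0..T} (\<lambda>t. a t \<omega> $ i)"
        by (intro borel_integrable_atLeastAtMost' component_continuous elim)
      have "(LBINT t:{0..T}. h t \<omega> * a t \<omega> $ i) = (LBINT t:{0..T}. a t \<omega> $ i * (LBINT s:{0..t}. c s \<omega>))"
        using elim by (intro set_lebesgue_integral_cong) (auto simp: mult.commute)
      moreover have "(LBINT s:{0..T}. c s \<omega>) = 0" using elim T by force
      ultimately show ?case
        using integration_by_parts_interval(3)[of T "\<lambda>t. c t \<omega>" "\<lambda>t. a t \<omega> $ i"] ai elim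
        unfolding A by (simp add: integral_restrict_lborel)
    qed
    show "(\<lambda>\<omega>. \<integral>t. c t \<omega> * ?A t \<omega> \<partial>time_measure T) \<in> borel_measurable M" using integrable_fst'[OF cA] by auto
    show "(\<lambda>\<omega>. - (\<integral>t. h t \<omega> * a t \<omega> $ i \<partial>time_measure T)) \<in> borel_measurable M" using integrable_fst'[OF ha] by auto
  qed
  also have "\<dots> = - (\<integral>(\<omega>, t). h t \<omega> * a t \<omega> $ i \<partial>(M \<Otimes>\<^sub>M time_measure T))" using integral_fst'[OF ha] by simp
  finally show "(\<integral>(\<omega>, t). c t \<omega> * b t \<omega> $ i \<partial>(M \<Otimes>\<^sub>M time_measure T)) = - (\<integral>(\<omega>, t). h t \<omega> * a t \<omega> $ i \<partial>(M \<Otimes>\<^sub>M time_measure T))" .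
qed


text \<open>
  This is the variational argument without any reference to a fluid: only the conclusion drawn from
  incompressibility and the Hessian bound, the estimate of \<open>E (h\<^sub>t \<bullet> a\<^sub>t)\<close>, enters as a hypothesis.
  It is demanded for \<open>t > 0\<close> only, which suffices as it is integrated over time.
\<close>

lemma energy_minimal_of_potential_bound:
  fixes b' h :: "real \<Rightarrow> 'a \<Rightarrow> real ^ 'n" and R :: real
  assumes b'_ad: "adapted F T b'" and b'_jm: "jointly_measurable M T b'"
    and b'2: "integrable (M \<Otimes>\<^sub>M time_measure T) (\<lambda>(\<omega>, t). (norm (b' t \<omega>))\<^sup>2)"
    and h_jm: "jointly_measurable M T h"
    and h_eq: "AE \<omega> in M. set_integrable lborel {0..T} (\<lambda>s. b' s \<omega> - b s \<omega>) \<and>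
        (\<forall>t\<in>{0..T}. h t \<omega> = (LBINT s:{0..t}. b' s \<omega> - b s \<omega>))"
    and hT: "AE \<omega> in M. h T \<omega> = 0"
    and pot: "\<And>t. 0 < t \<Longrightarrow> t \<le> T \<Longrightarrow> integrable M (\<lambda>\<omega>. (norm (h t \<omega>))\<^sup>2) \<Longrightarrow>
        (\<integral>\<omega>. h t \<omega> \<bullet> a t \<omega> \<partial>M) \<le> R / 2 * (\<integral>\<omega>. (norm (h t \<omega>))\<^sup>2 \<partial>M)"
    and R: "R * T\<^sup>2 \<le> pi\<^sup>2"
  shows "integrable (M \<Otimes>\<^sub>M time_measure T) (\<lambda>(\<omega>, t). (norm (b t \<omega>))\<^sup>2)"
    and "(\<integral>(\<omega>, t). (norm (b t \<omega>))\<^sup>2 \<partial>(M \<Otimes>\<^sub>M time_measure T)) \<le> (\<integral>(\<omega>, t). (norm (b' t \<omega>))\<^sup>2 \<partial>(M \<Otimes>\<^sub>M time_measure T))"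
proof -
  interpret M: prob_space M by (rule prob_space_M[OF filt])
  interpret N: finite_measure "time_measure T" by (rule finite_measure_restrict_lborel)
  interpret pair_sigma_finite M "time_measure T" by (rule pair_sigma_finite_path)
  interpret Q: finite_measure "M \<Otimes>\<^sub>M time_measure T" by (rule pair_sigma_finite_path)
  let ?Q = "M \<Otimes>\<^sub>M time_measure T"
  define c where "c i t \<omega> = b' t \<omega> $ i - b t \<omega> $ i" for i t \<omega>
  have sp: "space ?Q = space M \<times> {0..T}" by (simp add: space_pair_measure space_restrict_space)
  have bj: "jointly_measurable M T b" and aj: "jointly_measurable M T a"
    by (intro jointly_measurable_continuous_process drift_measurable a b; use T in simp)+
  note jm = jointly_measurable_swap[OF jointly_measurable_vec_nth]
  have bm: "(\<lambda>(\<omega>, t). b t \<omega> $ i) \<in> borel_measurable ?Q" and b'm: "(\<lambda>(\<omega>, t). b' t \<omega> $ i) \<in> borel_measurable ?Q"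
    and am: "(\<lambda>(\<omega>, t). a t \<omega> $ i) \<in> borel_measurable ?Q" for i
    by (intro jm bj b'_jm aj)+
  have sum_sq: "(norm x)\<^sup>2 = (\<Sum>i\<in>UNIV. (x $ i)\<^sup>2)" for x :: "real ^ 'n"
    unfolding power2_norm_eq_inner inner_vec_def by (simp add: power2_eq_square)
  have bi2: "integrable ?Q (\<lambda>(\<omega>, t). (b t \<omega> $ i)\<^sup>2)" for i
  proof (rule Q.integrable_const_bound[where B = "B\<^sup>2"])
    show "AE z in ?Q. norm (case z of (\<omega>, t) \<Rightarrow> (b t \<omega> $ i)\<^sup>2) \<le> B\<^sup>2"
    proof (rule AE_I2)
      fix z assume "z \<in> space ?Q"
      then have "snd z \<in> {0..T}" by (auto simp: sp)
      from component_bound(2)[OF this, of "fst z" i]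
      have "\<bar>b (snd z) (fst z) $ i\<bar> \<le> \<bar>B\<bar>" by linarith
      then show "norm (case z of (\<omega>, t) \<Rightarrow> (b t \<omega> $ i)\<^sup>2) \<le> B\<^sup>2"
        by (simp add: case_prod_beta' abs_le_square_iff)
    qed
    show "(\<lambda>(\<omega>, t). (b t \<omega> $ i)\<^sup>2) \<in> borel_measurable ?Q"
      using borel_measurable_power[OF bm, of i 2] by (simp add: case_prod_beta')
  qed
  have b'i2: "integrable ?Q (\<lambda>(\<omega>, t). (b' t \<omega> $ i)\<^sup>2)" for i
  proof (rule Bochner_Integration.integrable_bound[OF b'2])
    show "AE z in ?Q. norm (case z of (\<omega>, t) \<Rightarrow> (b' t \<omega> $ i)\<^sup>2) \<le> norm (case z of (\<omega>, t) \<Rightarrow> (norm (b' t \<omega>))\<^sup>2)"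
      by (intro AE_I2) (auto simp: abs_le_square_iff[symmetric] component_le_norm_cart)
    show "(\<lambda>(\<omega>, t). (b' t \<omega> $ i)\<^sup>2) \<in> borel_measurable ?Q"
      using borel_measurable_power[OF b'm, of i 2] by (simp add: case_prod_beta')
  qed
  show b2: "integrable ?Q (\<lambda>(\<omega>, t). (norm (b t \<omega>))\<^sup>2)"
    using Bochner_Integration.integrable_sum[of UNIV ?Q "\<lambda>i (\<omega>, t). (b t \<omega> $ i)\<^sup>2"] bi2
    by (simp add: sum_sq case_prod_beta')
  have c_jm: "jointly_measurable M T (c i)" for i
    using borel_measurable_diff[OF jointly_measurable_vec_nth[OF b'_jm, of i, unfolded jointly_measurable_def]
        jointly_measurable_vec_nth[OF bj, of i, unfolded jointly_measurable_def]]
    by (simp add: jointly_measurable_def c_def case_prod_beta')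
  have ci2: "integrable ?Q (\<lambda>(\<omega>, t). (c i t \<omega>)\<^sup>2)" for i
  proof (rule Bochner_Integration.integrable_bound)
    show "integrable ?Q (\<lambda>z. 2 * (case z of (\<omega>, t) \<Rightarrow> (b' t \<omega> $ i)\<^sup>2) + 2 * (case z of (\<omega>, t) \<Rightarrow> (b t \<omega> $ i)\<^sup>2))"
      using b'i2[of i] bi2[of i] by simp
    have "(x - y)\<^sup>2 \<le> 2 * x\<^sup>2 + 2 * y\<^sup>2" for x y :: real
      using zero_le_power2[of "x + y"] by (simp add: power2_eq_square algebra_simps)
    then show "AE z in ?Q. norm (case z of (\<omega>, t) \<Rightarrow> (c i t \<omega>)\<^sup>2)
       \<le> norm (2 * (case z of (\<omega>, t) \<Rightarrow> (b' t \<omega> $ i)\<^sup>2) + 2 * (case z of (\<omega>, t) \<Rightarrow> (b t \<omega> $ i)\<^sup>2))"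
      by (intro AE_I2) (auto simp: c_def)
    show "(\<lambda>(\<omega>, t). (c i t \<omega>)\<^sup>2) \<in> borel_measurable ?Q"
      using borel_measurable_power[OF jointly_measurable_swap[OF c_jm], of i 2] by (simp add: case_prod_beta')
  qed
  have c_ad: "c i s \<in> borel_measurable (F s)" if "s \<in> {0..T}" for i s
    unfolding c_def[abs_def] using b'_ad b(1) that
    by (intro borel_measurable_diff vec_nth_measurable) (auto simp: adapted_def)
  have hi_eq: "AE \<omega> in M. \<forall>t\<in>{0..T}. h t \<omega> $ i = (LBINT s:{0..t}. c i s \<omega>)" for i
    using h_eq
  proof eventually_elim
    case (elim \<omega>)
    show ?case
    proof
      fix t assume t: "t \<in> {0..T}"
      have "set_integrable lborel {0..t} (\<lambda>s. b' s \<omega> - b s \<omega>)"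
        by (rule set_integrable_subset[OF conjunct1[OF elim]]) (use t in auto)
      from set_integral_vec_nth[OF this, of i] show "h t \<omega> $ i = (LBINT s:{0..t}. c i s \<omega>)"
        using elim t by (simp add: c_def)
    qed
  qed
  have hi_jm: "jointly_measurable M T (\<lambda>t \<omega>. h t \<omega> $ i)" for i by (rule jointly_measurable_vec_nth[OF h_jm])
  have hiT: "AE \<omega> in M. h T \<omega> $ i = 0" for i using hT by eventually_elim simp
  note variation = component_variation[OF c_ad c_jm ci2 hi_jm hi_eq hiT]
  have cross: "(\<integral>(\<omega>, t). c i t \<omega> * b t \<omega> $ i \<partial>?Q) = - (\<integral>(\<omega>, t). h t \<omega> $ i * a t \<omega> $ i \<partial>?Q)" for i
    by (rule variation(3))
  define X where "X = (\<Sum>i\<in>UNIV. \<integral>(\<omega>, t). (h t \<omega> $ i)\<^sup>2 \<partial>?Q)"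
  define Y where "Y = (\<Sum>i\<in>UNIV. \<integral>(\<omega>, t). (c i t \<omega>)\<^sup>2 \<partial>?Q)"
  \<comment> \<open>\<open>X\<close> and \<open>Y\<close> are \<open>E \<integral> |h|\<^sup>2\<close> and \<open>E \<integral> |b' - b|\<^sup>2\<close>. The bound on \<open>R\<close> is multiplied by \<open>X \<ge> 0\<close>, so
    no distinction according to the sign of \<open>R\<close> is necessary.\<close>
  have X0: "X \<ge> 0" unfolding X_def by (intro sum_nonneg Bochner_Integration.integral_nonneg) auto
  have "pi\<^sup>2 * X \<le> T\<^sup>2 * Y"
    unfolding X_def Y_def sum_distrib_left by (intro sum_mono variation(2))
  moreover have "(R * T\<^sup>2) * X \<le> pi\<^sup>2 * X" by (rule mult_right_mono[OF R X0])
  ultimately have "T\<^sup>2 * (R * X) \<le> T\<^sup>2 * Y" by (simp add: mult.assoc mult.left_commute)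
  then have RX: "R * X \<le> Y" using T by simp

  have h2: "integrable ?Q (\<lambda>(\<omega>, t). (norm (h t \<omega>))\<^sup>2)"
    and X: "X = (\<integral>(\<omega>, t). (norm (h t \<omega>))\<^sup>2 \<partial>?Q)"
    using Bochner_Integration.integrable_sum[of UNIV ?Q "\<lambda>i (\<omega>, t). (h t \<omega> $ i)\<^sup>2"]
      Bochner_Integration.integral_sum[of UNIV ?Q "\<lambda>i (\<omega>, t). (h t \<omega> $ i)\<^sup>2"] variation(1)
    by (simp_all add: X_def sum_sq case_prod_beta')
  have hi1: "integrable ?Q (\<lambda>(\<omega>, t). h t \<omega> $ i)" for i
    using Q.integrable_of_square_integrable[OF jointly_measurable_swap[OF hi_jm]] variation(1)
    by (simp add: case_prod_beta')
  have ci1: "integrable ?Q (\<lambda>(\<omega>, t). c i t \<omega>)" for i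
    using Q.integrable_of_square_integrable[OF jointly_measurable_swap[OF c_jm]] ci2
    by (simp add: case_prod_beta')
  have hai: "integrable ?Q (\<lambda>(\<omega>, t). h t \<omega> $ i * a t \<omega> $ i)" for i
    using integrable_mult_bounded[OF hi1[of i] am[of i], of B] component_bound(1)[of _ _ i]
    by (auto simp: case_prod_beta' sp)
  have cbi: "integrable ?Q (\<lambda>(\<omega>, t). c i t \<omega> * b t \<omega> $ i)" for i
    using integrable_mult_bounded[OF ci1[of i] bm[of i], of B] component_bound(2)[of _ _ i]
    by (auto simp: case_prod_beta' sp)
  have ha: "integrable ?Q (\<lambda>(\<omega>, t). h t \<omega> \<bullet> a t \<omega>)"
    and ha_sum: "(\<integral>(\<omega>, t). h t \<omega> \<bullet> a t \<omega> \<partial>?Q) = (\<Sum>i\<in>UNIV. \<integral>(\<omega>, t). h t \<omega> $ i * a t \<omega> $ i \<partial>?Q)"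
    using Bochner_Integration.integrable_sum[of UNIV ?Q "\<lambda>i (\<omega>, t). h t \<omega> $ i * a t \<omega> $ i"]
      Bochner_Integration.integral_sum[of UNIV ?Q "\<lambda>i (\<omega>, t). h t \<omega> $ i * a t \<omega> $ i"] hai
    by (simp_all add: inner_vec_def case_prod_beta')
  have "(\<integral>(\<omega>, t). h t \<omega> \<bullet> a t \<omega> \<partial>?Q) = (\<integral>t. (\<integral>\<omega>. h t \<omega> \<bullet> a t \<omega> \<partial>M) \<partial>time_measure T)"
    using integral_snd[of "\<lambda>\<omega> t. h t \<omega> \<bullet> a t \<omega>"] ha by simp
  also have "\<dots> \<le> (\<integral>t. R / 2 * (\<integral>\<omega>. (norm (h t \<omega>))\<^sup>2 \<partial>M) \<partial>time_measure T)"
  proof (rule integral_mono_AE)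
    show "integrable (time_measure T) (\<lambda>t. \<integral>\<omega>. h t \<omega> \<bullet> a t \<omega> \<partial>M)"
      using integrable_snd[of "\<lambda>\<omega> t. h t \<omega> \<bullet> a t \<omega>"] ha by simp
    show "integrable (time_measure T) (\<lambda>t. R / 2 * (\<integral>\<omega>. (norm (h t \<omega>))\<^sup>2 \<partial>M))"
      using integrable_snd[of "\<lambda>\<omega> t. (norm (h t \<omega>))\<^sup>2"] h2 by simp
    have "AE t in time_measure T. t \<noteq> 0"
      using AE_lborel_singleton[of "0 :: real"] by (auto simp: AE_restrict_space_iff)
    moreover have "AE t in time_measure T. integrable M (\<lambda>\<omega>. (norm (h t \<omega>))\<^sup>2)"
      using AE_integrable_snd[of "\<lambda>\<omega> t. (norm (h t \<omega>))\<^sup>2"] h2 by simp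
    ultimately show "AE t in time_measure T. (\<integral>\<omega>. h t \<omega> \<bullet> a t \<omega> \<partial>M) \<le> R / 2 * (\<integral>\<omega>. (norm (h t \<omega>))\<^sup>2 \<partial>M)"
      using AE_space
    proof eventually_elim
      case (elim t)
      then show ?case by (intro pot) (auto simp: space_restrict_space)
    qed
  qed
  also have "\<dots> = R / 2 * X"
    using integral_snd[of "\<lambda>\<omega> t. (norm (h t \<omega>))\<^sup>2"] h2 by (simp add: X)
  finally have ha_le: "(\<integral>(\<omega>, t). h t \<omega> \<bullet> a t \<omega> \<partial>?Q) \<le> R / 2 * X" .

  have "(\<integral>(\<omega>, t). (norm (b' t \<omega>))\<^sup>2 \<partial>?Q) = (\<Sum>i\<in>UNIV. \<integral>(\<omega>, t). (b' t \<omega> $ i)\<^sup>2 \<partial>?Q)"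
    using Bochner_Integration.integral_sum[of UNIV ?Q "\<lambda>i (\<omega>, t). (b' t \<omega> $ i)\<^sup>2"] b'i2
    by (simp add: sum_sq case_prod_beta')
  also have "\<dots> = (\<Sum>i\<in>UNIV. (\<integral>(\<omega>, t). (b t \<omega> $ i)\<^sup>2 \<partial>?Q) + 2 * (\<integral>(\<omega>, t). c i t \<omega> * b t \<omega> $ i \<partial>?Q)
      + (\<integral>(\<omega>, t). (c i t \<omega>)\<^sup>2 \<partial>?Q))"
  proof (intro sum.cong refl)
    fix i
    have "(\<integral>(\<omega>, t). (b' t \<omega> $ i)\<^sup>2 \<partial>?Q) = (\<integral>z. (case z of (\<omega>, t) \<Rightarrow> (b t \<omega> $ i)\<^sup>2) +
        2 * (case z of (\<omega>, t) \<Rightarrow> c i t \<omega> * b t \<omega> $ i) + (case z of (\<omega>, t) \<Rightarrow> (c i t \<omega>)\<^sup>2) \<partial>?Q)"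
      by (rule Bochner_Integration.integral_cong) (auto simp: c_def power2_eq_square algebra_simps)
    then show "(\<integral>(\<omega>, t). (b' t \<omega> $ i)\<^sup>2 \<partial>?Q) = (\<integral>(\<omega>, t). (b t \<omega> $ i)\<^sup>2 \<partial>?Q)
        + 2 * (\<integral>(\<omega>, t). c i t \<omega> * b t \<omega> $ i \<partial>?Q) + (\<integral>(\<omega>, t). (c i t \<omega>)\<^sup>2 \<partial>?Q)"
      using bi2[of i] cbi[of i] ci2[of i] by simp
  qed
  also have "\<dots> = (\<Sum>i\<in>UNIV. \<integral>(\<omega>, t). (b t \<omega> $ i)\<^sup>2 \<partial>?Q) - 2 * (\<integral>(\<omega>, t). h t \<omega> \<bullet> a t \<omega> \<partial>?Q) + Y"
    unfolding cross ha_sum Y_def by (simp add: sum.distrib sum_distrib_left sum_negf sum_subtractf)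
  also have "(\<Sum>i\<in>UNIV. \<integral>(\<omega>, t). (b t \<omega> $ i)\<^sup>2 \<partial>?Q) = (\<integral>(\<omega>, t). (norm (b t \<omega>))\<^sup>2 \<partial>?Q)"
    using Bochner_Integration.integral_sum[of UNIV ?Q "\<lambda>i (\<omega>, t). (b t \<omega> $ i)\<^sup>2"] bi2
    by (simp add: sum_sq case_prod_beta')
  finally show "(\<integral>(\<omega>, t). (norm (b t \<omega>))\<^sup>2 \<partial>?Q) \<le> (\<integral>(\<omega>, t). (norm (b' t \<omega>))\<^sup>2 \<partial>?Q)"
    using ha_le RX by simp
qed

end

section \<open>Minimality of the energy\<close>

lemma nn_energy_eq:
  fixes v :: "real \<Rightarrow> 'a \<Rightarrow> real ^ 'n"
  assumes M: "prob_space M" and v: "jointly_measurable M T v"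
  shows "(\<integral>\<^sup>+\<omega>. (\<integral>\<^sup>+t\<in>{0..T}. ennreal ((norm (v t \<omega>))\<^sup>2) \<partial>lborel) \<partial>M)
    = (\<integral>\<^sup>+(\<omega>, t). ennreal ((norm (v t \<omega>))\<^sup>2) \<partial>(M \<Otimes>\<^sub>M time_measure T))"
proof -
  interpret M: prob_space M by (rule M)
  interpret N: finite_measure "time_measure T" by (rule finite_measure_restrict_lborel)
  have "(\<lambda>(\<omega>, t). ennreal ((norm (v t \<omega>))\<^sup>2)) \<in> borel_measurable (M \<Otimes>\<^sub>M time_measure T)"
    using jointly_measurable_swap[OF v] by (simp add: case_prod_beta')
  from N.nn_integral_fst[OF this] show ?thesis by (simp add: nn_integral_restrict_space)
qed

text \<open>
  Used to pass from the drift of \<open>g\<close> to the version of its mean derivative along a path; the new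
  function is known to be measurable on \<open>[0, T]\<close> only.
\<close>

lemma set_integrable_AE_cong:
  fixes f g :: "real \<Rightarrow> real ^ 'n"
  assumes g: "set_integrable lborel {0..T} g" and f: "f \<in> borel_measurable (time_measure T)"
    and eq: "AE t in lborel. t \<in> {0..T} \<longrightarrow> f t = g t"
  shows "set_integrable lborel {0..T} f" "\<And>t. t \<le> T \<Longrightarrow> (LBINT s:{0..t}. f s) = (LBINT s:{0..t}. g s)"
proof -
  have fm: "(\<lambda>t. indicator {0..T} t *\<^sub>R f t) \<in> borel_measurable lborel"
    using f by (subst (asm) borel_measurable_restrict_space_iff) auto
  have gm: "(\<lambda>t. indicator {0..T} t *\<^sub>R g t) \<in> borel_measurable lborel"
    using g by (auto simp: set_integrable_def)
  have "AE t in lborel. indicator {0..T} t *\<^sub>R f t = indicator {0..T} t *\<^sub>R g t"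
    using eq by eventually_elim (auto simp: indicator_def)
  from integrable_cong_AE[OF fm gm this] show "set_integrable lborel {0..T} f"
    using g by (simp add: set_integrable_def)
  fix t assume t: "t \<le> T"
  have *: "indicator {0..t} s *\<^sub>R q s = indicator {0..t} s *\<^sub>R (indicator {0..T} s *\<^sub>R q s)" for s and q :: "real \<Rightarrow> real ^ 'n"
    using t by (auto simp: indicator_def)
  show "(LBINT s:{0..t}. f s) = (LBINT s:{0..t}. g s)"
    unfolding set_lebesgue_integral_def
  proof (rule integral_cong_AE)
    show "(\<lambda>s. indicator {0..t} s *\<^sub>R f s) \<in> borel_measurable lborel"
      "(\<lambda>s. indicator {0..t} s *\<^sub>R g s) \<in> borel_measurable lborel"
      by (subst *, intro borel_measurable_scaleR fm gm borel_measurable_indicator, simp)+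
    show "AE s in lborel. indicator {0..t} s *\<^sub>R f s = indicator {0..t} s *\<^sub>R g s"
      using eq by eventually_elim (use t in \<open>auto simp: indicator_def\<close>)
  qed
qed

theorem theorem3p2:
  fixes M :: "'a measure" and F :: "real \<Rightarrow> 'a measure"
    and T \<nu> R :: real
    and w g :: "real \<Rightarrow> 'a \<Rightarrow> real ^ 'n"
    and u :: "real \<Rightarrow> real ^ 'n \<Rightarrow> real ^ 'n"
    and p :: "real \<Rightarrow> real ^ 'n \<Rightarrow> real"
  assumes "T > 0" and "\<nu> > 0"
    and "filtered_prob_space M F"
    and "brownian_motion M F T w"
    and "g \<in> \<D> M F T \<nu>"
    and "solves_sde M T \<nu> w g (\<lambda>t \<omega>. - u (T - t) (g t \<omega>))"
    and "regular_pressure T p"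
    and "navier_stokes_solution T \<nu> u p"
    and "\<And>t. 0 \<le> t \<Longrightarrow> t < T \<Longrightarrow>
           mean_derivative_at M F (\<lambda>s \<omega>. - u (T - s) (g s \<omega>)) t (\<lambda>\<omega>. - grad (p t) (g t \<omega>))"
    and "\<And>t x \<xi>. 0 \<le> t \<Longrightarrow> t \<le> T \<Longrightarrow> \<xi> \<bullet> (hessian (p t) x *v \<xi>) \<le> R * (\<xi> \<bullet> \<xi>)"
    and "R * T\<^sup>2 \<le> pi\<^sup>2"
  shows "is_arg_min (energy M F T) (\<lambda>g'. g' \<in> competitors M F T \<nu> w g) g"
proof -
  note T = assms(1) and filt = assms(3) and w = assms(4) and sde = assms(6) and R = assms(11)
  interpret M: prob_space M by (rule prob_space_M[OF filt])
  let ?N = "time_measure T"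
  let ?Q = "M \<Otimes>\<^sub>M ?N"
  define b where "b t \<omega> = - u (T - t) (g t \<omega>)" for t \<omega>
  define a where "a t \<omega> = - grad (p t) (g t \<omega>)" for t \<omega>

  have uc: "continuous_on ({0..T} \<times> UNIV) (\<lambda>(t, x). u t x)" and up: "\<And>t. t \<in> {0..T} \<Longrightarrow> periodic (u t)"
    using assms(8) by (auto simp: navier_stokes_solution_def)
  have pc: "continuous_on ({0..T} \<times> UNIV) (\<lambda>(t, x). p t x)"
    and gc: "continuous_on ({0..T} \<times> UNIV) (\<lambda>(t, x). grad (p t) x)"
    and pp: "\<And>t. t \<in> {0..T} \<Longrightarrow> periodic (p t)" and p2: "\<And>t. t \<in> {0..T} \<Longrightarrow> C2 (p t)"
    using assms(7) by (auto simp: regular_pressure_def)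
  have gp: "periodic (grad (p t))" if "t \<in> {0..T}" for t
    using periodic_grad[OF pp[OF that]] p2[OF that] by (simp add: C2_def)
  obtain B1 where B1: "\<forall>t\<in>{0..T}. \<forall>x. norm (u t x) \<le> B1"
    using periodic_family_bounded[OF uc up] by blast
  obtain B2 where B2: "\<forall>t\<in>{0..T}. \<forall>x. norm (grad (p t) x) \<le> B2"
    using periodic_family_bounded[OF gc gp] by blast
  define B where "B = max B1 B2"

  have inc: "incompressible M T g"
    and g_ad: "adapted F T g" and g_cont: "\<And>\<omega>. \<omega> \<in> space M \<Longrightarrow> continuous_on {0..T} (\<lambda>t. g t \<omega>)"
    using assms(5) by (auto simp: incompressible_diffusions_def brownian_with_drift_def)
  have g_S: "g \<in> \<S> M F T \<nu>"
    using assms(5) by (auto simp: incompressible_diffusions_def incompressible_semimartingales_def)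

  have along_path: "continuous_on {0..T} (\<lambda>t. f (r t) (g t \<omega>))"
    if "continuous_on ({0..T} \<times> UNIV) (\<lambda>(t, x). f t x)" "continuous_on {0..T} r" "r ` {0..T} \<subseteq> {0..T}" "\<omega> \<in> space M"
    for f :: "real \<Rightarrow> real ^ 'n \<Rightarrow> real ^ 'n" and r \<omega>
    using continuous_on_compose2[OF that(1) continuous_on_Pair[OF that(2) g_cont[OF that(4)]]] that(3) by auto
  have at_time: "(\<lambda>\<omega>. f t (g t \<omega>)) \<in> borel_measurable (F t)"
    if "continuous_on UNIV (f t)" "t \<in> {0..T}" for f :: "real \<Rightarrow> real ^ 'n \<Rightarrow> real ^ 'n" and t
    using borel_measurable_continuous_onI[OF that(1)] g_ad that(2)
    by (auto simp: adapted_def intro: measurable_compose)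

  have b_ad: "adapted F T b"
    unfolding adapted_def
  proof
    fix t assume t: "t \<in> {0..T}"
    have "continuous_on UNIV (u (T - t))" by (rule continuous_on_slice[OF uc]) (use t in auto)
    then show "b t \<in> borel_measurable (F t)"
      unfolding b_def[abs_def] by (intro at_time[of "\<lambda>t x. - u (T - t) x"] continuous_on_minus t)
  qed
  have b_cont: "continuous_on {0..T} (\<lambda>t. b t \<omega>)" if "\<omega> \<in> space M" for \<omega>
    unfolding b_def by (intro continuous_on_minus along_path[of u] uc that continuous_intros) auto
  have b_bd: "norm (b t \<omega>) \<le> B" if "t \<in> {0..T}" for t \<omega>
    using B1[rule_format, of "T - t" "g t \<omega>"] that by (simp add: b_def B_def)
  have a_ad: "adapted F T a"
    unfolding adapted_def
  proof
    fix t assume t: "t \<in> {0..T}"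
    have "continuous_on UNIV (\<lambda>x. grad (p t) x)" by (rule continuous_on_slice[OF gc t])
    then show "a t \<in> borel_measurable (F t)"
      unfolding a_def[abs_def] by (intro at_time[of "\<lambda>t x. - grad (p t) x"] continuous_on_minus t)
  qed
  have a_cont: "continuous_on {0..T} (\<lambda>t. a t \<omega>)" if "\<omega> \<in> space M" for \<omega>
    unfolding a_def by (intro continuous_on_minus along_path[of "\<lambda>t. grad (p t)"] gc that continuous_intros) auto
  have a_bd: "norm (a t \<omega>) \<le> B" if "t \<in> {0..T}" for t \<omega>
    using B2[rule_format, of t "g t \<omega>"] that by (simp add: a_def B_def)
  have md: "mean_derivative_at M F b t (a t)" if "0 \<le> t" "t < T" for t
    using assms(9)[OF that] by (simp add: b_def[abs_def] a_def[abs_def])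
  have sde_b: "solves_sde M T \<nu> w g b" using sde by (simp add: b_def[abs_def])
  note ctx = filt T b_ad b_cont b_bd a_ad a_cont a_bd md
  have b_jm: "jointly_measurable M T b"
    by (intro jointly_measurable_continuous_process adapted_measurable[OF filt b_ad] b_cont) (use T in auto)

  have b_md: "is_mean_derivative M F T g b"
    unfolding is_mean_derivative_def
    using mean_derivative_at_of_drift[OF filt w _ _ g_ad b_ad b_cont b_bd sde_b] b_ad b_jm by auto
  let ?v = "mean_derivative M F T g"
  note v = mean_derivative_version[OF filt T b_md]

  \<comment> \<open>The class of competitors and the energy refer to the chosen version \<open>?v\<close> of the mean derivative
    of \<open>g\<close>, which has to be traded for \<open>b\<close>.\<close>
  have "solves_sde M T \<nu> w g ?v"
    unfolding solves_sde_def
    using sde_b[unfolded solves_sde_def] v(2) AE_space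
  proof eventually_elim
    case (elim \<omega>)
    have "(\<lambda>(t, \<omega>). ?v t \<omega>) \<in> borel_measurable (?N \<Otimes>\<^sub>M M)"
      using v(1) by (simp add: is_mean_derivative_def jointly_measurable_lborel)
    from measurable_compose[OF measurable_Pair2'[OF elim(3)] this]
    have "(\<lambda>t. ?v t \<omega>) \<in> borel_measurable ?N" by simp
    note cong = set_integrable_AE_cong[OF conjunct1[OF elim(1)] this elim(2)]
    show ?case
    proof (intro conjI ballI)
      fix t assume t: "t \<in> {0..T}"
      then have "(LBINT s:{0..t}. ?v s \<omega>) = (LBINT s:{0..t}. b s \<omega>)" by (intro cong(2)) simp
      with conjunct2[OF elim(1), rule_format, OF t]
      show "g t \<omega> = g 0 \<omega> + sqrt (2 * \<nu>) *\<^sub>R (w t \<omega> - w 0 \<omega>) + (LBINT s:{0..t}. ?v s \<omega>)"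
        by (simp only:)
    qed (rule cong(1))
  qed
  then have g_comp: "g \<in> competitors M F T \<nu> w g"
    using g_S b_md by (auto simp: competitors_def)

  have "(\<integral>\<^sup>+\<omega>. (\<integral>\<^sup>+t\<in>{0..T}. ennreal ((norm (?v t \<omega>))\<^sup>2) \<partial>lborel) \<partial>M)
      = (\<integral>\<^sup>+\<omega>. (\<integral>\<^sup>+t\<in>{0..T}. ennreal ((norm (b t \<omega>))\<^sup>2) \<partial>lborel) \<partial>M)"
  proof (rule nn_integral_cong_AE)
    show "AE \<omega> in M. (\<integral>\<^sup>+t\<in>{0..T}. ennreal ((norm (?v t \<omega>))\<^sup>2) \<partial>lborel) = (\<integral>\<^sup>+t\<in>{0..T}. ennreal ((norm (b t \<omega>))\<^sup>2) \<partial>lborel)"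
      using v(2)
    proof eventually_elim
      case (elim \<omega>)
      show ?case
      proof (rule nn_integral_cong_AE)
        show "AE t in lborel. ennreal ((norm (?v t \<omega>))\<^sup>2) * indicator {0..T} t
            = ennreal ((norm (b t \<omega>))\<^sup>2) * indicator {0..T} t"
          using elim by eventually_elim (simp split: split_indicator)
      qed
    qed
  qed
  then have energy_g: "energy M F T g = (\<integral>\<^sup>+(\<omega>, t). ennreal ((norm (b t \<omega>))\<^sup>2) \<partial>?Q) / 2"
    by (simp add: energy_def nn_energy_eq[OF M.prob_space_axioms b_jm])

  have "energy M F T g \<le> energy M F T g'" if "g' \<in> competitors M F T \<nu> w g" for g'
  proof -
    define b' where "b' = mean_derivative M F T g'"
    have g'_S: "g' \<in> \<S> M F T \<nu>" and ex: "\<exists>b. is_mean_derivative M F T g' b"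
      and sde': "solves_sde M T \<nu> w g' b'"
      and g'0: "AE \<omega> in M. g' 0 \<omega> = g 0 \<omega>" and g'T: "AE \<omega> in M. g' T \<omega> = g T \<omega>"
      using that by (auto simp: competitors_def b'_def)
    have inc': "incompressible M T g'" and g'_ad: "adapted F T g'"
      and g'_cont: "\<And>\<omega>. \<omega> \<in> space M \<Longrightarrow> continuous_on {0..T} (\<lambda>t. g' t \<omega>)"
      using g'_S by (auto simp: incompressible_semimartingales_def brownian_with_drift_def)
    have "is_mean_derivative M F T g' b'"
      using ex mean_derivative_version(1)[OF filt T] unfolding b'_def by blast
    then have b'_ad: "adapted F T b'" and b'_jm: "jointly_measurable M T b'"
      by (auto simp: is_mean_derivative_def)
    have energy_g': "energy M F T g' = (\<integral>\<^sup>+(\<omega>, t). ennreal ((norm (b' t \<omega>))\<^sup>2) \<partial>?Q) / 2"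
      by (simp add: energy_def b'_def[symmetric] nn_energy_eq[OF M.prob_space_axioms b'_jm])
    show ?thesis
    proof (cases "(\<integral>\<^sup>+(\<omega>, t). ennreal ((norm (b' t \<omega>))\<^sup>2) \<partial>?Q) = \<infinity>")
      case True
      then show ?thesis by (simp add: energy_g' ennreal_top_divide)
    next
      case False
      have b'2: "integrable ?Q (\<lambda>(\<omega>, t). (norm (b' t \<omega>))\<^sup>2)"
      proof (rule integrableI_nonneg)
        show "(\<lambda>(\<omega>, t). (norm (b' t \<omega>))\<^sup>2) \<in> borel_measurable ?Q"
          using jointly_measurable_swap[OF b'_jm] by (simp add: case_prod_beta')
        show "(\<integral>\<^sup>+z. ennreal (case z of (\<omega>, t) \<Rightarrow> (norm (b' t \<omega>))\<^sup>2) \<partial>?Q) < \<infinity>"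
          using False by (simp add: case_prod_beta' less_top)
      qed auto
      define h where "h t \<omega> = g' t \<omega> - g t \<omega>" for t \<omega>
      have g_meas: "g t \<in> borel_measurable M" and g'_meas: "g' t \<in> borel_measurable M" if "t \<in> {0..T}" for t
        using adapted_measurable[OF filt g_ad that] adapted_measurable[OF filt g'_ad that] by auto
      have h_jm: "jointly_measurable M T h"
        unfolding h_def[abs_def]
        by (intro jointly_measurable_continuous_process borel_measurable_diff g_meas g'_meas
            continuous_on_diff g_cont g'_cont) (use T in auto)
      have h_eq: "AE \<omega> in M. set_integrable lborel {0..T} (\<lambda>s. b' s \<omega> - b s \<omega>) \<and>
          (\<forall>t\<in>{0..T}. h t \<omega> = (LBINT s:{0..t}. b' s \<omega> - b s \<omega>))"
        using sde_b[unfolded solves_sde_def] sde'[unfolded solves_sde_def] g'0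
      proof eventually_elim
        case (elim \<omega>)
        have "h t \<omega> = (LBINT s:{0..t}. b' s \<omega> - b s \<omega>)" if t: "t \<in> {0..T}" for t
        proof -
          have "set_integrable lborel {0..t} (\<lambda>s. b' s \<omega>)" "set_integrable lborel {0..t} (\<lambda>s. b s \<omega>)"
            by (rule set_integrable_subset[OF conjunct1[OF elim(2)]]; use t in simp)
              (rule set_integrable_subset[OF conjunct1[OF elim(1)]]; use t in simp)
          from set_integral_diff(2)[OF this] conjunct2[OF elim(1), rule_format, OF t]
            conjunct2[OF elim(2), rule_format, OF t] elim(3)
          show ?thesis by (simp add: h_def)
        qed
        then show ?case
          using set_integral_diff(1)[OF conjunct1[OF elim(2)] conjunct1[OF elim(1)]] by blast
      qed
      have hT: "AE \<omega> in M. h T \<omega> = 0" using g'T by eventually_elim (simp add: h_def)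
      have pot: "(\<integral>\<omega>. h t \<omega> \<bullet> a t \<omega> \<partial>M) \<le> R / 2 * (\<integral>\<omega>. (norm (h t \<omega>))\<^sup>2 \<partial>M)"
        if t: "0 < t" "t \<le> T" and h2: "integrable M (\<lambda>\<omega>. (norm (h t \<omega>))\<^sup>2)" for t
      proof -
        have t': "t \<in> {0..T}" using t by simp
        have ptc: "continuous_on UNIV (p t)" by (rule continuous_on_slice[OF pc t'])
        obtain K where K: "\<forall>t\<in>{0..T}. \<forall>x. norm (p t x) \<le> K"
          using periodic_family_bounded[OF pc pp] by blast
        have p_int: "integrable M (\<lambda>\<omega>. p t (q \<omega>))" if "q \<in> borel_measurable M" for q
          by (rule M.integrable_const_bound[where B = K])
            (use K[rule_format, OF t'] measurable_compose[OF that borel_measurable_continuous_onI[OF ptc]] in auto)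
        have hm: "h t \<in> borel_measurable M"
          unfolding h_def[abs_def] by (intro borel_measurable_diff g_meas g'_meas t')
        have am: "a t \<in> borel_measurable M" by (rule adapted_measurable[OF filt a_ad t'])
        have h1: "integrable M (\<lambda>\<omega>. norm (h t \<omega>))"
          by (rule M.integrable_of_square_integrable) (use hm h2 in auto)
        have ha: "integrable M (\<lambda>\<omega>. h t \<omega> \<bullet> a t \<omega>)"
        proof (rule Bochner_Integration.integrable_bound)
          show "integrable M (\<lambda>\<omega>. norm (h t \<omega>) * B)" using h1 by simp
          show "AE \<omega> in M. norm (h t \<omega> \<bullet> a t \<omega>) \<le> norm (norm (h t \<omega>) * B)"
          proof (rule AE_I2)
            fix \<omega>
            have "norm (h t \<omega> \<bullet> a t \<omega>) \<le> norm (h t \<omega>) * norm (a t \<omega>)" by (rule Cauchy_Schwarz_ineq2[folded real_norm_def])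
            also have "\<dots> \<le> norm (h t \<omega>) * B" by (intro mult_left_mono a_bd t') auto
            finally show "norm (h t \<omega> \<bullet> a t \<omega>) \<le> norm (norm (h t \<omega>) * B)" by simp
          qed
        qed (use hm am in auto)
        have p_eq: "(\<integral>\<omega>. p t (g' t \<omega>) \<partial>M) = (\<integral>\<omega>. p t (g t \<omega>) \<partial>M)"
          using inc inc' t pp[OF t'] ptc by (simp add: incompressible_def)
        have hess: "\<xi> \<bullet> (hessian (p t) x *v \<xi>) \<le> R * (\<xi> \<bullet> \<xi>)" for x \<xi>
          using assms(10) t by simp
        have "(\<integral>\<omega>. p t (g' t \<omega>) \<partial>M) \<le>
            (\<integral>\<omega>. p t (g t \<omega>) - h t \<omega> \<bullet> a t \<omega> + R / 2 * (norm (h t \<omega>))\<^sup>2 \<partial>M)"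
        proof (rule integral_mono)
          show "p t (g' t \<omega>) \<le> p t (g t \<omega>) - h t \<omega> \<bullet> a t \<omega> + R / 2 * (norm (h t \<omega>))\<^sup>2" for \<omega>
            using C2_taylor_upper[OF p2[OF t'] hess, where y = "g' t \<omega>" and x = "g t \<omega>"]
            by (simp add: h_def a_def power2_norm_eq_inner inner_commute)
        qed (use p_int g_meas[OF t'] g'_meas[OF t'] ha h2 in auto)
        then show ?thesis
          unfolding p_eq using p_int[OF g_meas[OF t']] ha h2 by simp
      qed
      note min = energy_minimal_of_potential_bound[OF ctx b'_ad b'_jm b'2 h_jm h_eq hT pot R]
      have "(\<integral>\<^sup>+(\<omega>, t). ennreal ((norm (b t \<omega>))\<^sup>2) \<partial>?Q) = ennreal (\<integral>(\<omega>, t). (norm (b t \<omega>))\<^sup>2 \<partial>?Q)"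
        "(\<integral>\<^sup>+(\<omega>, t). ennreal ((norm (b' t \<omega>))\<^sup>2) \<partial>?Q) = ennreal (\<integral>(\<omega>, t). (norm (b' t \<omega>))\<^sup>2 \<partial>?Q)"
        using nn_integral_eq_integral[OF min(1)] nn_integral_eq_integral[OF b'2] by (simp_all add: case_prod_beta')
      then have "(\<integral>\<^sup>+(\<omega>, t). ennreal ((norm (b t \<omega>))\<^sup>2) \<partial>?Q) \<le> (\<integral>\<^sup>+(\<omega>, t). ennreal ((norm (b' t \<omega>))\<^sup>2) \<partial>?Q)"
        using min(2) by (simp add: ennreal_leI)
      then show ?thesis unfolding energy_g energy_g' by (rule divide_right_mono_ennreal)
    qed
  qed
  then show ?thesis using g_comp by (auto simp: is_arg_min_def not_less)
qed

end
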